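(* Let $d\in\mathbb{N}$ and let $X=\{X_{\underline{n}}\}_{\underline{n}\in\mathbb{Z}_+^d}$ be a proper product system over $\mathbb{Z}_+^d$ with coefficients in a C*-algebra $A$. Then the following hold: (i) the NT-$2^d$-tuples of $X$ are exactly the T-families of $X$ (i.e., a $2^d$-tuple $\mathcal{L}$ of $X$ is an NT-$2^d$-tuple of $X$ if and only if it is a T-family of $X$), and (ii) the NO-$2^d$-tuples of $X$ are exactly the O-families of $X$.
   Context: Ideals of C*-algebras are two-sided and norm-closed. $[S]$ is the norm-closed linear span of $S$. For an ideal $I\subseteq A$, $I^\perp=\{a\in A: aI=\{0\}\}$. Expressions such as $\langle X,aX\rangle$ denote the set $\{\langle\xi,a\eta\rangle:\xi,\eta\in X\}$. C*-correspondences. A C*-correspondence $X$ over $A$ is a right Hilbert $A$-module with a $*$-homomorphism $\phi_X:A\to\mathcal{L}(X)$ into the adjointable operators (the left action; $a\xi:=\phi_X(a)\xi$). $\mathcal{K}(X)$ is the closed linear span of the operators $\Theta_{\xi,\eta}:\zeta\mapsto\xi\langle\eta,\zeta\rangle$. No non-degeneracy is assumed. $A$ is a C*-correspondence over itself by multiplication, with $\langle a,b\rangle=a^*b$. For an ideal $I\subseteq A$, $XI=\{\xi a:\xi\in X,a\in I\}$ (a closed submodule) and $\mathcal{K}(XI)$ is identified with the ideal $\overline{\mathrm{span}}\{\Theta_{\xi,\eta}:\xi,\eta\in XI\}$ of $\mathcal{L}(X)$. Notation in $\mathbb{Z}_+^d$. $\mathbb{Z}_+=\{0,1,\dots\}$,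 $[d]=\{1,\dots,d\}$, $\underline{i}$ ($i\in[d]$) are the standard generators, $\le$ is the entrywise order, $\mathrm{supp}\,\underline{n}=\{i:n_i\ne0\}$, $\underline{n}\perp F$ means $\mathrm{supp}\,\underline{n}\cap F=\emptyset$, and $\underline{1}_F=\sum_{i\in F}\underline{i}$. Product systems. A product system over $\mathbb{Z}_+^d$ with coefficients in $A$ is a family $\{X_{\underline{n}}\}_{\underline{n}\in\mathbb{Z}_+^d}$ of C*-correspondences over $A$ (left actions $\phi_{\underline{n}}$) with multiplication maps $u_{\underline{n},\underline{m}}:X_{\underline{n}}\otimes_AX_{\underline{m}}\to X_{\underline{n}+\underline{m}}$ such that: $X_{\underline{0}}=A$; $u_{\underline{0},\underline{m}}:A\otimes_AX_{\underline{m}}\to[\phi_{\underline{m}}(A)X_{\underline{m}}]$ is the unitary $a\otimes\xi\mapsto\phi_{\underline{m}}(a)\xi$; $u_{\underline{n},\underline{0}}$ is the unitary $\xi\otimes a\mapsto\xi a$; for $\underline{n},\underline{m}\neq\underline{0}$, $u_{\underline{n},\underline{m}}$ is a unitary (surjective inner-product-preserving $A$-bimodule map) onto $X_{\underline{n}+\underline{m}}$; and the maps are associative. $X$ is proper if $\phi_{\underline{n}}(A)\subseteq\mathcal{K}(X_{\underline{n}})$ for all $\underline{n}$. Ideals. For an ideal $I\subseteq A$, $X_{\underline{n}}^{-1}(I)=\{a\in A:\langle X_{\underline{n}},aX_{\underline{n}}\rangle\subseteq I\}$. For $\emptyset\ne F\subseteq[d]$, $X_F^{-1}(I)=\bigcap\{X_{\underline{n}}^{-1}(I):\underline{0}\neq\underline{n}\le\underline{1}_F\}$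 and (for proper $X$) $J_F(I,X)=\{a\in A:aX_F^{-1}(I)\subseteq I\}$. Also $\mathcal{J}_\emptyset=\{0\}$, $\mathcal{J}_F=(\bigcap_{i\in F}\ker\phi_{\underline{i}})^\perp$ for $F\neq\emptyset$, and $\mathcal{I}_F=\bigcap\{X_{\underline{n}}^{-1}(\mathcal{J}_F):\underline{n}\perp F\}$ for $F\subseteq[d]$ (so $\mathcal{I}_\emptyset=\{0\}$). $2^d$-tuples. A $2^d$-tuple of $X$ is a family $\mathcal{L}=\{\mathcal{L}_F\}_{F\subseteq[d]}$ of non-empty subsets of $A$. $\mathcal{L}\subseteq\mathcal{L}'$ means $\mathcal{L}_F\subseteq\mathcal{L}'_F$ for all $F$. $\mathcal{L}$ is $X$-invariant if $[\langle X_{\underline{n}},\mathcal{L}_FX_{\underline{n}}\rangle]\subseteq\mathcal{L}_F$ for all $F\subseteq[d]$ and $\underline{n}\perp F$; it is partially ordered if $\mathcal{L}_{F_1}\subseteq\mathcal{L}_{F_2}$ whenever $F_1\subseteq F_2\subseteq[d]$. If $\mathcal{L}$ consists of ideals and $\emptyset\ne F\subsetneq[d]$, set $\mathcal{L}_{\mathrm{inv},F}=\bigcap_{\underline{n}\perp F}X_{\underline{n}}^{-1}\big(\bigcap_{F\subsetneq D\subseteq[d]}\mathcal{L}_D\big)$ and $\mathcal{L}_{\lim,F}=\{a\in A:\lim_{\underline{n}\perp F}\|\phi_{\underline{n}}(a)+\mathcal{K}(X_{\underline{n}}\mathcal{L}_F)\|=0\}$, where the norm is the quotient norm in $\mathcal{L}(X_{\underline{n}})/\mathcal{K}(X_{\underline{n}}\mathcal{L}_F)$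 and the limit is over the directed set $\{\underline{n}:\underline{n}\perp F\}$. NT-$2^d$-tuple: a $2^d$-tuple $\mathcal{L}$ such that (1) $\mathcal{L}$ consists of ideals and $\mathcal{L}_F\subseteq J_F(\mathcal{L}_\emptyset,X)$ for all $\emptyset\ne F\subseteq[d]$; (2) $\mathcal{L}$ is $X$-invariant; (3) $\mathcal{L}$ is partially ordered; (4) $\big(\bigcap_{\underline{n}\perp F}X_{\underline{n}}^{-1}(J_F(\mathcal{L}_\emptyset,X))\big)\cap\mathcal{L}_{\mathrm{inv},F}\cap\mathcal{L}_{\lim,F}\subseteq\mathcal{L}_F$ for all $\emptyset\neq F\subsetneq[d]$. NO-$2^d$-tuple: an NT-$2^d$-tuple $\mathcal{L}$ with $\mathcal{I}\subseteq\mathcal{L}$. T-family: a $2^d$-tuple $\mathcal{L}$ consisting of ideals with $\mathcal{L}_F=X_{\underline{i}}^{-1}(\mathcal{L}_F)\cap\mathcal{L}_{F\cup\{i\}}$ for all $F\subsetneq[d]$ and $i\in[d]\setminus F$. O-family: a T-family $\mathcal{L}$ with $\mathcal{I}\subseteq\mathcal{L}$. *)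

theory Defs
  imports "HOL-Analysis.Analysis" "HOL-Library.Function_Algebras"
begin

section \<open>Complex vector spaces and C*-algebras\<close>

class scaleC =
  fixes scaleC :: "complex \<Rightarrow> 'a \<Rightarrow> 'a" (infixr "*\<^sub>C" 75)

class complex_vector = scaleC + ab_group_add +
  assumes scaleC_add_right: "c *\<^sub>C (x + y) = c *\<^sub>C x + c *\<^sub>C y"
    and scaleC_add_left: "(b + c) *\<^sub>C x = b *\<^sub>C x + c *\<^sub>C x"
    and scaleC_scaleC: "b *\<^sub>C c *\<^sub>C x = (b * c) *\<^sub>C x"
    and scaleC_one: "1 *\<^sub>C x = x"

lemma module_scaleC: "module (scaleC :: complex \<Rightarrow> 'a::complex_vector \<Rightarrow> 'a)"
  by unfold_locales
    (simp_all add: scaleC_add_right scaleC_add_left scaleC_scaleC scaleC_one)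

abbreviation csubspace :: "'a::complex_vector set \<Rightarrow> bool"
  where "csubspace \<equiv> module.subspace scaleC"

abbreviation cspan :: "'a::complex_vector set \<Rightarrow> 'a set"
  where "cspan \<equiv> module.span scaleC"

text \<open>Operators are functions, added and scaled pointwise.\<close>

instantiation "fun" :: (type, complex_vector) complex_vector
begin

definition scaleC_fun_def: "c *\<^sub>C f = (\<lambda>x. c *\<^sub>C f x)"

instance
  by standard
    (simp_all add: scaleC_fun_def fun_eq_iff scaleC_add_right scaleC_add_left
      scaleC_scaleC scaleC_one)

end

text \<open>C*-algebras need not be unital, and the zero algebra is allowed.\<close>

class cstar_algebra = complex_vector + real_normed_algebra + banach +
  fixes star :: "'a \<Rightarrow> 'a"
  assumes scaleR_scaleC: "r *\<^sub>R x = complex_of_real r *\<^sub>C x"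
    and norm_scaleC: "norm (c *\<^sub>C x) = cmod c * norm x"
    and mult_scaleC_left: "(c *\<^sub>C x) * y = c *\<^sub>C (x * y)"
    and mult_scaleC_right: "x * (c *\<^sub>C y) = c *\<^sub>C (x * y)"
    and star_star: "star (star x) = x"
    and star_add: "star (x + y) = star x + star y"
    and star_scaleC: "star (c *\<^sub>C x) = cnj c *\<^sub>C star x"
    and star_mult: "star (x * y) = star y * star x"
    and cstar_identity: "norm (star x * x) = (norm x)\<^sup>2"

text \<open>\<open>a \<ge> 0\<close>; in this form no spectra (hence no unitisation) are needed.\<close>

definition cstar_positive :: "'a::cstar_algebra \<Rightarrow> bool"
  where "cstar_positive a \<longleftrightarrow> (\<exists>b. a = star b * b)"

definition cstar_ideal :: "'a::cstar_algebra set \<Rightarrow> bool"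
  where "cstar_ideal I \<longleftrightarrow>
    csubspace I \<and> closed I \<and> (\<forall>a. \<forall>x\<in>I. a * x \<in> I \<and> x * a \<in> I)"

definition cclosed_span :: "'a::cstar_algebra set \<Rightarrow> 'a set"
  where "cclosed_span S = closure (cspan S)"

definition annihilator :: "'a::cstar_algebra set \<Rightarrow> 'a set"
  where "annihilator I = {a. \<forall>x\<in>I. a * x = 0}"


section \<open>Hilbert modules and C*-correspondences\<close>

text \<open>
  The underlying vector space of a module is a subspace \<open>carr\<close> of an ambient complex vector
  space, so that a whole family of modules can live over one type. The module operations
  and the inner product belong to the individual module; their values outside \<open>carr\<close> are
  irrelevant. The field \<open>ip\<close> is the \<open>A\<close>-valued inner product, linear in its second argument,
  and \<open>lact\<close> is \<open>\<phi>\<^sub>X\<close>.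
\<close>

record ('a, 'x) corr =
  carr :: "'x set"
  ract :: "'x \<Rightarrow> 'a \<Rightarrow> 'x"
  ip :: "'x \<Rightarrow> 'x \<Rightarrow> 'a"
  lact :: "'a \<Rightarrow> 'x \<Rightarrow> 'x"

definition hnorm :: "('a::cstar_algebra, 'x) corr \<Rightarrow> 'x \<Rightarrow> real"
  where "hnorm X \<xi> = sqrt (norm (ip X \<xi> \<xi>))"

locale hilbert_module =
  fixes X :: "('a::cstar_algebra, 'x::complex_vector) corr"
  assumes carr_subspace: "csubspace (carr X)"
    and ract_closed: "\<xi> \<in> carr X \<Longrightarrow> ract X \<xi> a \<in> carr X"
    and ract_add_left: "\<xi> \<in> carr X \<Longrightarrow> \<eta> \<in> carr X \<Longrightarrow>
      ract X (\<xi> + \<eta>) a = ract X \<xi> a + ract X \<eta> a"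
    and ract_add_right: "\<xi> \<in> carr X \<Longrightarrow> ract X \<xi> (a + b) = ract X \<xi> a + ract X \<xi> b"
    and ract_mult: "\<xi> \<in> carr X \<Longrightarrow> ract X \<xi> (a * b) = ract X (ract X \<xi> a) b"
    and ract_scaleC_left: "\<xi> \<in> carr X \<Longrightarrow> ract X (c *\<^sub>C \<xi>) a = c *\<^sub>C ract X \<xi> a"
    and ract_scaleC_right: "\<xi> \<in> carr X \<Longrightarrow> ract X \<xi> (c *\<^sub>C a) = c *\<^sub>C ract X \<xi> a"
    and ip_add: "\<xi> \<in> carr X \<Longrightarrow> \<eta> \<in> carr X \<Longrightarrow> \<zeta> \<in> carr X \<Longrightarrow>
      ip X \<xi> (\<eta> + \<zeta>) = ip X \<xi> \<eta> + ip X \<xi> \<zeta>"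
    and ip_scaleC: "\<xi> \<in> carr X \<Longrightarrow> \<eta> \<in> carr X \<Longrightarrow> ip X \<xi> (c *\<^sub>C \<eta>) = c *\<^sub>C ip X \<xi> \<eta>"
    and ip_ract: "\<xi> \<in> carr X \<Longrightarrow> \<eta> \<in> carr X \<Longrightarrow> ip X \<xi> (ract X \<eta> a) = ip X \<xi> \<eta> * a"
    and ip_star: "\<xi> \<in> carr X \<Longrightarrow> \<eta> \<in> carr X \<Longrightarrow> star (ip X \<xi> \<eta>) = ip X \<eta> \<xi>"
    and ip_positive: "\<xi> \<in> carr X \<Longrightarrow> cstar_positive (ip X \<xi> \<xi>)"
    and ip_definite: "\<xi> \<in> carr X \<Longrightarrow> ip X \<xi> \<xi> = 0 \<Longrightarrow> \<xi> = 0"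
    and complete: "(\<And>k. s k \<in> carr X) \<Longrightarrow>
      (\<And>\<epsilon>. \<epsilon> > 0 \<Longrightarrow> \<exists>N. \<forall>j\<ge>N. \<forall>k\<ge>N. hnorm X (s j - s k) < \<epsilon>) \<Longrightarrow>
      \<exists>\<xi>\<in>carr X. (\<lambda>k. hnorm X (s k - \<xi>)) \<longlonglongrightarrow> 0"

definition hclosed_span ::
    "('a::cstar_algebra, 'x::complex_vector) corr \<Rightarrow> 'x set \<Rightarrow> 'x set"
  where "hclosed_span X S =
    {\<xi> \<in> carr X. \<forall>\<epsilon>>0. \<exists>\<eta>\<in>cspan S. hnorm X (\<xi> - \<eta>) < \<epsilon>}"

definition adjointables ::
    "('a::cstar_algebra, 'x) corr \<Rightarrow> ('x \<Rightarrow> 'x) set"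
  where "adjointables X = {T. (\<forall>\<xi>\<in>carr X. T \<xi> \<in> carr X) \<and>
    (\<exists>S. (\<forall>\<xi>\<in>carr X. S \<xi> \<in> carr X) \<and>
      (\<forall>\<xi>\<in>carr X. \<forall>\<eta>\<in>carr X. ip X (T \<xi>) \<eta> = ip X \<xi> (S \<eta>)))}"

definition op_norm :: "('a::cstar_algebra, 'x) corr \<Rightarrow> ('x \<Rightarrow> 'x) \<Rightarrow> real"
  where "op_norm X T = (SUP \<xi>\<in>{\<xi> \<in> carr X. hnorm X \<xi> \<le> 1}. hnorm X (T \<xi>))"

definition rank_one :: "('a, 'x) corr \<Rightarrow> 'x \<Rightarrow> 'x \<Rightarrow> ('x \<Rightarrow> 'x)"
  where "rank_one X \<xi> \<eta> = (\<lambda>\<zeta>. ract X \<xi> (ip X \<eta> \<zeta>))"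

definition compacts_on ::
    "('a::cstar_algebra, 'x::complex_vector) corr \<Rightarrow> 'x set \<Rightarrow> ('x \<Rightarrow> 'x) set"
  where "compacts_on X S = {T \<in> adjointables X.
    \<forall>\<epsilon>>0. \<exists>R\<in>cspan {rank_one X \<xi> \<eta> | \<xi> \<eta>. \<xi> \<in> S \<and> \<eta> \<in> S}. op_norm X (T - R) < \<epsilon>}"

text \<open>\<open>compacts X\<close> is \<open>\<K>(X)\<close>, and \<open>compacts_on X (module_ideal X I)\<close> is \<open>\<K>(XI)\<close>
  regarded as an ideal of \<open>\<L>(X)\<close>.\<close>

definition compacts ::
    "('a::cstar_algebra, 'x::complex_vector) corr \<Rightarrow> ('x \<Rightarrow> 'x) set"
  where "compacts X = compacts_on X (carr X)"

definition module_ideal :: "('a, 'x) corr \<Rightarrow> 'a set \<Rightarrow> 'x set"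
  where "module_ideal X I = {ract X \<xi> a | \<xi> a. \<xi> \<in> carr X \<and> a \<in> I}"

definition quotient_norm ::
    "('a::cstar_algebra, 'x::complex_vector) corr \<Rightarrow> ('x \<Rightarrow> 'x) set \<Rightarrow> ('x \<Rightarrow> 'x) \<Rightarrow> real"
  where "quotient_norm X K T = (INF R\<in>K. op_norm X (T - R))"

locale cstar_correspondence = hilbert_module X
  for X :: "('a::cstar_algebra, 'x::complex_vector) corr" +
  assumes lact_adjointable: "lact X a \<in> adjointables X"
    and lact_add: "\<xi> \<in> carr X \<Longrightarrow> lact X (a + b) \<xi> = lact X a \<xi> + lact X b \<xi>"
    and lact_scaleC: "\<xi> \<in> carr X \<Longrightarrow> lact X (c *\<^sub>C a) \<xi> = c *\<^sub>C lact X a \<xi>"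
    and lact_mult: "\<xi> \<in> carr X \<Longrightarrow> lact X (a * b) \<xi> = lact X a (lact X b \<xi>)"
    and lact_star: "\<xi> \<in> carr X \<Longrightarrow> \<eta> \<in> carr X \<Longrightarrow>
      ip X (lact X a \<xi>) \<eta> = ip X \<xi> (lact X (star a) \<eta>)"

definition lact_kernel :: "('a, 'x::zero) corr \<Rightarrow> 'a set"
  where "lact_kernel X = {a. \<forall>\<xi>\<in>carr X. lact X a \<xi> = 0}"

definition self_corr :: "('a::cstar_algebra, 'a) corr"
  where "self_corr = \<lparr>carr = UNIV, ract = (*), ip = (\<lambda>a b. star a * b), lact = (*)\<rparr>"

definition corr_unitary ::
    "('a::cstar_algebra, 'x::complex_vector) corr \<Rightarrow> ('a, 'y::complex_vector) corr \<Rightarrow>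
      'y set \<Rightarrow> ('x \<Rightarrow> 'y) \<Rightarrow> bool"
    \<comment> \<open>a unitary bimodule map from \<open>X\<close> onto the subset \<open>S\<close> of \<open>Y\<close>\<close>
  where "corr_unitary X Y S u \<longleftrightarrow>
    S \<subseteq> carr Y \<and> u ` carr X = S \<and>
    (\<forall>\<xi>\<in>carr X. \<forall>\<eta>\<in>carr X. u (\<xi> + \<eta>) = u \<xi> + u \<eta>) \<and>
    (\<forall>\<xi>\<in>carr X. \<forall>c. u (c *\<^sub>C \<xi>) = c *\<^sub>C u \<xi>) \<and>
    (\<forall>\<xi>\<in>carr X. \<forall>\<eta>\<in>carr X. ip Y (u \<xi>) (u \<eta>) = ip X \<xi> \<eta>) \<and>
    (\<forall>\<xi>\<in>carr X. \<forall>a. u (ract X \<xi> a) = ract Y (u \<xi>) a) \<and>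
    (\<forall>\<xi>\<in>carr X. \<forall>a. u (lact X a \<xi>) = lact Y a (u \<xi>))"

text \<open>
  \<open>interior_tensor X Y T \<tau>\<close>: the correspondence \<open>T\<close>, with elementary tensors
  \<open>\<xi> \<otimes> \<eta> = \<tau> \<xi> \<eta>\<close>, is the interior tensor product \<open>X \<otimes>\<^sub>A Y\<close>, i.e. the completion of the span of
  the balanced elementary tensors with respect to
  \<open>\<langle>\<xi> \<otimes> \<eta>, \<xi>' \<otimes> \<eta>'\<rangle> = \<langle>\<eta>, \<langle>\<xi>, \<xi>'\<rangle> \<eta>'\<rangle>\<close>. These properties determine \<open>(T, \<tau>)\<close> up to a unique
  unitary.
\<close>

definition interior_tensor ::
    "('a::cstar_algebra, 'x::complex_vector) corr \<Rightarrow> ('a, 'y::complex_vector) corr \<Rightarrow>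
      ('a, 't::complex_vector) corr \<Rightarrow> ('x \<Rightarrow> 'y \<Rightarrow> 't) \<Rightarrow> bool"
  where "interior_tensor X Y T \<tau> \<longleftrightarrow>
    cstar_correspondence T \<and>
    (\<forall>\<xi>\<in>carr X. \<forall>\<eta>\<in>carr Y. \<tau> \<xi> \<eta> \<in> carr T) \<and>
    (\<forall>\<xi>\<in>carr X. \<forall>\<xi>'\<in>carr X. \<forall>\<eta>\<in>carr Y. \<tau> (\<xi> + \<xi>') \<eta> = \<tau> \<xi> \<eta> + \<tau> \<xi>' \<eta>) \<and>
    (\<forall>\<xi>\<in>carr X. \<forall>\<eta>\<in>carr Y. \<forall>\<eta>'\<in>carr Y. \<tau> \<xi> (\<eta> + \<eta>') = \<tau> \<xi> \<eta> + \<tau> \<xi> \<eta>') \<and>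
    (\<forall>\<xi>\<in>carr X. \<forall>\<eta>\<in>carr Y. \<forall>c. \<tau> (c *\<^sub>C \<xi>) \<eta> = c *\<^sub>C \<tau> \<xi> \<eta> \<and> \<tau> \<xi> (c *\<^sub>C \<eta>) = c *\<^sub>C \<tau> \<xi> \<eta>) \<and>
    (\<forall>\<xi>\<in>carr X. \<forall>\<eta>\<in>carr Y. \<forall>a. \<tau> (ract X \<xi> a) \<eta> = \<tau> \<xi> (lact Y a \<eta>)) \<and>
    (\<forall>\<xi>\<in>carr X. \<forall>\<eta>\<in>carr Y. \<forall>a. ract T (\<tau> \<xi> \<eta>) a = \<tau> \<xi> (ract Y \<eta> a)) \<and>
    (\<forall>\<xi>\<in>carr X. \<forall>\<eta>\<in>carr Y. \<forall>a. lact T a (\<tau> \<xi> \<eta>) = \<tau> (lact X a \<xi>) \<eta>) \<and>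
    (\<forall>\<xi>\<in>carr X. \<forall>\<eta>\<in>carr Y. \<forall>\<xi>'\<in>carr X. \<forall>\<eta>'\<in>carr Y.
      ip T (\<tau> \<xi> \<eta>) (\<tau> \<xi>' \<eta>') = ip Y \<eta> (lact Y (ip X \<xi> \<xi>') \<eta>')) \<and>
    hclosed_span T {\<tau> \<xi> \<eta> | \<xi> \<eta>. \<xi> \<in> carr X \<and> \<eta> \<in> carr Y} = carr T"


section \<open>Product systems\<close>

text \<open>
  The index semigroup is \<^typ>\<open>nat ^ 'd\<close>, where the finite type \<^typ>\<open>'d\<close> plays the role of
  \<open>[d]\<close>; the generators are the vectors \<open>axis i 1\<close>, and \<open>\<le>\<close> is the componentwise order.
  The identification \<open>X\<^sub>0 = A\<close> is made through the isomorphism \<open>\<iota>\<close>, since the fibres are carried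
  by subspaces of \<^typ>\<open>'x\<close>. \<open>(T n m, \<tau> n m)\<close> is the tensor product \<open>X\<^sub>n \<otimes>\<^sub>A X\<^sub>m\<close>, on which the
  multiplication map \<open>u n m\<close> is defined.
\<close>

locale product_system =
  fixes X :: "nat ^ 'd::finite \<Rightarrow> ('a::cstar_algebra, 'x::complex_vector) corr"
    and \<iota> :: "'a \<Rightarrow> 'x"
    and T :: "nat ^ 'd \<Rightarrow> nat ^ 'd \<Rightarrow> ('a, 't::complex_vector) corr"
    and \<tau> :: "nat ^ 'd \<Rightarrow> nat ^ 'd \<Rightarrow> 'x \<Rightarrow> 'x \<Rightarrow> 't"
    and u :: "nat ^ 'd \<Rightarrow> nat ^ 'd \<Rightarrow> 't \<Rightarrow> 'x"
  assumes fibre: "cstar_correspondence (X n)"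
    and fibre_zero: "corr_unitary self_corr (X 0) (carr (X 0)) \<iota>"
    and tensor: "interior_tensor (X n) (X m) (T n m) (\<tau> n m)"
    and mult_zero_left_unitary:
      "corr_unitary (T 0 m) (X m)
        (hclosed_span (X m) {lact (X m) a \<xi> | a \<xi>. \<xi> \<in> carr (X m)}) (u 0 m)"
    and mult_zero_left: "\<xi> \<in> carr (X m) \<Longrightarrow> u 0 m (\<tau> 0 m (\<iota> a) \<xi>) = lact (X m) a \<xi>"
    and mult_zero_right_unitary: "corr_unitary (T n 0) (X n) (carr (X n)) (u n 0)"
    and mult_zero_right: "\<xi> \<in> carr (X n) \<Longrightarrow> u n 0 (\<tau> n 0 \<xi> (\<iota> a)) = ract (X n) \<xi> a"
    and mult_unitary: "n \<noteq> 0 \<Longrightarrow> m \<noteq> 0 \<Longrightarrow>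
      corr_unitary (T n m) (X (n + m)) (carr (X (n + m))) (u n m)"
    and mult_assoc: "\<xi> \<in> carr (X n) \<Longrightarrow> \<eta> \<in> carr (X m) \<Longrightarrow> \<zeta> \<in> carr (X k) \<Longrightarrow>
      u (n + m) k (\<tau> (n + m) k (u n m (\<tau> n m \<xi> \<eta>)) \<zeta>) =
      u n (m + k) (\<tau> n (m + k) \<xi> (u m k (\<tau> m k \<eta> \<zeta>)))"

definition proper ::
    "(nat ^ 'd::finite \<Rightarrow> ('a::cstar_algebra, 'x::complex_vector) corr) \<Rightarrow> bool"
  where "proper X \<longleftrightarrow> (\<forall>n a. lact (X n) a \<in> compacts (X n))"

definition perp :: "nat ^ 'd::finite \<Rightarrow> 'd set \<Rightarrow> bool" (infix "\<perp>" 50)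
  where "n \<perp> F \<longleftrightarrow> {i. n $ i \<noteq> 0} \<inter> F = {}"

definition ones :: "'d::finite set \<Rightarrow> nat ^ 'd"
  where "ones F = (\<Sum>i\<in>F. axis i 1)"

definition perp_limit :: "'d::finite set \<Rightarrow> (nat ^ 'd) filter"
    \<comment> \<open>the filter of tails of the directed set \<open>{n. n \<perp> F}\<close>\<close>
  where "perp_limit F = (INF n\<in>{n. n \<perp> F}. principal {m. m \<perp> F \<and> n \<le> m})"


section \<open>Ideals associated with a product system\<close>

definition sandwich :: "('a, 'x) corr \<Rightarrow> 'a set \<Rightarrow> 'a set"
  where "sandwich X S = {ip X \<xi> (lact X a \<eta>) | \<xi> a \<eta>. \<xi> \<in> carr X \<and> a \<in> S \<and> \<eta> \<in> carr X}"

definition inv_ideal :: "('a, 'x) corr \<Rightarrow> 'a set \<Rightarrow> 'a set"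
    \<comment> \<open>\<open>X\<^sup>-\<^sup>1(I)\<close> for a single correspondence\<close>
  where "inv_ideal X I = {a. sandwich X {a} \<subseteq> I}"

definition inv_ideal_F ::
    "(nat ^ 'd::finite \<Rightarrow> ('a, 'x) corr) \<Rightarrow> 'd set \<Rightarrow> 'a set \<Rightarrow> 'a set"
  where "inv_ideal_F X F I = (\<Inter>n\<in>{n. n \<noteq> 0 \<and> n \<le> ones F}. inv_ideal (X n) I)"

definition J_ideal ::
    "(nat ^ 'd::finite \<Rightarrow> ('a::cstar_algebra, 'x) corr) \<Rightarrow> 'd set \<Rightarrow> 'a set \<Rightarrow> 'a set"
  where "J_ideal X F I = {a. \<forall>b\<in>inv_ideal_F X F I. a * b \<in> I}"

definition cal_J ::
    "(nat ^ 'd::finite \<Rightarrow> ('a::cstar_algebra, 'x::zero) corr) \<Rightarrow> 'd set \<Rightarrow> 'a set"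
  where "cal_J X F =
    (if F = {} then {0} else annihilator (\<Inter>i\<in>F. lact_kernel (X (axis i 1))))"

definition cal_I ::
    "(nat ^ 'd::finite \<Rightarrow> ('a::cstar_algebra, 'x::zero) corr) \<Rightarrow> 'd set \<Rightarrow> 'a set"
  where "cal_I X F = (\<Inter>n\<in>{n. n \<perp> F}. inv_ideal (X n) (cal_J X F))"


section \<open>Tuples indexed by the subsets of \<open>[d]\<close>\<close>

definition is_tuple :: "('d::finite set \<Rightarrow> 'a set) \<Rightarrow> bool"
  where "is_tuple L \<longleftrightarrow> (\<forall>F. L F \<noteq> {})"

definition consists_of_ideals :: "('d::finite set \<Rightarrow> 'a::cstar_algebra set) \<Rightarrow> bool"
  where "consists_of_ideals L \<longleftrightarrow> (\<forall>F. cstar_ideal (L F))"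

definition X_invariant ::
    "(nat ^ 'd::finite \<Rightarrow> ('a::cstar_algebra, 'x) corr) \<Rightarrow> ('d set \<Rightarrow> 'a set) \<Rightarrow> bool"
  where "X_invariant X L \<longleftrightarrow>
    (\<forall>F n. n \<perp> F \<longrightarrow> cclosed_span (sandwich (X n) (L F)) \<subseteq> L F)"

definition partially_ordered :: "('d::finite set \<Rightarrow> 'a set) \<Rightarrow> bool"
  where "partially_ordered L \<longleftrightarrow> (\<forall>F1 F2. F1 \<subseteq> F2 \<longrightarrow> L F1 \<subseteq> L F2)"

definition L_inv ::
    "(nat ^ 'd::finite \<Rightarrow> ('a, 'x) corr) \<Rightarrow> ('d set \<Rightarrow> 'a set) \<Rightarrow> 'd set \<Rightarrow> 'a set"
  where "L_inv X L F = (\<Inter>n\<in>{n. n \<perp> F}. inv_ideal (X n) (\<Inter>D\<in>{D. F \<subset> D}. L D))"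

definition L_lim ::
    "(nat ^ 'd::finite \<Rightarrow> ('a::cstar_algebra, 'x::complex_vector) corr) \<Rightarrow>
      ('d set \<Rightarrow> 'a set) \<Rightarrow> 'd set \<Rightarrow> 'a set"
  where "L_lim X L F = {a.
    ((\<lambda>n. quotient_norm (X n) (compacts_on (X n) (module_ideal (X n) (L F))) (lact (X n) a))
      \<longlongrightarrow> 0) (perp_limit F)}"

definition NT_tuple ::
    "(nat ^ 'd::finite \<Rightarrow> ('a::cstar_algebra, 'x::complex_vector) corr) \<Rightarrow>
      ('d set \<Rightarrow> 'a set) \<Rightarrow> bool"
  where "NT_tuple X L \<longleftrightarrow>
    is_tuple L \<and>
    consists_of_ideals L \<and> (\<forall>F. F \<noteq> {} \<longrightarrow> L F \<subseteq> J_ideal X F (L {})) \<and>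
    X_invariant X L \<and>
    partially_ordered L \<and>
    (\<forall>F. F \<noteq> {} \<and> F \<noteq> UNIV \<longrightarrow>
      (\<Inter>n\<in>{n. n \<perp> F}. inv_ideal (X n) (J_ideal X F (L {}))) \<inter> L_inv X L F \<inter> L_lim X L F
        \<subseteq> L F)"

definition NO_tuple ::
    "(nat ^ 'd::finite \<Rightarrow> ('a::cstar_algebra, 'x::complex_vector) corr) \<Rightarrow>
      ('d set \<Rightarrow> 'a set) \<Rightarrow> bool"
  where "NO_tuple X L \<longleftrightarrow> NT_tuple X L \<and> (\<forall>F. cal_I X F \<subseteq> L F)"

definition T_family ::
    "(nat ^ 'd::finite \<Rightarrow> ('a::cstar_algebra, 'x) corr) \<Rightarrow> ('d set \<Rightarrow> 'a set) \<Rightarrow> bool"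
  where "T_family X L \<longleftrightarrow>
    is_tuple L \<and> consists_of_ideals L \<and>
    (\<forall>F i. i \<notin> F \<longrightarrow> L F = inv_ideal (X (axis i 1)) (L F) \<inter> L (insert i F))"

definition O_family ::
    "(nat ^ 'd::finite \<Rightarrow> ('a::cstar_algebra, 'x::zero) corr) \<Rightarrow> ('d set \<Rightarrow> 'a set) \<Rightarrow> bool"
  where "O_family X L \<longleftrightarrow> T_family X L \<and> (\<forall>F. cal_I X F \<subseteq> L F)"

end

theory Submission
  imports Defs
begin

text \<open>
  An NT-tuple is a T-family by downward induction on \<open>F\<close>: an element of
  \<open>X\<^sub>i\<^sup>-\<^sup>1(\<L>\<^sub>F) \<inter> \<L>\<^bsub>F \<union> {i}\<^esub>\<close> satisfies the three conditions of the maximality axiom for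
  \<open>F\<close>. It acts by elements of \<open>\<K>(X\<^sub>n\<L>\<^sub>F)\<close> as soon as \<open>n\<^sub>i \<noteq> 0\<close>, because it acts compactly and
  \<open>\<langle>X\<^sub>n, a X\<^sub>n\<rangle> \<subseteq> \<L>\<^sub>F\<close>; hence the quotient norms in \<open>\<L>\<^bsub>lim,F\<^esub>\<close> vanish eventually.

  Conversely, let \<open>\<L>\<close> be a T-family. On the ideal \<open>\<L>\<^bsub>inv,F\<^esub>\<close> the kernel of the action on
  \<open>X\<^sub>n/X\<^sub>n\<L>\<^sub>F\<close> is contained in \<open>\<L>\<^sub>F\<close>, for every \<open>n \<perp> F\<close>. An injective *-homomorphism is isometric,
  so the quotient norms of \<open>a\<close> dominate its distance to \<open>\<L>\<^sub>F\<close>, and \<open>a \<in> \<L>\<^sub>F\<close> if they tend to \<open>0\<close>.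
  In place of quotient C*-algebras, the argument uses elements \<open>g\<close> obtained from the positive part of
  \<open>star a * a - \<epsilon>\<close>.
\<close>

text \<open>Part (ii) adds the same inclusion to both sides of (i). Two ingredients carry the
  algebra. First, J_F(I) and X_F^-1(I) intersect inside I, since I then contains the product of such
  an element with its adjoint; this gives the J-condition in the first direction and settles F = {}
  there, where the maximality axiom is silent. Second, the T-identity is a descent device: an
  element whose sandwiches over X_i lie in L_F moves from L_(F + i) down to L_F. This yields the
  J-condition and the kernel statement in the converse. The limit argument estimates modulo an ideal
  that varies within the proof, so the quotient is not a fixed type of class
  \<open>cstar_algebra\<close>. Vanishing in the quotient is expressed by membership in the ideal,
  by its approximate units, and by inner products with values in it. Functional calculus is reduced
  to square roots in the unitisation; these come with a clause on commuting elements, which takes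
  the place of being a limit of polynomials.\<close>

lemma scaleC_zero_left [simp]: "0 *\<^sub>C (x::'a::complex_vector) = 0"
  using scaleC_add_left[of 0 0 x] by simp

lemma scaleC_zero_right [simp]: "c *\<^sub>C (0::'a::complex_vector) = 0"
  using scaleC_add_right[of c 0 "0::'a"] by simp

lemma scaleC_minus_right: "c *\<^sub>C (- x) = - (c *\<^sub>C (x::'a::complex_vector))"
  using scaleC_add_right[of c x "- x"] by (simp add: eq_neg_iff_add_eq_0 add.commute)

lemma scaleC_minus_left: "(- c) *\<^sub>C x = - (c *\<^sub>C (x::'a::complex_vector))"
  using scaleC_add_left[of c "- c" x] by (simp add: eq_neg_iff_add_eq_0 add.commute)

lemma scaleC_diff_right: "c *\<^sub>C (x - y) = c *\<^sub>C x - c *\<^sub>C (y::'a::complex_vector)"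
  using scaleC_add_right[of c x "- y"] by (simp add: scaleC_minus_right)

lemma scaleC_minus1: "(- 1) *\<^sub>C x = - (x::'a::complex_vector)"
  by (simp add: scaleC_minus_left scaleC_one)

section \<open>The involution\<close>

context cstar_algebra
begin

lemma star_zero [simp]: "star 0 = 0"
  using star_add[of 0 0] by simp

lemma star_minus: "star (- x) = - star x"
  using star_add[of x "- x"] by (simp add: eq_neg_iff_add_eq_0 add.commute)

lemma star_diff: "star (x - y) = star x - star y"
  using star_add[of x "- y"] by (simp add: star_minus)

lemma star_scaleR: "star (r *\<^sub>R x) = r *\<^sub>R star x"
  by (simp add: scaleR_scaleC star_scaleC)

lemma norm_star [simp]: "norm (star x) = norm x"
proof -
  have le: "norm y \<le> norm (star y)" for y
  proof (cases "norm y = 0")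
    case False
    have "norm y * norm y \<le> norm (star y) * norm y"
      using norm_mult_ineq[of "star y" y] cstar_identity[of y] by (simp add: power2_eq_square)
    with False show ?thesis by (metis mult_right_le_imp_le norm_ge_zero order_le_less)
  qed simp
  show ?thesis using le[of x] le[of "star x"] by (simp add: star_star)
qed

lemma norm_mult_self_adjoint:
  assumes "star x = x" shows "norm (x * x) = (norm x)\<^sup>2"
  using cstar_identity[of x] assms by simp

end

lemma bounded_linear_star: "bounded_linear (star :: 'a::cstar_algebra \<Rightarrow> 'a)"
  by (rule bounded_linear_intro[where K=1]) (simp_all add: star_add star_scaleR)

lemmas tendsto_star = bounded_linear.tendsto[OF bounded_linear_star]

text \<open>Order arguments take place in unital algebras, where \<open>of_real c - h\<close> and
  powers make sense; \<open>unitisation\<close> embeds every algebra into one of these.\<close>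

class cstar_algebra_1 = cstar_algebra + real_normed_algebra_1

lemma star_one [simp]: "star 1 = (1::'a::cstar_algebra_1)"
  by (metis mult.right_neutral mult_1 star_mult star_star)

lemma star_of_real [simp]: "star (of_real r) = (of_real r :: 'a::cstar_algebra_1)"
  by (simp add: of_real_def star_scaleR)

lemma star_power: "star (x ^ n) = star x ^ n" for x :: "'a::cstar_algebra_1"
  by (induction n) (simp_all add: star_mult power_commutes)

section \<open>Square roots and positive elements\<close>

text \<open>\<open>1 - y\<close> is the square root of \<open>1 - x\<close>; the iteration for the fixed point is dominated by the
  same iteration for \<open>x = 1\<close> in the reals.\<close>

fun sqrt_iter :: "'a::real_normed_algebra \<Rightarrow> nat \<Rightarrow> 'a"
  where "sqrt_iter x 0 = 0"
  | "sqrt_iter x (Suc n) = (1/2) *\<^sub>R (x + sqrt_iter x n * sqrt_iter x n)"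

lemma sqrt_iter_commute:
  assumes "z * x = x * z"
  shows "z * sqrt_iter x n = sqrt_iter x n * z"
proof (induction n)
  case (Suc n)
  have "z * (sqrt_iter x n * sqrt_iter x n) = sqrt_iter x n * sqrt_iter x n * z"
    by (metis Suc mult.assoc)
  then show ?case by (simp add: assms algebra_simps)
qed simp

lemma sqrt_iter_real: "0 \<le> (sqrt_iter 1 n :: real) \<and> sqrt_iter 1 n \<le> (1::real)"
proof (induction n)
  case (Suc n)
  then have "sqrt_iter 1 n * sqrt_iter 1 n \<le> (1::real)" by (intro mult_le_one) auto
  then show ?case by simp
qed simp

lemma sqrt_iter_norm:
  assumes "norm x \<le> 1"
  shows "norm (sqrt_iter x n) \<le> sqrt_iter 1 n"
proof (induction n)
  case (Suc n)
  have "norm (sqrt_iter x n * sqrt_iter x n) \<le> sqrt_iter 1 n * sqrt_iter 1 n"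
    by (rule order_trans[OF norm_mult_ineq]) (intro mult_mono Suc sqrt_iter_real[THEN conjunct1] norm_ge_zero)
  then have "norm (x + sqrt_iter x n * sqrt_iter x n) \<le> 1 + sqrt_iter 1 n * sqrt_iter 1 n"
    by (intro norm_triangle_le add_mono assms)
  then show ?case by simp
qed simp

text \<open>Iterates commute, so a difference of two squares factors; the scalar iteration for x = 1
  obeys the same factorisation and bounds both factors.\<close>

lemma sqrt_iter_step:
  assumes "norm x \<le> 1"
  shows "norm (sqrt_iter x (Suc n) - sqrt_iter x n) \<le> sqrt_iter 1 (Suc n) - sqrt_iter 1 n"
proof (induction n)
  case (Suc n)
  let ?a = "sqrt_iter x (Suc n)" and ?b = "sqrt_iter x n"
  let ?s = "sqrt_iter 1 (Suc n) :: real" and ?t = "sqrt_iter 1 n :: real"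
  have com: "?b * ?a = ?a * ?b"
    by (rule sqrt_iter_commute) (metis sqrt_iter_commute)
  have eq: "(?a - ?b) * (?a + ?b) = ?a * ?a - ?b * ?b"
    using com by (simp add: algebra_simps del: sqrt_iter.simps)
  have "norm ((?a - ?b) * (?a + ?b)) \<le> (?s - ?t) * (?s + ?t)"
  proof (rule order_trans[OF norm_mult_ineq], rule mult_mono)
    show "norm (?a + ?b) \<le> ?s + ?t"
      by (intro norm_triangle_le add_mono sqrt_iter_norm assms)
    show "0 \<le> ?s - ?t" using Suc norm_ge_zero order_trans by blast
  qed (use Suc in simp_all)
  moreover have "sqrt_iter x (Suc (Suc n)) - ?a = (1/2) *\<^sub>R ((?a - ?b) * (?a + ?b))"
    unfolding eq by (simp only: sqrt_iter.simps) (simp add: algebra_simps)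
  moreover have "sqrt_iter 1 (Suc (Suc n)) - ?s = (?s - ?t) * (?s + ?t) / 2"
    by (simp add: algebra_simps)
  ultimately show ?case by (simp only: norm_scaleR)
qed (use assms in simp)

text \<open>For norm 1 the iteration need not be a strict contraction. The scalar iterates increase
  and are bounded by 1, so their increments form a convergent series that majorises the increments
  for \<open>x\<close>.\<close>

lemma sqrt_iter_convergent:
  fixes x :: "'a::{real_normed_algebra, banach}"
  assumes "norm x \<le> 1"
  shows "convergent (sqrt_iter x)"
proof -
  define d where "d n = (sqrt_iter 1 (Suc n) - sqrt_iter 1 n :: real)" for n
  have mono: "0 \<le> d n" for n
    using sqrt_iter_step[of x n] assms norm_ge_zero order_trans unfolding d_def by blast
  have "convergent (\<lambda>n. sqrt_iter 1 n :: real)"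
    by (rule Bseq_monoseq_convergent)
      (use sqrt_iter_real mono in \<open>auto simp: d_def intro!: BseqI'[where K=1] incseq_imp_monoseq incseq_SucI\<close>)
  then have "summable d"
    unfolding d_def summable_iff_convergent sum_lessThan_telescope
    by (simp add: convergent_diff convergent_const)
  then have "summable (\<lambda>n. sqrt_iter x (Suc n) - sqrt_iter x n)"
    by (rule summable_comparison_test')
      (use sqrt_iter_step[OF assms] in \<open>simp add: d_def\<close>)
  then show ?thesis
    unfolding summable_iff_convergent sum_lessThan_telescope by simp
qed

lemma sqrt_exists:
  fixes x :: "'a::cstar_algebra"
  assumes "norm x \<le> 1" "star x = x"
  obtains y where "norm y \<le> 1" "2 *\<^sub>R y = x + y * y" "star y = y"
    "\<And>z. z * x = x * z \<Longrightarrow> z * y = y * z"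
proof -
  obtain y where y: "sqrt_iter x \<longlonglongrightarrow> y"
    using sqrt_iter_convergent[OF assms(1)] by (auto simp: convergent_def)
  have sa: "star (sqrt_iter x n) = sqrt_iter x n" for n
    by (induction n) (simp_all add: star_add star_scaleR star_mult assms)
  show thesis
  proof (rule that)
    have "norm (sqrt_iter x n) \<le> 1" for n
      using sqrt_iter_norm[OF assms(1)] sqrt_iter_real order_trans by blast
    then show "norm y \<le> 1"
      by (intro LIMSEQ_le_const2[OF tendsto_norm[OF y]]) auto
    have "(\<lambda>n. sqrt_iter x (Suc n)) \<longlonglongrightarrow> y" using y by (rule LIMSEQ_Suc)
    moreover have "(\<lambda>n. sqrt_iter x (Suc n)) \<longlonglongrightarrow> (1/2) *\<^sub>R (x + y * y)"
      unfolding sqrt_iter.simps by (intro tendsto_intros y)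
    ultimately have "y = (1/2) *\<^sub>R (x + y * y)" by (rule LIMSEQ_unique)
    then have "2 *\<^sub>R y = 2 *\<^sub>R ((1/2) *\<^sub>R (x + y * y))" by simp
    then show "2 *\<^sub>R y = x + y * y" by simp
    show "star y = y"
      using tendsto_star[OF y] y by (simp add: sa LIMSEQ_unique)
    show "z * y = y * z" if "z * x = x * z" for z
    proof -
      have "(\<lambda>n. z * sqrt_iter x n) \<longlonglongrightarrow> z * y" "(\<lambda>n. sqrt_iter x n * z) \<longlonglongrightarrow> y * z"
        by (intro tendsto_intros y)+
      then show ?thesis using sqrt_iter_commute[OF that] by (simp add: LIMSEQ_unique)
    qed
  qed
qed

text \<open>In a unital C*-algebra \<open>sa_square\<close> is the positive cone. That \<open>star a * a\<close> lies in it is the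
  theorem of Fukamiya, Kelley and Vaught below.\<close>

definition sa_square :: "'a::cstar_algebra_1 \<Rightarrow> bool"
  where "sa_square h \<longleftrightarrow> (\<exists>k. star k = k \<and> h = k * k)"

lemma sa_square_star: "sa_square h \<Longrightarrow> star h = h"
  by (auto simp: sa_square_def star_mult)

lemma sa_squareI: "star k = k \<Longrightarrow> sa_square (k * k)"
  by (auto simp: sa_square_def)

lemma sa_square_zero [simp]: "sa_square 0" and sa_square_one [simp]: "sa_square 1"
  using sa_squareI[of 0] sa_squareI[of 1] by simp_all

lemma sa_square_scaleR:
  assumes "sa_square h" "0 \<le> r" shows "sa_square (r *\<^sub>R h)"
proof -
  obtain k where "star k = k" "h = k * k" using assms by (auto simp: sa_square_def)
  then show ?thesis
    using sa_squareI[of "sqrt r *\<^sub>R k"] assms(2) by (simp add: star_scaleR)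
qed

lemma sqrt_unit_ball:
  fixes x :: "'a::cstar_algebra_1"
  assumes "norm (1 - x) \<le> 1" "star x = x"
  obtains k where "star k = k" "k * k = x" "norm (1 - k) \<le> 1"
    "\<And>z. z * x = x * z \<Longrightarrow> z * k = k * z"
proof -
  have "star (1 - x) = 1 - x" by (simp add: star_diff assms)
  from sqrt_exists[OF assms(1) this]
  obtain y where y: "norm y \<le> 1" "2 *\<^sub>R y = 1 - x + y * y" "star y = y"
    "\<And>z. z * (1 - x) = (1 - x) * z \<Longrightarrow> z * y = y * z"
    by metis
  show thesis
  proof (rule that[of "1 - y"])
    have "y + y = 1 - x + y * y" using y(2) by (simp add: scaleR_2)
    then show "(1 - y) * (1 - y) = x" by (simp add: algebra_simps)
    show "z * (1 - y) = (1 - y) * z" if "z * x = x * z" for z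
      using y(4)[of z] that by (simp add: algebra_simps)
  qed (use y(1,3) in \<open>simp_all add: star_diff\<close>)
qed

text \<open>\<open>k\<close> is the real part of \<open>w = k + i l\<close>. Since \<open>k\<close>
  and \<open>l\<close> commute, \<open>star w * w\<close> is the sum of the squares, so
  \<open>w\<close> has squared norm c, and a real part is no larger in norm.\<close>

lemma norm_le_of_squares_sum:
  fixes k l :: "'a::cstar_algebra_1"
  assumes "star k = k" "star l = l" "k * l = l * k" "k * k + l * l = of_real c" "0 \<le> c"
  shows "(norm k)\<^sup>2 \<le> c"
proof -
  define w where "w = k + \<i> *\<^sub>C l"
  have sw: "star w = k - \<i> *\<^sub>C l"
    by (simp add: w_def star_add star_scaleC assms scaleC_minus_left)
  have "star w * w = k * k + l * l + (k * (\<i> *\<^sub>C l) - (\<i> *\<^sub>C l) * k)"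
    unfolding sw
    by (simp add: w_def algebra_simps mult_scaleC_left mult_scaleC_right scaleC_scaleC scaleC_minus1 scaleC_diff_right)
  also have "\<dots> = of_real c"
    using assms by (simp add: mult_scaleC_left mult_scaleC_right)
  finally have nw: "(norm w)\<^sup>2 = c" using cstar_identity[of w] assms by simp
  have "2 *\<^sub>R k = w + star w" unfolding sw by (simp add: w_def scaleR_2)
  then have "2 * norm k = norm (w + star w)" by (metis norm_scaleR abs_numeral)
  also have "\<dots> \<le> norm w + norm (star w)" by (rule norm_triangle_ineq)
  finally have "norm k \<le> norm w" by simp
  then show ?thesis using nw by (metis norm_ge_zero power_mono)
qed

text \<open>A root \<open>s\<close> of \<open>1 - y * y\<close> commutes with \<open>y\<close>, and
  the squares of \<open>s\<close> and \<open>y\<close> add up to 1.\<close>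

lemma norm_one_minus_square:
  fixes y :: "'a::cstar_algebra_1"
  assumes "star y = y" "norm y \<le> 1"
  shows "norm (1 - y * y) \<le> 1"
proof -
  have "norm (1 - (1 - y * y)) \<le> 1"
    using assms norm_mult_ineq[of y y] mult_le_one[of "norm y" "norm y"] by simp
  moreover have "star (1 - y * y) = 1 - y * y" by (simp add: star_diff star_mult assms)
  moreover have "y * (1 - y * y) = (1 - y * y) * y" by (simp add: algebra_simps)
  ultimately obtain s where s: "star s = s" "s * s = 1 - y * y" "y * s = s * y"
    using sqrt_unit_ball by metis
  have "(norm s)\<^sup>2 \<le> 1"
    by (rule norm_le_of_squares_sum[of s y]) (use s assms in simp_all)
  then show ?thesis using norm_mult_self_adjoint[OF s(1)] s(2) by simp
qed

lemma sa_square_norm: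
  fixes h :: "'a::cstar_algebra_1"
  assumes "sa_square h" "norm h \<le> c"
  shows "norm (of_real c - h) \<le> c"
proof (cases "c = 0")
  case False
  then have c: "c > 0" using assms(2) norm_ge_zero[of h] by linarith
  obtain k where k: "star k = k" "h = k * k" using assms by (auto simp: sa_square_def)
  have "(norm k)\<^sup>2 \<le> c" using norm_mult_self_adjoint[OF k(1)] k assms by simp
  then have "norm ((1 / sqrt c) *\<^sub>R k) \<le> 1"
    using c by (simp add: divide_simps real_le_rsqrt)
  then have "norm (1 - ((1 / sqrt c) *\<^sub>R k) * ((1 / sqrt c) *\<^sub>R k)) \<le> 1"
    by (intro norm_one_minus_square) (simp_all add: star_scaleR k)
  then have "norm (1 - (1 / c) *\<^sub>R h) \<le> 1" using c k by simp
  then have "c * norm (1 - (1 / c) *\<^sub>R h) \<le> c" using c by simp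
  moreover have "of_real c - h = c *\<^sub>R (1 - (1 / c) *\<^sub>R h)"
    using c by (simp add: scaleR_diff_right of_real_def)
  ultimately show ?thesis using c by simp
qed (use assms in simp)

lemma sqrt_of_norm_le:
  fixes h :: "'a::cstar_algebra_1"
  assumes "star h = h" "norm (of_real c - h) \<le> c"
  obtains k where "sa_square k" "star k = k" "k * k = h" "\<And>z. z * h = h * z \<Longrightarrow> z * k = k * z"
proof (cases "c = 0")
  case True
  then show ?thesis using assms that[of 0] by simp
next
  case False
  then have c: "c > 0" using assms(2) norm_ge_zero[of "of_real c - h"] by linarith
  have "norm (1 - (1 / c) *\<^sub>R h) = norm ((1 / c) *\<^sub>R (of_real c - h))"
    using c by (simp add: scaleR_diff_right of_real_def)
  also have "\<dots> \<le> 1" using assms(2) c by simp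
  finally have "norm (1 - (1 / c) *\<^sub>R h) \<le> 1" .
  moreover have "star ((1 / c) *\<^sub>R h) = (1 / c) *\<^sub>R h" by (simp add: star_scaleR assms)
  ultimately obtain k where k: "star k = k" "k * k = (1 / c) *\<^sub>R h" "norm (1 - k) \<le> 1"
    "\<And>z. z * ((1 / c) *\<^sub>R h) = (1 / c) *\<^sub>R h * z \<Longrightarrow> z * k = k * z"
    using sqrt_unit_ball by metis
  show thesis
  proof (rule that[of "sqrt c *\<^sub>R k"])
    \<comment> \<open>The root \<open>k\<close> again satisfies \<open>norm (1 - k) \<le> 1\<close>,
      so it has a self-adjoint root itself; this makes the chosen root positive.\<close>
    obtain l where "star l = l" "l * l = k" by (rule sqrt_unit_ball[OF k(3,1)])
    then have "sa_square k" by (metis sa_squareI)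
    then show "sa_square (sqrt c *\<^sub>R k)" using c by (intro sa_square_scaleR) auto
    show "z * sqrt c *\<^sub>R k = sqrt c *\<^sub>R k * z" if "z * h = h * z" for z
      using k(4)[of z] that by simp
  qed (use k(1,2) c in \<open>simp_all add: star_scaleR\<close>)
qed

text \<open>The right side expresses positivity without spectra. Being a norm inequality, it is
  stable under sums by the triangle inequality, which is not visible for squares.\<close>

lemma sa_square_iff:
  fixes h :: "'a::cstar_algebra_1"
  assumes "norm h \<le> c"
  shows "sa_square h \<longleftrightarrow> star h = h \<and> norm (of_real c - h) \<le> c"
  using sa_square_norm[OF _ assms] sa_square_star sqrt_of_norm_le sa_squareI by metis

lemma sa_squareE:
  fixes h :: "'a::cstar_algebra_1"
  assumes "sa_square h"
  obtains k where "sa_square k" "star k = k" "k * k = h" "\<And>z. z * h = h * z \<Longrightarrow> z * k = k * z"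
  using sqrt_of_norm_le[OF sa_square_star[OF assms] sa_square_norm[OF assms order_refl]] by metis

lemma sa_square_add:
  fixes h g :: "'a::cstar_algebra_1"
  assumes "sa_square h" "sa_square g"
  shows "sa_square (h + g)"
proof -
  have "norm (of_real (norm h) - h + (of_real (norm g) - g)) \<le> norm h + norm g"
    by (intro norm_triangle_le add_mono sa_square_norm assms order_refl)
  then have "norm (of_real (norm h + norm g) - (h + g)) \<le> norm h + norm g"
    by (simp add: algebra_simps)
  then show ?thesis
    by (subst sa_square_iff[OF norm_triangle_ineq]) (simp add: star_add sa_square_star assms)
qed

text \<open>The roots commute with whatever commutes with \<open>h\<close> or \<open>g\<close>,
  hence with each other, so their product is a self-adjoint root of \<open>h * g\<close>.\<close>

lemma sa_square_mult:
  fixes h g :: "'a::cstar_algebra_1"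
  assumes "sa_square h" "sa_square g" "h * g = g * h"
  shows "sa_square (h * g)"
proof -
  obtain k where k: "star k = k" "k * k = h" "\<And>z. z * h = h * z \<Longrightarrow> z * k = k * z"
    using sa_squareE[OF assms(1)] by metis
  obtain l where l: "star l = l" "l * l = g" "\<And>z. z * g = g * z \<Longrightarrow> z * l = l * z"
    using sa_squareE[OF assms(2)] by metis
  have "k * g = g * k" using k(3)[of g] assms(3) by simp
  then have kl: "k * l = l * k" using l(3) by blast
  have "h * g = (k * l) * (k * l)"
    unfolding k(2)[symmetric] l(2)[symmetric] by (metis kl mult.assoc)
  moreover have "star (k * l) = k * l" by (simp add: star_mult k(1) l(1) kl)
  ultimately show ?thesis using sa_squareI by metis
qed

lemma sa_square_power: "sa_square h \<Longrightarrow> sa_square (h ^ n)"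
  by (induction n) (simp_all add: sa_square_mult power_commutes)

lemma sa_square_conj:
  fixes h x :: "'a::cstar_algebra_1"
  assumes "sa_square h" "x * h = h * x" "star x = x"
  shows "sa_square (x * h * x)"
proof -
  have 1: "x * h * x = h * (x * x)" by (simp add: assms(2) mult.assoc)
  have "x * x * h = x * (x * h)" by (simp add: mult.assoc)
  also have "\<dots> = x * h * x" by (subst assms(2)) (simp add: mult.assoc)
  finally have "sa_square (h * (x * x))"
    by (intro sa_square_mult assms sa_squareI) (simp add: 1)
  then show ?thesis by (simp add: 1)
qed

lemma sa_square_diff_norm:
  fixes h :: "'a::cstar_algebra_1"
  assumes "star h = h" "norm h \<le> c"
  shows "sa_square (of_real c - h)"
proof -
  have "norm (of_real c - (of_real c - h)) \<le> c" using assms by simp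
  moreover have "star (of_real c - h) = of_real c - h" using assms by (simp add: star_diff)
  ultimately show ?thesis using sqrt_of_norm_le sa_squareI by metis
qed

text \<open>Roots of \<open>h\<close> and of \<open>c - h\<close> commute and their squares add up
  to c, the situation of \<open>norm_le_of_squares_sum\<close>.\<close>

lemma norm_le_of_sa_square:
  fixes h :: "'a::cstar_algebra_1"
  assumes "sa_square h" "sa_square (of_real c - h)" "0 \<le> c"
  shows "norm h \<le> c"
proof -
  obtain k where k: "star k = k" "k * k = h" "\<And>z. z * h = h * z \<Longrightarrow> z * k = k * z"
    using sa_squareE[OF assms(1)] by metis
  obtain l where l: "star l = l" "l * l = of_real c - h"
      "\<And>z. z * (of_real c - h) = (of_real c - h) * z \<Longrightarrow> z * l = l * z"
    using sa_squareE[OF assms(2)] by metis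
  have "k * h = h * k" using k(2) by (metis mult.assoc)
  then have "k * (of_real c - h) = (of_real c - h) * k"
    by (simp add: algebra_simps) (simp add: of_real_def)
  then have "(norm k)\<^sup>2 \<le> c"
    by (intro norm_le_of_squares_sum[of k l]) (use k(1,2) l(1,2) assms l(3)[of k] in simp_all)
  then show ?thesis using norm_mult_self_adjoint[OF k(1)] k(2) by simp
qed

lemma norm_mono_sa_square:
  fixes h g :: "'a::cstar_algebra_1"
  assumes "sa_square h" "sa_square (g - h)"
  shows "norm h \<le> norm g"
proof (rule norm_le_of_sa_square[OF assms(1)])
  have "star g = star (g - h) + star h" by (simp add: star_diff)
  then have "star g = g" using assms by (simp add: sa_square_star)
  then have "sa_square ((of_real (norm g) - g) + (g - h))"
    by (intro sa_square_add sa_square_diff_norm assms) auto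
  then show "sa_square (of_real (norm g) - h)" by simp
qed simp

lemma sa_square_minus_zero:
  fixes h :: "'a::cstar_algebra_1"
  assumes "sa_square h" "sa_square (- h)"
  shows "h = 0"
  using norm_mono_sa_square[of h 0] assms by simp

lemma self_adjoint_square_eq_zero:
  fixes h :: "'a::cstar_algebra"
  assumes "star h = h" "h * h = 0"
  shows "h = 0"
  using norm_mult_self_adjoint[OF assms(1)] assms(2) by simp

text \<open>\<open>s\<close> is the absolute value of \<open>h\<close>; the halves of
  \<open>s + h\<close> and \<open>s - h\<close> will act as its positive and negative parts.\<close>

lemma sa_square_abs:
  fixes h :: "'a::cstar_algebra_1"
  assumes "star h = h"
  obtains s where "sa_square s" "star s = s" "s * s = h * h" "\<And>z. z * h = h * z \<Longrightarrow> z * s = s * z"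
proof -
  obtain s where s: "sa_square s" "star s = s" "s * s = h * h"
      "\<And>z. z * (h * h) = (h * h) * z \<Longrightarrow> z * s = s * z"
    using sa_squareE[OF sa_squareI[OF assms]] by metis
  show thesis
    by (rule that[OF s(1-3)]) (rule s(4), metis mult.assoc)
qed

text \<open>With \<open>w = b m\<close>, where \<open>m * m = - (star b * b)\<close>, both \<open>- (star w * w)\<close> and \<open>- (w * star w)\<close>
  are positive, but the sum of \<open>star w * w\<close> and \<open>w * star w\<close> is positive for every \<open>w\<close>.\<close>

lemma star_mult_self_eq_zero_of_neg:
  fixes b :: "'a::cstar_algebra_1"
  assumes "sa_square (- (star b * b))"
  shows "star b * b = 0"
proof -
  define g where "g = - (star b * b)"
  obtain m where m: "star m = m" "m * m = g" using assms by (auto simp: sa_square_def g_def)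
  define w where "w = b * m"
  \<comment> \<open>\<open>x\<close> and \<open>y\<close> are the real and imaginary parts of
    \<open>w\<close>; their cross terms cancel in \<open>star w * w + w * star w\<close>.\<close>
  define x where "x = (1/2) *\<^sub>R (w + star w)"
  define y where "y = (1/2) *\<^sub>R (\<i> *\<^sub>C (star w - w))"
  have sx: "star x = x" and sy: "star y = y"
    by (simp_all add: x_def y_def star_scaleR star_scaleC star_add star_diff star_star
        scaleC_diff_right scaleC_minus_left add.commute)
  have gs: "star g = g" by (simp add: g_def star_minus star_mult star_star)
  have ww: "star w * w = - (g * g)"
  proof -
    have "star w * w = m * (star b * b) * m" by (simp add: w_def star_mult m mult.assoc)
    also have "\<dots> = - (m * (m * m) * m)" by (simp add: m(2)) (simp add: g_def)
    finally show ?thesis by (simp add: m(2)[symmetric] mult.assoc)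
  qed
  have bb: "w * star w = - ((b * star b) * (b * star b))"
  proof -
    have "w * star w = b * (m * m) * star b" by (simp add: w_def star_mult m(1) mult.assoc)
    also have "\<dots> = b * g * star b" by (simp only: m(2))
    finally show ?thesis by (simp add: g_def mult.assoc)
  qed
  have sum: "star w * w + w * star w = 2 *\<^sub>R (x * x + y * y)"
  proof -
    have "4 *\<^sub>R (x * x) = (w + star w) * (w + star w)" by (simp add: x_def)
    moreover have "4 *\<^sub>R (y * y) = - ((star w - w) * (star w - w))"
      by (simp add: y_def mult_scaleC_left mult_scaleC_right scaleC_scaleC scaleC_minus1 scaleR_scaleC)
    ultimately have "4 *\<^sub>R (x * x + y * y) = 2 *\<^sub>R (star w * w + w * star w)"
      by (simp add: scaleR_add_right algebra_simps scaleR_2)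
    then have "(1/2) *\<^sub>R (4 *\<^sub>R (x * x + y * y)) = (1/2) *\<^sub>R (2 *\<^sub>R (star w * w + w * star w))"
      by simp
    then show ?thesis by simp
  qed
  have "sa_square (2 *\<^sub>R (x * x + y * y))"
    by (intro sa_square_scaleR sa_square_add sa_squareI sx sy) simp
  moreover have B: "sa_square (b * star b * (b * star b))"
    by (rule sa_squareI) (simp add: star_mult star_star)
  \<comment> \<open>Adding the square of \<open>b * star b\<close> cancels \<open>w * star w\<close>
    and leaves \<open>star w * w = - (g * g)\<close>.\<close>
  ultimately have "sa_square (- (g * g))"
    using sa_square_add[of "star w * w + w * star w" "b * star b * (b * star b)"]
    by (simp add: sum[symmetric] ww bb)
  then have "g * g = 0" using sa_square_minus_zero[of "g * g"] sa_squareI[OF gs] by blast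
  then show ?thesis using self_adjoint_square_eq_zero[OF gs] by (simp add: g_def)
qed

text \<open>With \<open>n\<close> the negative part of \<open>star a * a\<close>, the element
  \<open>b = a * n\<close> has \<open>star b * b = - (n * n * n)\<close>. The cube equals
  \<open>n * s * n\<close> and is positive, so it vanishes by the previous lemma, and
  \<open>n = 0\<close>.\<close>

lemma sa_square_star_mult_self:
  fixes a :: "'a::cstar_algebra_1"
  shows "sa_square (star a * a)"
proof -
  define h where "h = star a * a"
  have hs: "star h = h" by (simp add: h_def star_mult star_star)
  obtain s where s: "sa_square s" "star s = s" "s * s = h * h" "\<And>z. z * h = h * z \<Longrightarrow> z * s = s * z"
    using sa_square_abs[OF hs] by metis
  define n where "n = (1/2) *\<^sub>R (s - h)"
  have sh: "h * s = s * h" using s(4) by blast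
  have ns: "star n = n" by (simp add: n_def star_scaleR star_diff s(2) hs)
  have hn: "h * n = - (n * n)"
    by (simp add: n_def algebra_simps s(3) sh flip: scaleR_scaleR) (simp add: scaleR_2[symmetric] flip: scaleR_add_right)
  have ns2: "n * s = s * n" using sh by (simp add: n_def algebra_simps)
  have "n * s = n * n"
    by (simp add: n_def algebra_simps s(3) sh flip: scaleR_scaleR) (simp add: scaleR_2[symmetric] flip: scaleR_add_right)
  then have n3: "n * n * n = n * s * n" by simp
  have "star (a * n) * (a * n) = n * (h * n)" by (simp add: star_mult ns h_def mult.assoc)
  then have b: "star (a * n) * (a * n) = - (n * n * n)" by (simp add: hn mult.assoc)
  have "sa_square (n * s * n)" by (rule sa_square_conj[OF s(1) ns2 ns])
  then have "star (a * n) * (a * n) = 0"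
    by (intro star_mult_self_eq_zero_of_neg) (simp add: b n3)
  then have "n * n * n = 0" using b by simp
  then have "(n * n) * (n * n) = 0" by (simp add: mult.assoc)
  then have "n * n = 0" by (rule self_adjoint_square_eq_zero[rotated]) (simp add: star_mult ns)
  then have "n = 0" using self_adjoint_square_eq_zero[OF ns] by blast
  then have "s = h" by (simp add: n_def)
  then show ?thesis using s(1) by (simp add: h_def)
qed

section \<open>The unitisation\<close>

datatype 'a unitisation = Unitisation (alg_part: 'a) (scalar_part: complex)

definition unit_act :: "'a::cstar_algebra unitisation \<Rightarrow> 'a \<Rightarrow> 'a"
  where "unit_act z x = alg_part z * x + scalar_part z *\<^sub>C x"

lemma bounded_linear_unit_act: "bounded_linear (unit_act z)"
proof (rule bounded_linear_intro)
  fix x y :: 'a and r :: real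
  show "unit_act z (x + y) = unit_act z x + unit_act z y"
    by (simp add: unit_act_def algebra_simps scaleC_add_right)
  show "unit_act z (r *\<^sub>R x) = r *\<^sub>R unit_act z x"
    by (simp add: unit_act_def scaleR_scaleC mult_scaleC_right scaleC_add_right scaleC_scaleC mult.commute)
  have "norm (unit_act z x) \<le> norm (alg_part z) * norm x + cmod (scalar_part z) * norm x"
    unfolding unit_act_def
    by (rule order_trans[OF norm_triangle_ineq]) (simp add: norm_scaleC norm_mult_ineq)
  then show "norm (unit_act z x) \<le> norm x * (norm (alg_part z) + cmod (scalar_part z))"
    by (simp add: algebra_simps)
qed

instantiation unitisation :: (cstar_algebra) real_normed_algebra_1
begin

definition "0 = Unitisation 0 0"
definition "1 = Unitisation 0 1"
definition "z + w = Unitisation (alg_part z + alg_part w) (scalar_part z + scalar_part w)"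
definition "z - w = Unitisation (alg_part z - alg_part w) (scalar_part z - scalar_part w)"
definition "- z = Unitisation (- alg_part z) (- scalar_part z)"
definition "z * w = Unitisation
  (alg_part z * alg_part w + scalar_part z *\<^sub>C alg_part w + scalar_part w *\<^sub>C alg_part z)
  (scalar_part z * scalar_part w)"
definition "r *\<^sub>R z = Unitisation (r *\<^sub>R alg_part z) (r *\<^sub>R scalar_part z)"
definition "norm z = max (onorm (unit_act z)) (cmod (scalar_part z))"
  \<comment> \<open>the maximum makes this a norm even if the algebra already has a unit\<close>
definition "sgn z = inverse (norm z) *\<^sub>R (z::'a unitisation)"
definition "dist z w = norm (z - w :: 'a unitisation)"
definition "uniformity = (INF e\<in>{0 <..}. principal {(z, w::'a unitisation). dist z w < e})"
definition "open U = (\<forall>z\<in>U. \<forall>\<^sub>F (z', w) in uniformity. z' = z \<longrightarrow> w \<in> (U::'a unitisation set))"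

lemmas unitisation_defs = zero_unitisation_def one_unitisation_def plus_unitisation_def
  minus_unitisation_def uminus_unitisation_def times_unitisation_def scaleR_unitisation_def

lemma unit_act_simps:
  "unit_act (z + w) x = unit_act z x + unit_act w x"
  "unit_act (z * w) x = unit_act z (unit_act w x)"
  "unit_act (r *\<^sub>R z) x = r *\<^sub>R unit_act z x"
  "unit_act 1 x = x"
  by (simp_all add: unit_act_def unitisation_defs algebra_simps scaleC_add_left scaleC_add_right
      scaleC_scaleC mult_scaleC_left mult_scaleC_right scaleR_scaleC scaleC_one
      scaleR_conv_of_real)

lemma scalar_part_bound: "cmod (scalar_part z) \<le> norm z"
  by (simp add: norm_unitisation_def)

lemma norm_unitisation_nonneg: "0 \<le> norm (z :: 'a unitisation)"
  by (rule order_trans[OF norm_ge_zero scalar_part_bound])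

lemma unit_act_bound: "norm (unit_act z x) \<le> norm z * norm x"
proof -
  have "norm (unit_act z x) \<le> onorm (unit_act z) * norm x"
    by (rule onorm[OF bounded_linear_unit_act])
  also have "\<dots> \<le> norm z * norm x" by (simp add: norm_unitisation_def mult_right_mono)
  finally show ?thesis .
qed

lemma norm_unitisation_le:
  assumes "\<And>x. norm (unit_act z x) \<le> c * norm x" "cmod (scalar_part z) \<le> c"
  shows "norm z \<le> c"
  unfolding norm_unitisation_def 
  using onorm_bound[OF order_trans[OF norm_ge_zero assms(2)] assms(1)] assms(2) by simp

text \<open>Evaluating the action at the adjoint of the algebra part attains its norm by the
  C*-identity, so the algebra embeds isometrically.\<close>

lemma norm_alg_part: "scalar_part z = 0 \<Longrightarrow> norm z = norm (alg_part z)"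
proof (rule antisym)
  assume 0: "scalar_part z = 0"
  show "norm z \<le> norm (alg_part z)"
    by (rule norm_unitisation_le) (simp_all add: 0 unit_act_def norm_mult_ineq)
  show "norm (alg_part z) \<le> norm z"
  proof (cases "alg_part z = 0")
    case False
    let ?x = "star (alg_part z)"
    have "norm (alg_part z) * norm (alg_part z) \<le> norm z * norm (alg_part z)"
      using unit_act_bound[of z ?x] cstar_identity[of ?x]
      by (simp add: unit_act_def 0 star_star power2_eq_square)
    with False show ?thesis by simp
  qed (simp add: norm_unitisation_nonneg)
qed

instance
proof
  fix z w v :: "'a unitisation" and r s :: real and U :: "'a unitisation set"
  show "z * w * v = z * (w * v)"
    by (simp add: unitisation_defs algebra_simps scaleC_add_right scaleC_scaleC mult_scaleC_left
        mult_scaleC_right)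
  show "(z + w) * v = z * v + w * v" "z * (w + v) = z * w + z * v"
    by (simp_all add: unitisation_defs algebra_simps scaleC_add_left scaleC_add_right)
  show "r *\<^sub>R z * w = r *\<^sub>R (z * w)" "z * r *\<^sub>R w = r *\<^sub>R (z * w)"
    by (simp_all add: unitisation_defs algebra_simps scaleC_scaleC scaleR_scaleC scaleC_add_right
        mult_scaleC_left mult_scaleC_right) (simp_all add: scaleR_conv_of_real mult_ac)
  show "norm z = 0 \<longleftrightarrow> z = 0"
  proof
    assume "norm z = 0"
    moreover from this have "scalar_part z = 0" using scalar_part_bound[of z] by simp
    ultimately show "z = 0" using norm_alg_part[of z]
      by (simp add: zero_unitisation_def unitisation.expand)
  next
    assume "z = 0"
    then show "norm z = 0" using norm_alg_part[of z] by (simp add: zero_unitisation_def)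
  qed
  show "norm (z + w) \<le> norm z + norm w"
  proof (rule norm_unitisation_le)
    show "norm (unit_act (z + w) x) \<le> (norm z + norm w) * norm x" for x
      unfolding unit_act_simps distrib_right by (intro norm_triangle_le add_mono unit_act_bound)
    show "cmod (scalar_part (z + w)) \<le> norm z + norm w"
      by (simp add: plus_unitisation_def norm_triangle_le add_mono scalar_part_bound)
  qed
  show "norm (r *\<^sub>R z) = \<bar>r\<bar> * norm z"
  proof -
    have "unit_act (r *\<^sub>R z) = (\<lambda>x. r *\<^sub>R unit_act z x)" by (simp add: fun_eq_iff unit_act_simps)
    then show ?thesis
      by (simp add: norm_unitisation_def onorm_scaleR[OF bounded_linear_unit_act]
          max_mult_distrib_left scaleR_unitisation_def)
  qed
  show "norm (z * w) \<le> norm z * norm w"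
  proof (rule norm_unitisation_le)
    fix x
    have "norm (unit_act (z * w) x) \<le> norm z * norm (unit_act w x)"
      unfolding unit_act_simps by (rule unit_act_bound)
    also have "\<dots> \<le> norm z * (norm w * norm x)"
      by (intro mult_left_mono unit_act_bound norm_unitisation_nonneg)
    finally show "norm (unit_act (z * w) x) \<le> norm z * norm w * norm x" by (simp add: mult.assoc)
    show "cmod (scalar_part (z * w)) \<le> norm z * norm w"
      using mult_mono[OF scalar_part_bound[of z] scalar_part_bound[of w]]
      by (simp add: times_unitisation_def norm_mult norm_unitisation_nonneg)
  qed
  show "norm (1::'a unitisation) = 1"
  proof (rule antisym)
    show "norm (1::'a unitisation) \<le> 1"
      by (rule norm_unitisation_le) (simp_all add: unit_act_simps, simp add: one_unitisation_def)
    show "1 \<le> norm (1::'a unitisation)"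
      using scalar_part_bound[of "1::'a unitisation"] by (simp add: one_unitisation_def)
  qed
qed (simp_all add: unitisation_defs algebra_simps sgn_unitisation_def dist_unitisation_def
    uniformity_unitisation_def open_unitisation_def scaleC_one unitisation.expand)

end

definition of_alg :: "'a::cstar_algebra \<Rightarrow> 'a unitisation"
  where "of_alg a = Unitisation a 0"

lemma alg_part_of_alg [simp]: "alg_part (of_alg a) = a"
  and scalar_part_of_alg [simp]: "scalar_part (of_alg a) = 0"
  by (simp_all add: of_alg_def)

lemma norm_of_alg [simp]: "norm (of_alg a) = norm a"
  using norm_alg_part[of "of_alg a"] by simp

lemma of_alg_diff: "of_alg (a - b) = of_alg a - of_alg b"
  by (simp add: of_alg_def unitisation_defs)

instance unitisation :: (cstar_algebra) banach
proof
  fix Z :: "nat \<Rightarrow> 'a unitisation"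
  assume Z: "Cauchy Z"
  have lin: "bounded_linear (scalar_part :: 'a unitisation \<Rightarrow> complex)"
    by (rule bounded_linear_intro[where K=1])
      (simp_all add: plus_unitisation_def scaleR_unitisation_def scalar_part_bound)
  \<comment> \<open>Removing the scalar part costs at most its modulus, hence the factor 2; so both
    coordinates of a Cauchy sequence are Cauchy.\<close>
  have dec: "norm (alg_part z) \<le> 2 * norm z" for z :: "'a unitisation"
  proof -
    have "norm (alg_part z) = norm (z - Unitisation 0 (scalar_part z))"
      by (subst norm_alg_part) (simp_all add: minus_unitisation_def)
    also have "\<dots> \<le> norm z + norm (Unitisation (0::'a) (scalar_part z))"
      by (rule norm_triangle_ineq4)
    also have "norm (Unitisation (0::'a) (scalar_part z)) \<le> cmod (scalar_part z)"
      by (rule norm_unitisation_le) (simp_all add: unit_act_def norm_scaleC)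
    finally show ?thesis using scalar_part_bound[of z] by simp
  qed
  have "bounded_linear (alg_part :: 'a unitisation \<Rightarrow> 'a)"
    by (rule bounded_linear_intro[where K=2])
      (use dec in \<open>simp_all add: plus_unitisation_def scaleR_unitisation_def mult.commute\<close>)
  from bounded_linear.Cauchy[OF this Z] obtain a where a: "(\<lambda>n. alg_part (Z n)) \<longlonglongrightarrow> a"
    by (auto simp: Cauchy_convergent_iff convergent_def)
  from bounded_linear.Cauchy[OF lin Z] obtain l where l: "(\<lambda>n. scalar_part (Z n)) \<longlonglongrightarrow> l"
    by (auto simp: Cauchy_convergent_iff convergent_def)
  have bound: "norm z \<le> norm (alg_part z) + cmod (scalar_part z)" for z :: "'a unitisation"
  proof (rule norm_unitisation_le)
    show "norm (unit_act z x) \<le> (norm (alg_part z) + cmod (scalar_part z)) * norm x" for x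
      unfolding unit_act_def distrib_right
      by (intro norm_triangle_le add_mono norm_mult_ineq) (simp add: norm_scaleC)
  qed simp
  have "(\<lambda>n. norm (alg_part (Z n) - a) + cmod (scalar_part (Z n) - l)) \<longlonglongrightarrow> 0"
    using tendsto_add[OF tendsto_norm[OF LIM_zero[OF a]] tendsto_norm[OF LIM_zero[OF l]]] by simp
  then have "(\<lambda>n. Z n - Unitisation a l) \<longlonglongrightarrow> 0"
    by (rule Lim_null_comparison[rotated])
      (use bound in \<open>auto simp: minus_unitisation_def intro!: always_eventually\<close>,
        metis bound unitisation.sel)
  then show "convergent Z" using LIM_zero_cancel convergent_def by blast
qed

instantiation unitisation :: (cstar_algebra) cstar_algebra_1
begin

definition "c *\<^sub>C z = Unitisation (c *\<^sub>C alg_part z) (c * scalar_part z)"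
definition "star z = Unitisation (star (alg_part z)) (cnj (scalar_part z))"

instance
proof
  fix z w :: "'a unitisation" and c b :: complex and r :: real
  \<comment> \<open>The C*-identity of the original algebra, applied to each value
    \<open>unit_act z x\<close>, carries over to the operator norm.\<close>
  have norm_sq: "(norm z)\<^sup>2 \<le> norm (star z * z)" for z :: "'a unitisation"
  proof -
    have "norm z \<le> sqrt (norm (star z * z))"
    proof (rule norm_unitisation_le)
      fix x :: 'a
      have "(norm (unit_act z x))\<^sup>2 = norm (star (unit_act z x) * unit_act z x)"
        by (simp add: cstar_identity)
      also have "star (unit_act z x) * unit_act z x = star x * unit_act (star z * z) x"
        by (simp add: unit_act_def times_unitisation_def star_unitisation_def star_add star_mult
            star_scaleC algebra_simps mult_scaleC_left mult_scaleC_right scaleC_scaleC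
            scaleC_add_right)
      also have "norm \<dots> \<le> norm (star x) * (norm (star z * z) * norm x)"
        by (intro order_trans[OF norm_mult_ineq] mult_left_mono unit_act_bound norm_ge_zero)
      also have "\<dots> = (sqrt (norm (star z * z)) * norm x)\<^sup>2"
        by (simp add: power_mult_distrib power2_eq_square[of "norm x"])
      finally show "norm (unit_act z x) \<le> sqrt (norm (star z * z)) * norm x"
        by (rule power2_le_imp_le) simp
      show "cmod (scalar_part z) \<le> sqrt (norm (star z * z))"
        using scalar_part_bound[of "star z * z"]
        by (intro real_le_rsqrt)
          (simp add: times_unitisation_def star_unitisation_def norm_mult power2_eq_square)
    qed
    then have "(norm z)\<^sup>2 \<le> (sqrt (norm (star z * z)))\<^sup>2" by (rule power_mono) simp
    then show ?thesis by simp
  qed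
  have star_star: "star (star z) = z" for z :: "'a unitisation"
    by (simp add: star_unitisation_def star_star)
  have "norm z \<le> norm (star z)" for z :: "'a unitisation"
  proof (cases "z = 0")
    case False
    have "norm z * norm z \<le> norm (star z) * norm z"
      using norm_sq[of z] norm_mult_ineq[of "star z" z] by (simp add: power2_eq_square)
    with False show ?thesis by simp
  qed simp
  then have "norm (star z) = norm z" by (metis star_star order_antisym)
  then show "norm (star z * z) = (norm z)\<^sup>2"
    using norm_sq[of z] norm_mult_ineq[of "star z" z] by (simp add: power2_eq_square)
  show "norm (c *\<^sub>C z) = cmod c * norm z"
  proof -
    \<comment> \<open>\<open>c\<close> and its modulus scale the norm of every value of the action
      equally, which reduces the claim to real scalars.\<close>
    have "onorm (unit_act (c *\<^sub>C z)) = onorm (unit_act (cmod c *\<^sub>R z))"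
      by (simp add: onorm_def unit_act_simps) (simp add: unit_act_def scaleC_unitisation_def
          mult_scaleC_left norm_scaleC flip: scaleC_scaleC scaleC_add_right)
    also have "\<dots> = cmod c * onorm (unit_act z)"
      using onorm_scaleR[OF bounded_linear_unit_act, of "cmod c" z]
      by (simp add: onorm_def unit_act_simps)
    finally show ?thesis
      by (simp add: norm_unitisation_def max_mult_distrib_left scaleC_unitisation_def norm_mult)
  qed
qed (simp_all add: unitisation_defs scaleC_unitisation_def star_unitisation_def algebra_simps
    scaleC_add_left scaleC_add_right scaleC_scaleC scaleC_one mult_scaleC_left mult_scaleC_right
    star_add star_mult star_scaleC star_star scaleR_scaleC scaleR_conv_of_real)

end

lemma of_alg_simps:
  "of_alg (a + b) = of_alg a + of_alg b"
  "of_alg (a * b) = of_alg a * of_alg b"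
  "of_alg (r *\<^sub>R a) = r *\<^sub>R of_alg a"
  "of_alg (star a) = star (of_alg a)"
  "of_alg 0 = 0"
  by (simp_all add: of_alg_def unitisation_defs star_unitisation_def)

lemma inj_of_alg: "of_alg a = of_alg b \<longleftrightarrow> a = b"
  by (simp add: of_alg_def)

lemma of_alg_times: "of_alg a * z = of_alg (a * alg_part z + scalar_part z *\<^sub>C a)"
  by (simp add: of_alg_def times_unitisation_def)

lemma sa_square_of_alg: "sa_square (of_alg (star a * a))"
  unfolding of_alg_simps by (rule sa_square_star_mult_self)

section \<open>Closed ideals\<close>

lemma csubspace_iff:
  "csubspace S \<longleftrightarrow> 0 \<in> S \<and> (\<forall>x\<in>S. \<forall>y\<in>S. x + y \<in> S) \<and> (\<forall>c. \<forall>x\<in>S. c *\<^sub>C x \<in> S)"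
  by (simp add: module.subspace_def[OF module_scaleC])

lemma csubspaceD:
  assumes "csubspace S"
  shows "0 \<in> S" "x \<in> S \<Longrightarrow> y \<in> S \<Longrightarrow> x + y \<in> S" "x \<in> S \<Longrightarrow> c *\<^sub>C x \<in> S"
    "x \<in> S \<Longrightarrow> - x \<in> S" "x \<in> S \<Longrightarrow> y \<in> S \<Longrightarrow> x - y \<in> S"
proof -
  show 1: "0 \<in> S" "x \<in> S \<Longrightarrow> y \<in> S \<Longrightarrow> x + y \<in> S" "x \<in> S \<Longrightarrow> c *\<^sub>C x \<in> S" for x y c
    using assms by (auto simp: csubspace_iff)
  show 2: "x \<in> S \<Longrightarrow> - x \<in> S" for x using 1(3)[of x "- 1"] by (simp add: scaleC_minus1)
  show "x \<in> S \<Longrightarrow> y \<in> S \<Longrightarrow> x - y \<in> S" using 1(2)[OF _ 2] by simp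
qed

lemma cstar_idealD:
  assumes "cstar_ideal I"
  shows "0 \<in> I" "x \<in> I \<Longrightarrow> y \<in> I \<Longrightarrow> x + y \<in> I" "x \<in> I \<Longrightarrow> c *\<^sub>C x \<in> I"
    "x \<in> I \<Longrightarrow> - x \<in> I" "x \<in> I \<Longrightarrow> y \<in> I \<Longrightarrow> x - y \<in> I"
    "x \<in> I \<Longrightarrow> a * x \<in> I" "x \<in> I \<Longrightarrow> x * a \<in> I" "closed I"
    "x \<in> I \<Longrightarrow> r *\<^sub>R x \<in> I"
  using assms unfolding cstar_ideal_def by (auto simp: csubspaceD scaleR_scaleC)

lemma closed_approachable:
  assumes "closed I" "\<And>\<epsilon>. \<epsilon> > 0 \<Longrightarrow> \<exists>y\<in>I. norm (x - y) < \<epsilon>"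
  shows "x \<in> (I :: 'a::real_normed_vector set)"
  using assms by (metis closure_approachable closure_eq dist_norm norm_minus_commute)

text \<open>Scale \<open>star x * x\<close> to \<open>t\<close> of norm at most 1. Then
  \<open>e = 1 - (1 - t)^n\<close> has no constant term, so it lies in \<open>I\<close>, and
  \<open>norm (x - x * e)\<close> squared is at most c times the norm of
  \<open>t * (1 - t)^n\<close>, which is at most 1/n. Asking for \<open>star x * x\<close> in
  \<open>I\<close>, rather than \<open>x\<close>, lets the lemma prove membership of
  \<open>x\<close>.\<close>

lemma ideal_approx_unit:
  fixes x :: "'a::cstar_algebra"
  assumes I: "cstar_ideal I" and x: "star x * x \<in> I" and "\<delta> > 0"
  obtains e where "e \<in> I" "star e = e" "norm (1 - of_alg e) \<le> 1" "norm (x - x * e) < \<delta>"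
proof (cases "x = 0")
  case True
  then show ?thesis using that[of 0] assms by (simp add: cstar_idealD of_alg_simps)
next
  case False
  define c where "c = (norm x)\<^sup>2"
  have c: "c > 0" using False by (simp add: c_def)
  define t' where "t' = (1 / c) *\<^sub>R (star x * x)"
  define t where "t = of_alg t'"
  define U where "U = 1 - t"
  have t'I: "t' \<in> I" unfolding t'_def by (rule cstar_idealD(9)[OF I x])
  have post: "sa_square t"
    using c sa_square_scaleR[OF sa_square_of_alg[of x], of "1 / c"]
    by (simp add: t_def t'_def of_alg_simps)
  have st: "star t = t" by (rule sa_square_star[OF post])
  have nt: "norm t \<le> 1" using c by (simp add: t_def t'_def cstar_identity c_def)
  have posU: "sa_square U" using sa_square_diff_norm[OF st nt] by (simp add: U_def)
  have sU: "star U = U" by (rule sa_square_star[OF posU])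
  have nU: "norm U \<le> 1" using sa_square_norm[OF post nt] by (simp add: U_def)
  have nUn: "norm (U ^ n) \<le> 1" for n
    using norm_power_ineq[of U n] power_le_one[OF norm_ge_zero nU] order_trans by blast
  have ex: "\<exists>e\<in>I. star e = e \<and> U ^ n = 1 - of_alg e" for n
  proof (induction n)
    case 0
    then show ?case using cstar_idealD(1)[OF I] by (intro bexI[of _ 0]) (simp_all add: of_alg_simps)
  next
    case (Suc n)
    then obtain e where e: "e \<in> I" "star e = e" "U ^ n = 1 - of_alg e" by blast
    let ?e = "e + t' - e * t'"
    have eq: "U ^ Suc n = 1 - of_alg ?e"
      by (subst power_Suc2, subst e(3)) (simp add: U_def t_def of_alg_simps of_alg_diff algebra_simps)
    have "star (1 - of_alg ?e) = 1 - of_alg ?e" unfolding eq[symmetric] by (simp only: star_power sU)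
    then have "star (of_alg ?e) = of_alg ?e" unfolding star_diff star_one by simp
    then have "star ?e = ?e" by (simp only: inj_of_alg flip: of_alg_simps(4))
    moreover have "?e \<in> I" by (intro cstar_idealD(2,5,6)[OF I] e t'I)
    ultimately show ?case using eq by blast
  qed
  have com: "t * U ^ n = U ^ n * t" for n
    by (rule power_commuting_commutes[symmetric]) (simp add: U_def algebra_simps)
  have tU: "sa_square (t * U ^ n)" for n
    by (intro sa_square_mult post sa_square_power posU com)
  \<comment> \<open>Operator form of \<open>1 - (1 - t)^n \<ge> n t (1 - t)^n\<close> for t between
    0 and 1; the step from n to n + 1 adds \<open>(n + 1) t^2 (1 - t)^n\<close> to the
    difference.\<close>
  have Q: "sa_square (1 - U ^ n - real n *\<^sub>R (t * U ^ n))" for n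
  proof (induction n)
    case (Suc n)
    have "sa_square (t * (t * U ^ n))"
      by (rule sa_square_mult[OF post tU]) (simp add: com flip: mult.assoc)
    then have "sa_square (1 - U ^ n - real n *\<^sub>R (t * U ^ n) + real (Suc n) *\<^sub>R (t * (t * U ^ n)))"
      by (intro sa_square_add Suc sa_square_scaleR) simp_all
    moreover have "1 - U ^ Suc n - real (Suc n) *\<^sub>R (t * U ^ Suc n) =
      1 - U ^ n - real n *\<^sub>R (t * U ^ n) + real (Suc n) *\<^sub>R (t * (t * U ^ n))"
      by (simp add: U_def[symmetric] scaleR_add_left) (simp add: U_def algebra_simps)
    ultimately show ?case by (simp only:)
  qed simp
  have tn: "real n * norm (t * U ^ n) \<le> 1" for n
  proof -
    have "sa_square (1 - real n *\<^sub>R (t * U ^ n))"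
      using sa_square_add[OF Q[of n] sa_square_power[OF posU, of n]] by (simp add: algebra_simps)
    then have "norm (real n *\<^sub>R (t * U ^ n)) \<le> 1"
      by (intro norm_le_of_sa_square sa_square_scaleR tU) simp_all
    then show ?thesis by simp
  qed
  obtain n where n: "real n > c / \<delta>\<^sup>2" using reals_Archimedean2 by blast
  then have n0: "real n > 0" using c assms(3) by (smt (verit) divide_nonneg_nonneg zero_le_power2)
  obtain e where e: "e \<in> I" "star e = e" "U ^ n = 1 - of_alg e" using ex by blast
  have eq: "of_alg (x - x * e) = of_alg x * U ^ n"
    by (simp add: e of_alg_diff of_alg_simps algebra_simps)
  have "star (of_alg x * U ^ n) * (of_alg x * U ^ n) = U ^ n * (of_alg (star x * x) * U ^ n)"
    by (simp add: star_mult star_power sU of_alg_simps mult.assoc)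
  also have "of_alg (star x * x) = c *\<^sub>R t" using c by (simp add: t_def t'_def of_alg_simps)
  finally have "(norm (x - x * e))\<^sup>2 = norm (U ^ n * (c *\<^sub>R t * U ^ n))"
    using cstar_identity[of "of_alg (x - x * e)"] by (simp add: eq[symmetric])
  also have "\<dots> = c * norm (U ^ n * (t * U ^ n))" using c by simp
  also have "\<dots> \<le> c * (norm (U ^ n) * norm (t * U ^ n))"
    using c by (intro mult_left_mono norm_mult_ineq) simp
  also have "\<dots> \<le> c * (1 * (1 / real n))"
    using c n0 tn[of n] nUn by (intro mult_left_mono mult_mono) (simp_all add: field_simps)
  also have "\<dots> < \<delta>\<^sup>2" using n n0 assms(3) by (simp add: field_simps)
  finally have "norm (x - x * e) < \<delta>" using assms(3) by (simp add: power2_less_imp_less)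
  moreover have "norm (1 - of_alg e) \<le> 1" using nUn[of n] e by simp
  ultimately show ?thesis using that e by blast
qed

text \<open>The element \<open>x * e\<close> lies in \<open>I\<close> along with \<open>e\<close>
  and approximates \<open>x\<close>. In the quotient this says that \<open>star x * x = 0\<close>
  forces \<open>x = 0\<close>.\<close>

lemma ideal_star_mult_self:
  assumes I: "cstar_ideal I" and x: "star x * x \<in> I"
  shows "x \<in> I"
proof (rule closed_approachable)
  show "closed I" by (rule cstar_idealD[OF I])
  show "\<exists>y\<in>I. norm (x - y) < \<epsilon>" if "\<epsilon> > 0" for \<epsilon>
    using ideal_approx_unit[OF assms that] cstar_idealD(6)[OF I] by metis
qed

lemma ideal_star:
  assumes I: "cstar_ideal I" and x: "x \<in> I"
  shows "star x \<in> I"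
  by (rule ideal_star_mult_self[OF I]) (simp add: star_star cstar_idealD[OF I] x)

text \<open>Compressing by \<open>1 - e\<close> for an approximate unit \<open>e\<close> of \<open>I\<close> plays the role of passing to the
  quotient by \<open>I\<close>.\<close>

lemma ideal_dominated:
  fixes k :: "'a::cstar_algebra"
  assumes I: "cstar_ideal I"
    and ex: "\<And>\<delta>. \<delta> > 0 \<Longrightarrow> \<exists>b. \<exists>i\<in>I. norm (star k * k + star b * b - i) < \<delta>"
  shows "k \<in> I"
proof (rule closed_approachable)
  show "closed I" by (rule cstar_idealD[OF I])
  fix \<epsilon> :: real assume "\<epsilon> > 0"
  \<comment> \<open>One half bounds the error \<open>w\<close>, the other the defect
    \<open>i - i * e\<close>; the target is \<open>\<epsilon>\<close> squared because the
    C*-identity squares the norm of \<open>k\<close>.\<close>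
  define \<delta> where "\<delta> = \<epsilon>\<^sup>2 / 2"
  have d: "\<delta> > 0" using \<open>\<epsilon> > 0\<close> by (simp add: \<delta>_def)
  obtain b i where b: "i \<in> I" "norm (star k * k + star b * b - i) < \<delta>" using ex[OF d] by blast
  obtain e where e: "e \<in> I" "star e = e" "norm (1 - of_alg e) \<le> 1" "norm (i - i * e) < \<delta>"
    using ideal_approx_unit[OF I cstar_idealD(6)[OF I b(1)] d] by metis
  define T where "T = 1 - of_alg e"
  have sT: "star T = T" by (simp add: T_def star_diff e flip: of_alg_simps(4))
  have nT: "norm T \<le> 1" by (simp add: T_def e)
  define w where "w = star k * k + star b * b - i"
  let ?k = "of_alg k * T" and ?b = "of_alg b * T"
  have "star ?k * ?k + star ?b * ?b = T * (of_alg w * T) + T * (of_alg i * T)"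
    by (simp add: w_def star_mult sT of_alg_simps of_alg_diff algebra_simps)
  also have "norm \<dots> \<le> norm (of_alg w * T) + norm (of_alg i * T)"
    using nT by (intro norm_triangle_le add_mono order_trans[OF norm_mult_ineq] mult_left_le_one_le)
      simp_all
  also have "of_alg i * T = of_alg (i - i * e)"
    by (simp add: T_def of_alg_diff of_alg_simps algebra_simps)
  also have "norm (of_alg w * T) + norm (of_alg (i - i * e)) \<le> norm w + norm (of_alg (i - i * e))"
    using nT by (intro add_right_mono order_trans[OF norm_mult_ineq]) (simp add: mult_left_le)
  also have "norm w + norm (of_alg (i - i * e)) < \<epsilon>\<^sup>2" using b(2) e(4) by (simp add: w_def \<delta>_def)
  finally have "norm (star ?k * ?k + star ?b * ?b) < \<epsilon>\<^sup>2" .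
  moreover have "norm (star ?k * ?k) \<le> norm (star ?k * ?k + star ?b * ?b)"
    by (rule norm_mono_sa_square) (simp_all add: sa_square_star_mult_self)
  ultimately have "(norm ?k)\<^sup>2 < \<epsilon>\<^sup>2" by (simp add: cstar_identity)
  then have "norm ?k < \<epsilon>" using \<open>\<epsilon> > 0\<close> by (simp add: power2_less_imp_less)
  moreover have "?k = of_alg (k - k * e)"
    by (simp add: T_def of_alg_diff of_alg_simps algebra_simps)
  ultimately have "norm (k - k * e) < \<epsilon>" by simp
  then show "\<exists>y\<in>I. norm (k - y) < \<epsilon>" using cstar_idealD(6)[OF I e(1)] by blast
qed

text \<open>\<open>g = h (h - \<epsilon>)\<^sub>+\<close> lives on the part of the spectrum of \<open>h\<close> above \<open>\<epsilon>\<close>, where \<open>h\<^sup>N \<ge> \<epsilon>\<^sup>N\<close>.\<close>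

lemma spectral_cutoff:
  fixes a :: "'a::cstar_algebra"
  assumes "\<epsilon> > 0" and h: "h = star a * a"
  obtains g where "star g = g" "\<And>I. cstar_ideal I \<Longrightarrow> h \<in> I \<Longrightarrow> g \<in> I"
    "norm (h * h - g) \<le> 2 * \<epsilon> * norm h"
    "\<And>N. \<exists>b. star (((\<lambda>x. h * x) ^^ N) g) * (((\<lambda>x. h * x) ^^ N) g) = (\<epsilon> ^ N)\<^sup>2 *\<^sub>R (g * g) + star b * b"
proof -
  define H where "H = of_alg h"
  define d where "d = H - of_real \<epsilon>"
  have posH: "sa_square H" unfolding H_def h by (rule sa_square_of_alg)
  have sH: "star H = H" by (rule sa_square_star[OF posH])
  have sd: "star d = d" by (simp add: d_def star_diff sH)
  obtain s where s: "sa_square s" "star s = s" "s * s = d * d"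
    and s_com: "\<And>z. z * d = d * z \<Longrightarrow> z * s = s * z"
    using sa_square_abs[OF sd] by metis
  have Hd: "H * d = d * H" by (simp add: d_def algebra_simps) (simp add: of_real_def)
  have Hs: "H * s = s * H" by (rule s_com[OF Hd])
  have ds: "d * s = s * d" by (rule s_com) simp
  \<comment> \<open>\<open>p\<close> and \<open>q\<close> are the positive and negative parts of
    \<open>H - \<epsilon>\<close>.\<close>
  define p where "p = (1/2) *\<^sub>R (s + d)"
  define q where "q = (1/2) *\<^sub>R (s - d)"
  have sp: "star p = p" and sq: "star q = q"
    by (simp_all add: p_def q_def star_scaleR star_add star_diff s(2) sd)
  have Hp: "H * p = p * H" and Hq: "H * q = q * H"
    by (simp_all add: p_def q_def algebra_simps Hs Hd)
  have pq: "p * q = 0" "q * p = 0" by (simp_all add: p_def q_def algebra_simps s(3) ds)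
  have spq: "s = p + q" and dpq: "d = p - q"
    by (simp_all add: p_def q_def algebra_simps flip: scaleR_add_left)
  have Hpq: "H = p - q + of_real \<epsilon>" using dpq unfolding d_def by (metis diff_add_cancel)
  have ps: "p * s = s * p" and qs: "q * s = s * q" by (simp_all add: spq algebra_simps pq)
  \<comment> \<open>Conjugating the positive element \<open>s = p + q\<close> by \<open>p\<close> or
    \<open>q\<close> gives cubes, as mixed products vanish; the positivity of both parts is used in
    this form.\<close>
  have p3: "sa_square (p * p * p)"
    using sa_square_conj[OF s(1) ps sp] by (simp add: spq algebra_simps pq)
  have q3: "sa_square (q * q * q)"
    using sa_square_conj[OF s(1) qs sq] by (simp add: spq algebra_simps pq)
  have Hcube: "x * x * x * H = H * (x * x * x)" if "H * x = x * H" for x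
    by (metis that mult.assoc)

  \<comment> \<open>From \<open>q * H = \<epsilon> q - q^2\<close> follows
    \<open>q^4 = \<epsilon> q^3 - q^3 H\<close>, which is dominated by
    \<open>\<epsilon> q^3\<close>; compare norms and cancel the cube of
    \<open>norm q\<close>.\<close>
  have "norm q \<le> \<epsilon>"
  proof -
    have q3H: "sa_square (q * q * q * H)" by (intro sa_square_mult q3 posH Hcube Hq)
    have "q * q * (q * q) = \<epsilon> *\<^sub>R (q * q * q) - q * q * q * H"
    proof -
      have "q * d = - (q * q)" by (simp add: dpq algebra_simps pq)
      moreover have "q * d = q * H - \<epsilon> *\<^sub>R q" by (simp add: d_def of_real_def algebra_simps)
      ultimately have "q * q = \<epsilon> *\<^sub>R q - q * H" by (simp add: algebra_simps)
      then have "q * q * (q * q) = q * q * (\<epsilon> *\<^sub>R q - q * H)" by simp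
      then show ?thesis by (simp add: right_diff_distrib mult.assoc)
    qed
    then have "sa_square (\<epsilon> *\<^sub>R (q * q * q) - q * q * (q * q))" using q3H by simp
    then have "norm (q * q * (q * q)) \<le> norm (\<epsilon> *\<^sub>R (q * q * q))"
      by (rule norm_mono_sa_square[rotated]) (simp add: sa_squareI star_mult sq)
    also have "\<dots> \<le> \<epsilon> * (norm q * norm q * norm q)"
      using assms(1) norm_mult_ineq[of "q * q" q] mult_right_mono[OF norm_mult_ineq[of q q] norm_ge_zero[of q]]
      by simp
    also have "norm (q * q * (q * q)) = norm q * (norm q * norm q * norm q)"
      using norm_mult_self_adjoint[of "q * q"] norm_mult_self_adjoint[OF sq]
      by (simp add: star_mult sq power2_eq_square)
    finally show ?thesis
      using assms(1) by (cases "q = 0") simp_all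
  qed
  moreover have "H - p = of_real \<epsilon> - q" by (simp add: Hpq)
  ultimately have Hp_norm: "norm (H - p) \<le> 2 * \<epsilon>"
    using norm_triangle_ineq4[of "of_real \<epsilon>" q] assms(1) by simp

  \<comment> \<open>Positivity of \<open>A N * (p * p)\<close> says
    \<open>H^(2N) \<ge> \<epsilon>^(2N)\<close> where \<open>p\<close> lives. It starts from
    \<open>A 1 = (H + \<epsilon>) d\<close> and \<open>d * (p * p) = p * p * p\<close>, and
    continues by \<open>A (N + 1) = H (A N) H + \<epsilon>^(2N) A 1\<close>.\<close>
  define A where "A N = H ^ (2 * N) - (\<epsilon> ^ N)\<^sup>2 *\<^sub>R 1" for N
  have Hpp: "p * p * H = H * (p * p)"
  proof -
    have "p * p * H = p * (H * p)" by (simp add: Hp mult.assoc)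
    also have "\<dots> = p * H * p" by (simp only: mult.assoc)
    also have "\<dots> = H * p * p" by (simp only: Hp)
    finally show ?thesis by (simp only: mult.assoc)
  qed
  have HA: "H * A N = A N * H" for N
    by (simp add: A_def algebra_simps power_commutes)
  have HW: "H * (A N * (p * p)) = A N * (p * p) * H" for N
  proof -
    have "H * (A N * (p * p)) = A N * H * (p * p)" by (simp only: HA flip: mult.assoc)
    also have "\<dots> = A N * (H * (p * p))" by (simp only: mult.assoc)
    also have "\<dots> = A N * (p * p) * H" by (simp only: Hpp[symmetric] mult.assoc)
    finally show ?thesis .
  qed
  have W1: "sa_square (A 1 * (p * p))"
  proof -
    have "sa_square ((H + \<epsilon> *\<^sub>R 1) * (p * p * p))"
      using assms(1) Hcube[OF Hp, symmetric]
      by (intro sa_square_mult sa_square_add posH p3 sa_square_scaleR) (simp_all add: algebra_simps)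
    moreover have "d * (p * p) = p * p * p" by (simp add: dpq left_diff_distrib pq flip: mult.assoc)
    then have "(H + \<epsilon> *\<^sub>R 1) * (p * p * p) = (H + \<epsilon> *\<^sub>R 1) * d * (p * p)" by (simp add: mult.assoc)
    moreover have "(H + \<epsilon> *\<^sub>R 1) * d = A 1"
      by (simp add: A_def d_def of_real_def algebra_simps power2_eq_square)
    ultimately show ?thesis by simp
  qed
  have W: "sa_square (A N * (p * p))" for N
  proof (induction N)
    case (Suc N)
    have 1: "sa_square (H * (A N * (p * p)) * H)" by (rule sa_square_conj[OF Suc HW sH])
    have "A (Suc N) = H * A N * H + (\<epsilon> ^ N)\<^sup>2 *\<^sub>R A 1"
      by (simp add: A_def algebra_simps power_commutes power_mult_distrib power2_eq_square)
    then have "A (Suc N) * (p * p) = H * A N * H * (p * p) + (\<epsilon> ^ N)\<^sup>2 *\<^sub>R (A 1 * (p * p))"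
      by (simp add: distrib_right)
    also have "H * A N * H * (p * p) = H * (A N * (p * p)) * H"
      by (simp only: mult.assoc Hpp[unfolded mult.assoc])
    finally show ?case using 1 W1 by (simp add: sa_square_add sa_square_scaleR)
  qed (simp add: A_def)

  \<comment> \<open>A factor \<open>h\<close> brings elements of the unitisation back into the
    algebra, and into every ideal containing \<open>h\<close>; \<open>b\<close> below is built in
    the same way.\<close>
  define g where "g = h * alg_part p + scalar_part p *\<^sub>C h"
  have g: "of_alg g = H * p" by (simp add: H_def g_def of_alg_times)
  show thesis
  proof (rule that[of g])
    have "of_alg (star g) = of_alg g" by (simp add: of_alg_simps g star_mult sp sH Hp)
    then show "star g = g" by (simp add: inj_of_alg)
    show "g \<in> I" if "cstar_ideal I" "h \<in> I" for I
      unfolding g_def using that cstar_idealD by metis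
    have "of_alg (h * h - g) = H * (H - p)"
      by (simp add: of_alg_diff of_alg_simps g algebra_simps H_def)
    then have "norm (h * h - g) = norm (H * (H - p))" by (metis norm_of_alg)
    also have "\<dots> \<le> norm H * (2 * \<epsilon>)"
      by (rule order_trans[OF norm_mult_ineq]) (intro mult_left_mono Hp_norm norm_ge_zero)
    finally show "norm (h * h - g) \<le> 2 * \<epsilon> * norm h" by (simp add: H_def mult.commute)
    fix N
    \<comment> \<open>Iterated left multiplication stands for the power \<open>h^N\<close>, which is
      thereby meaningful without a unit.\<close>
    have pow: "of_alg (((\<lambda>x. h * x) ^^ N) g) = H ^ N * (H * p)"
      by (induction N) (simp_all add: g of_alg_simps H_def mult.assoc)
    obtain m where m: "star m = m" "m * m = A N * (p * p)"
        "\<And>z. z * (A N * (p * p)) = A N * (p * p) * z \<Longrightarrow> z * m = m * z"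
      using sa_squareE[OF W[of N]] by metis
    have Hm: "H * m = m * H" by (rule m(3)[OF HW])
    define b where "b = h * alg_part m + scalar_part m *\<^sub>C h"
    have b: "of_alg b = H * m" by (simp add: H_def b_def of_alg_times)
    have "of_alg (star b * b) = m * H * (H * m)"
      by (simp add: of_alg_simps(2,4) b star_mult m(1) sH)
    also have "\<dots> = H * m * (m * H)" by (simp only: Hm)
    also have "\<dots> = H * (m * m) * H" by (simp only: mult.assoc)
    also have "\<dots> = H * A N * H * (p * p)" unfolding m(2) by (simp only: mult.assoc Hpp[unfolded mult.assoc])
    also have "\<dots> = H * H ^ (2 * N) * H * (p * p) - (\<epsilon> ^ N)\<^sup>2 *\<^sub>R (H * H * (p * p))"
      by (simp add: A_def left_diff_distrib right_diff_distrib)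
    also have "H * H * (p * p) = of_alg (g * g)"
    proof -
      have "p * (H * p) = H * (p * p)" by (simp only: Hp[symmetric] flip: mult.assoc)
      then show ?thesis by (simp only: of_alg_simps(2) g mult.assoc)
    qed
    also have "H * H ^ (2 * N) * H * (p * p) = of_alg (star (((\<lambda>x. h * x) ^^ N) g) * (((\<lambda>x. h * x) ^^ N) g))"
    proof -
      have "of_alg (star (((\<lambda>x. h * x) ^^ N) g) * (((\<lambda>x. h * x) ^^ N) g)) = p * H * H ^ N * (H ^ N * (H * p))"
        by (simp only: of_alg_simps(2,4) pow star_mult star_power sH sp)
      also have "\<dots> = p * (H * H ^ (2 * N) * H) * p"
        by (simp add: mult.assoc mult_2 power_add)
      also have "H * H ^ (2 * N) * H = H ^ (2 * N + 2)" by (simp add: power_commutes mult.assoc)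
      also have "p * H ^ (2 * N + 2) = H ^ (2 * N + 2) * p"
        by (rule power_commuting_commutes[OF Hp, symmetric])
      finally show ?thesis by (simp add: power_commutes mult.assoc)
    qed
    finally have "star (((\<lambda>x. h * x) ^^ N) g) * (((\<lambda>x. h * x) ^^ N) g) = (\<epsilon> ^ N)\<^sup>2 *\<^sub>R (g * g) + star b * b"
      by (simp add: inj_of_alg flip: of_alg_diff of_alg_simps)
    then show "\<exists>b. star (((\<lambda>x. h * x) ^^ N) g) * (((\<lambda>x. h * x) ^^ N) g) = (\<epsilon> ^ N)\<^sup>2 *\<^sub>R (g * g) + star b * b" ..
  qed
qed

section \<open>Hilbert modules and their operators\<close>

context hilbert_module
begin

lemmas carr_zero = csubspaceD(1)[OF carr_subspace]
  and carr_add = csubspaceD(2)[OF carr_subspace]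
  and carr_scaleC = csubspaceD(3)[OF carr_subspace]
  and carr_minus = csubspaceD(4)[OF carr_subspace]
  and carr_diff = csubspaceD(5)[OF carr_subspace]

lemmas carr_intros [simp] = carr_zero carr_add carr_scaleC carr_minus carr_diff ract_closed

lemma ip_add_left:
  "\<xi> \<in> carr X \<Longrightarrow> \<eta> \<in> carr X \<Longrightarrow> \<zeta> \<in> carr X \<Longrightarrow> ip X (\<xi> + \<eta>) \<zeta> = ip X \<xi> \<zeta> + ip X \<eta> \<zeta>"
  using ip_star[of \<zeta> "\<xi> + \<eta>"] ip_star[of \<zeta> \<xi>] ip_star[of \<zeta> \<eta>] by (simp add: ip_add star_add)

lemma ip_scaleC_left:
  "\<xi> \<in> carr X \<Longrightarrow> \<eta> \<in> carr X \<Longrightarrow> ip X (c *\<^sub>C \<xi>) \<eta> = cnj c *\<^sub>C ip X \<xi> \<eta>"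
  using ip_star[of \<eta> "c *\<^sub>C \<xi>"] ip_star[of \<eta> \<xi>] by (simp add: ip_scaleC star_scaleC)

lemma ip_ract_left:
  "\<xi> \<in> carr X \<Longrightarrow> \<eta> \<in> carr X \<Longrightarrow> ip X (ract X \<xi> a) \<eta> = star a * ip X \<xi> \<eta>"
  using ip_star[of \<eta> "ract X \<xi> a"] ip_star[of \<eta> \<xi>] by (simp add: ip_ract star_mult)

lemma ip_minus: "\<xi> \<in> carr X \<Longrightarrow> \<eta> \<in> carr X \<Longrightarrow> ip X \<xi> (- \<eta>) = - ip X \<xi> \<eta>"
  using ip_scaleC[of \<xi> \<eta> "- 1"] by (simp add: scaleC_minus1)

lemma ip_minus_left: "\<xi> \<in> carr X \<Longrightarrow> \<eta> \<in> carr X \<Longrightarrow> ip X (- \<xi>) \<eta> = - ip X \<xi> \<eta>"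
  using ip_scaleC_left[of \<xi> \<eta> "- 1"] by (simp add: scaleC_minus1)

lemma ip_diff: "\<xi> \<in> carr X \<Longrightarrow> \<eta> \<in> carr X \<Longrightarrow> \<zeta> \<in> carr X \<Longrightarrow> ip X \<xi> (\<eta> - \<zeta>) = ip X \<xi> \<eta> - ip X \<xi> \<zeta>"
  using ip_add[of \<xi> \<eta> "- \<zeta>"] by (simp add: ip_minus)

lemma ip_diff_left: "\<xi> \<in> carr X \<Longrightarrow> \<eta> \<in> carr X \<Longrightarrow> \<zeta> \<in> carr X \<Longrightarrow> ip X (\<xi> - \<eta>) \<zeta> = ip X \<xi> \<zeta> - ip X \<eta> \<zeta>"
  using ip_add_left[of \<xi> "- \<eta>" \<zeta>] by (simp add: ip_minus_left)

lemma ip_zero [simp]: "\<xi> \<in> carr X \<Longrightarrow> ip X \<xi> 0 = 0" "\<xi> \<in> carr X \<Longrightarrow> ip X 0 \<xi> = 0"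
  using ip_scaleC[of \<xi> 0 0] ip_scaleC_left[of 0 \<xi> 0] by simp_all

lemma eq_if_ip_eq:
  assumes "\<xi> \<in> carr X" "\<eta> \<in> carr X" "\<And>\<zeta>. \<zeta> \<in> carr X \<Longrightarrow> ip X \<zeta> \<xi> = ip X \<zeta> \<eta>"
  shows "\<xi> = \<eta>"
  using ip_definite[of "\<xi> - \<eta>"] assms by (simp add: ip_diff)

lemma sa_square_ip: "\<xi> \<in> carr X \<Longrightarrow> sa_square (of_alg (ip X \<xi> \<xi>))"
  using ip_positive sa_square_of_alg unfolding cstar_positive_def by metis

lemma hnorm_nonneg [simp]: "0 \<le> hnorm X \<xi>"
  by (simp add: hnorm_def)

lemma hnorm_square: "(hnorm X \<xi>)\<^sup>2 = norm (ip X \<xi> \<xi>)"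
  by (simp add: hnorm_def)

text \<open>Positivity of \<open>\<langle>\<zeta>, \<zeta>\<rangle>\<close> for \<open>\<zeta> = s \<xi> - \<eta> v\<close>, where \<open>s = \<parallel>\<langle>\<eta>, \<eta>\<rangle>\<parallel>\<close> and \<open>v = \<langle>\<eta>, \<xi>\<rangle>\<close>.\<close>

lemma Cauchy_Schwarz:
  assumes "\<xi> \<in> carr X" "\<eta> \<in> carr X"
  shows "norm (ip X \<eta> \<xi>) \<le> hnorm X \<eta> * hnorm X \<xi>"
proof (cases "ip X \<eta> \<eta> = 0")
  case True
  then have "\<eta> = 0" using ip_definite assms by blast
  then show ?thesis using assms by simp
next
  case False
  define s where "s = norm (ip X \<eta> \<eta>)"
  define v where "v = ip X \<eta> \<xi>"
  define \<zeta> where "\<zeta> = complex_of_real s *\<^sub>C \<xi> - ract X \<eta> v"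
  have s: "s > 0" using False by (simp add: s_def)
  have \<zeta>: "\<zeta> \<in> carr X" using assms by (simp add: \<zeta>_def)
  have v: "ip X \<xi> \<eta> = star v" using assms by (simp add: v_def ip_star)
  define V where "V = of_alg v"
  define P where "P = of_alg (ip X \<xi> \<xi>)"
  define K where "K = of_alg (ip X \<eta> \<eta>)"
  have "ip X \<zeta> \<zeta> = s\<^sup>2 *\<^sub>R ip X \<xi> \<xi> - (2 * s) *\<^sub>R (star v * v) + star v * ip X \<eta> \<eta> * v"
    using assms unfolding \<zeta>_def
    by (simp add: ip_diff ip_diff_left ip_scaleC ip_scaleC_left ip_ract ip_ract_left v v_def[symmetric]
        algebra_simps power2_eq_square scaleR_2 flip: scaleR_scaleC scaleR_scaleR)
  then have "of_alg (ip X \<zeta> \<zeta>) = s\<^sup>2 *\<^sub>R P - (2 * s) *\<^sub>R (star V * V) + star V * K * V"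
    by (simp add: of_alg_simps of_alg_diff P_def V_def K_def)
  \<comment> \<open>A root of the positive element \<open>s - K\<close> exhibits
    \<open>star V * (s - K) * V\<close> as a star product.\<close>
  moreover obtain l where l: "star l = l" "of_real s - K = l * l"
  proof -
    have "sa_square (of_real s - K)"
      by (rule sa_square_diff_norm) (use sa_square_star[OF sa_square_ip[OF assms(2)]] in \<open>simp_all add: K_def s_def\<close>)
    then show ?thesis using that by (auto simp: sa_square_def)
  qed
  then have "star (l * V) * (l * V) = star V * (of_real s - K) * V"
    by (simp add: star_mult mult.assoc)
  then have "star (l * V) * (l * V) = s *\<^sub>R (star V * V) - star V * K * V"
    by (simp add: of_real_def algebra_simps)
  ultimately have "of_alg (ip X \<zeta> \<zeta>) + star (l * V) * (l * V) = s\<^sup>2 *\<^sub>R P - s *\<^sub>R (star V * V)"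
    by (simp only: mult_2 scaleR_add_left) simp
  then have "s\<^sup>2 *\<^sub>R P - s *\<^sub>R (star V * V) = of_alg (ip X \<zeta> \<zeta>) + star (l * V) * (l * V)"
    by simp
  then have "sa_square (s\<^sup>2 *\<^sub>R P - s *\<^sub>R (star V * V))"
    using sa_square_add[OF sa_square_ip[OF \<zeta>] sa_square_star_mult_self[of "l * V"]] by simp
  then have "norm (s *\<^sub>R (star V * V)) \<le> norm (s\<^sup>2 *\<^sub>R P)"
    using s by (intro norm_mono_sa_square sa_square_scaleR sa_square_star_mult_self) simp_all
  then have "s * (norm v)\<^sup>2 \<le> s * (s * norm (ip X \<xi> \<xi>))"
    using s by (simp add: cstar_identity V_def P_def power2_eq_square mult.assoc)
  then have "(norm v)\<^sup>2 \<le> (hnorm X \<eta> * hnorm X \<xi>)\<^sup>2"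
    using s by (simp add: power_mult_distrib hnorm_square s_def)
  then show ?thesis unfolding v_def by (rule power2_le_imp_le) simp
qed

lemma hnorm_zero [simp]: "hnorm X 0 = 0"
  by (simp add: hnorm_def carr_zero)

lemma hnorm_scaleC: "\<xi> \<in> carr X \<Longrightarrow> hnorm X (c *\<^sub>C \<xi>) = cmod c * hnorm X \<xi>"
  by (simp add: hnorm_def ip_scaleC ip_scaleC_left norm_scaleC real_sqrt_mult scaleC_scaleC norm_mult)

lemma hnorm_minus: "\<xi> \<in> carr X \<Longrightarrow> hnorm X (- \<xi>) = hnorm X \<xi>"
  by (simp add: hnorm_def ip_minus ip_minus_left)

lemma hnorm_commute: "\<xi> \<in> carr X \<Longrightarrow> \<eta> \<in> carr X \<Longrightarrow> hnorm X (\<xi> - \<eta>) = hnorm X (\<eta> - \<xi>)"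
  using hnorm_minus[of "\<xi> - \<eta>"] by simp

lemma hnorm_triangle:
  assumes "\<xi> \<in> carr X" "\<eta> \<in> carr X"
  shows "hnorm X (\<xi> + \<eta>) \<le> hnorm X \<xi> + hnorm X \<eta>"
proof (rule power2_le_imp_le)
  have "(hnorm X (\<xi> + \<eta>))\<^sup>2 = norm (ip X \<xi> \<xi> + ip X \<xi> \<eta> + (ip X \<eta> \<xi> + ip X \<eta> \<eta>))"
    using assms by (simp add: hnorm_square ip_add ip_add_left algebra_simps)
  also have "\<dots> \<le> hnorm X \<xi> * hnorm X \<xi> + hnorm X \<xi> * hnorm X \<eta>
      + (hnorm X \<eta> * hnorm X \<xi> + hnorm X \<eta> * hnorm X \<eta>)"
    by (intro norm_triangle_le add_mono Cauchy_Schwarz assms)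
  finally show "(hnorm X (\<xi> + \<eta>))\<^sup>2 \<le> (hnorm X \<xi> + hnorm X \<eta>)\<^sup>2"
    by (simp add: power2_eq_square algebra_simps)
qed simp

lemma hnorm_triangle_diff:
  "\<xi> \<in> carr X \<Longrightarrow> \<eta> \<in> carr X \<Longrightarrow> \<zeta> \<in> carr X \<Longrightarrow> hnorm X (\<xi> - \<zeta>) \<le> hnorm X (\<xi> - \<eta>) + hnorm X (\<eta> - \<zeta>)"
  using hnorm_triangle[of "\<xi> - \<eta>" "\<eta> - \<zeta>"] by simp

lemma hnorm_ract:
  assumes "\<xi> \<in> carr X"
  shows "hnorm X (ract X \<xi> a) \<le> hnorm X \<xi> * norm a"
proof (rule power2_le_imp_le)
  have "(hnorm X (ract X \<xi> a))\<^sup>2 = norm (star a * (ip X \<xi> \<xi> * a))"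
    using assms by (simp add: hnorm_square ip_ract ip_ract_left mult.assoc)
  also have "\<dots> \<le> norm (star a) * (norm (ip X \<xi> \<xi>) * norm a)"
    by (intro order_trans[OF norm_mult_ineq] mult_left_mono norm_mult_ineq norm_ge_zero)
  finally show "(hnorm X (ract X \<xi> a))\<^sup>2 \<le> (hnorm X \<xi> * norm a)\<^sup>2"
    by (simp add: power_mult_distrib hnorm_square) (simp add: power2_eq_square mult_ac)
qed simp

section \<open>Adjointable operators and their norms\<close>

lemma adjointableE:
  assumes "T \<in> adjointables X"
  obtains S where "\<And>\<xi>. \<xi> \<in> carr X \<Longrightarrow> S \<xi> \<in> carr X"
    "\<And>\<xi> \<eta>. \<xi> \<in> carr X \<Longrightarrow> \<eta> \<in> carr X \<Longrightarrow> ip X (T \<xi>) \<eta> = ip X \<xi> (S \<eta>)"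
    "\<And>\<xi> \<eta>. \<xi> \<in> carr X \<Longrightarrow> \<eta> \<in> carr X \<Longrightarrow> ip X \<eta> (T \<xi>) = ip X (S \<eta>) \<xi>"
proof -
  from assms obtain S where T: "\<And>\<xi>. \<xi> \<in> carr X \<Longrightarrow> T \<xi> \<in> carr X" and S: "\<And>\<xi>. \<xi> \<in> carr X \<Longrightarrow> S \<xi> \<in> carr X"
    "\<And>\<xi> \<eta>. \<xi> \<in> carr X \<Longrightarrow> \<eta> \<in> carr X \<Longrightarrow> ip X (T \<xi>) \<eta> = ip X \<xi> (S \<eta>)"
    unfolding adjointables_def by blast
  have "ip X \<eta> (T \<xi>) = ip X (S \<eta>) \<xi>" if "\<xi> \<in> carr X" "\<eta> \<in> carr X" for \<xi> \<eta>
    using ip_star[of "T \<xi>" \<eta>] ip_star[of \<xi> "S \<eta>"] S(2)[OF that] that T S(1) by simp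
  with S that show thesis by blast
qed

lemma adjointable_carr [simp]: "T \<in> adjointables X \<Longrightarrow> \<xi> \<in> carr X \<Longrightarrow> T \<xi> \<in> carr X"
  by (simp add: adjointables_def)

text \<open>Adjointables are merely functions with an adjoint. Here and in the next lemmas,
  linearity is read off from the adjoint, since inner products separate vectors.\<close>

lemma adjointable_add:
  assumes "T \<in> adjointables X" "\<xi> \<in> carr X" "\<eta> \<in> carr X"
  shows "T (\<xi> + \<eta>) = T \<xi> + T \<eta>"
proof (rule adjointableE[OF assms(1)], rule eq_if_ip_eq)
  fix S \<zeta> assume "\<And>\<xi>. \<xi> \<in> carr X \<Longrightarrow> S \<xi> \<in> carr X" "\<zeta> \<in> carr X"
    and "\<And>\<xi> \<eta>. \<xi> \<in> carr X \<Longrightarrow> \<eta> \<in> carr X \<Longrightarrow> ip X \<eta> (T \<xi>) = ip X (S \<eta>) \<xi>"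
  then show "ip X \<zeta> (T (\<xi> + \<eta>)) = ip X \<zeta> (T \<xi> + T \<eta>)"
    using assms by (simp add: ip_add)
qed (use assms in simp_all)

lemma adjointable_scaleC:
  assumes "T \<in> adjointables X" "\<xi> \<in> carr X"
  shows "T (c *\<^sub>C \<xi>) = c *\<^sub>C T \<xi>"
proof (rule adjointableE[OF assms(1)], rule eq_if_ip_eq)
  fix S \<zeta> assume "\<And>\<xi>. \<xi> \<in> carr X \<Longrightarrow> S \<xi> \<in> carr X" "\<zeta> \<in> carr X"
    and "\<And>\<xi> \<eta>. \<xi> \<in> carr X \<Longrightarrow> \<eta> \<in> carr X \<Longrightarrow> ip X \<eta> (T \<xi>) = ip X (S \<eta>) \<xi>"
  then show "ip X \<zeta> (T (c *\<^sub>C \<xi>)) = ip X \<zeta> (c *\<^sub>C T \<xi>)"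
    using assms by (simp add: ip_scaleC)
qed (use assms in simp_all)

lemma adjointable_ract:
  assumes "T \<in> adjointables X" "\<xi> \<in> carr X"
  shows "T (ract X \<xi> a) = ract X (T \<xi>) a"
proof (rule adjointableE[OF assms(1)], rule eq_if_ip_eq)
  fix S \<zeta> assume "\<And>\<xi>. \<xi> \<in> carr X \<Longrightarrow> S \<xi> \<in> carr X" "\<zeta> \<in> carr X"
    and "\<And>\<xi> \<eta>. \<xi> \<in> carr X \<Longrightarrow> \<eta> \<in> carr X \<Longrightarrow> ip X \<eta> (T \<xi>) = ip X (S \<eta>) \<xi>"
  then show "ip X \<zeta> (T (ract X \<xi> a)) = ip X \<zeta> (ract X (T \<xi>) a)"
    using assms by (simp add: ip_ract)
qed (use assms in simp_all)

lemma adjointable_diff: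
  assumes "T \<in> adjointables X" "\<xi> \<in> carr X" "\<eta> \<in> carr X"
  shows "T (\<xi> - \<eta>) = T \<xi> - T \<eta>"
  using adjointable_add[OF assms(1), of "\<xi> - \<eta>" \<eta>] assms by (simp add: eq_diff_eq)

lemma csubspace_adjointables: "csubspace (adjointables X)"
  unfolding csubspace_iff
proof (intro conjI ballI allI)
  show "0 \<in> adjointables X"
    unfolding adjointables_def mem_Collect_eq by (intro conjI exI[of _ "\<lambda>_. 0"]) simp_all
next
  fix T R assume T: "T \<in> adjointables X" and R: "R \<in> adjointables X"
  obtain T' where T': "\<And>\<xi>. \<xi> \<in> carr X \<Longrightarrow> T' \<xi> \<in> carr X"
    "\<And>\<xi> \<eta>. \<xi> \<in> carr X \<Longrightarrow> \<eta> \<in> carr X \<Longrightarrow> ip X (T \<xi>) \<eta> = ip X \<xi> (T' \<eta>)"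
    using adjointableE[OF T] by metis
  obtain R' where R': "\<And>\<xi>. \<xi> \<in> carr X \<Longrightarrow> R' \<xi> \<in> carr X"
    "\<And>\<xi> \<eta>. \<xi> \<in> carr X \<Longrightarrow> \<eta> \<in> carr X \<Longrightarrow> ip X (R \<xi>) \<eta> = ip X \<xi> (R' \<eta>)"
    using adjointableE[OF R] by metis
  show "T + R \<in> adjointables X"
    using T R T' R' unfolding adjointables_def mem_Collect_eq
    by (intro conjI exI[of _ "\<lambda>\<xi>. T' \<xi> + R' \<xi>"]) (simp_all add: ip_add ip_add_left)
next
  fix c T assume T: "T \<in> adjointables X"
  obtain T' where T': "\<And>\<xi>. \<xi> \<in> carr X \<Longrightarrow> T' \<xi> \<in> carr X"
    "\<And>\<xi> \<eta>. \<xi> \<in> carr X \<Longrightarrow> \<eta> \<in> carr X \<Longrightarrow> ip X (T \<xi>) \<eta> = ip X \<xi> (T' \<eta>)"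
    using adjointableE[OF T] by metis
  show "c *\<^sub>C T \<in> adjointables X"
    using T T' unfolding adjointables_def mem_Collect_eq
    by (intro conjI exI[of _ "\<lambda>\<xi>. cnj c *\<^sub>C T' \<xi>"])
      (simp_all add: scaleC_fun_def ip_scaleC ip_scaleC_left)
qed

lemma rank_one_adjointable:
  assumes "\<xi> \<in> carr X" "\<eta> \<in> carr X"
  shows "rank_one X \<xi> \<eta> \<in> adjointables X"
  using assms unfolding adjointables_def mem_Collect_eq
  by (intro conjI exI[of _ "rank_one X \<eta> \<xi>"])
    (simp_all add: rank_one_def ip_ract ip_ract_left ip_star)

text \<open>The uniform boundedness principle for the functionals \<open>\<langle>T \<xi>, \<cdot>\<rangle>\<close>, \<open>\<parallel>\<xi>\<parallel> \<le> 1\<close>, by a gliding hump.\<close>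

lemma adjointable_bounded:
  assumes T: "T \<in> adjointables X"
  obtains C where "\<And>\<xi>. \<xi> \<in> carr X \<Longrightarrow> hnorm X \<xi> \<le> 1 \<Longrightarrow> hnorm X (T \<xi>) \<le> C"
proof (rule ccontr)
  assume neg: "\<not> thesis"
  obtain S where S: "\<And>\<xi>. \<xi> \<in> carr X \<Longrightarrow> S \<xi> \<in> carr X"
    "\<And>\<xi> \<eta>. \<xi> \<in> carr X \<Longrightarrow> \<eta> \<in> carr X \<Longrightarrow> ip X (T \<xi>) \<eta> = ip X \<xi> (S \<eta>)"
    using adjointableE[OF T] by metis
  have "\<forall>n. \<exists>\<xi>. \<xi> \<in> carr X \<and> hnorm X \<xi> \<le> 1 \<and> 4 ^ n < hnorm X (T \<xi>)"
  proof
    fix n :: nat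
    have "\<not> (\<forall>\<xi>. \<xi> \<in> carr X \<longrightarrow> hnorm X \<xi> \<le> 1 \<longrightarrow> hnorm X (T \<xi>) \<le> 4 ^ n)"
      using neg that[of "4 ^ n"] by blast
    then show "\<exists>\<xi>. \<xi> \<in> carr X \<and> hnorm X \<xi> \<le> 1 \<and> 4 ^ n < hnorm X (T \<xi>)" by force
  qed
  then obtain x where x: "\<And>n. x n \<in> carr X" "\<And>n. hnorm X (x n) \<le> 1" "\<And>n. 4 ^ n < hnorm X (T (x n))"
    by metis
  define y where "y n = T (x n)" for n
  define N where "N n = hnorm X (y n)" for n
  have y: "y n \<in> carr X" for n using x T by (simp add: y_def)
  have N: "4 ^ n < N n" for n using x by (simp add: N_def y_def)
  have N0: "N n > 0" for n using N[of n] by (smt (verit) zero_less_power)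
  \<comment> \<open>Step n has length \<open>(1/3)^n\<close>, while its inner product with
    \<open>y n\<close> has norm above \<open>(4/3)^n\<close>.\<close>
  define \<eta> where "\<eta> n = complex_of_real ((1/3) ^ n / N n) *\<^sub>C y n" for n
  have \<eta>: "\<eta> n \<in> carr X" for n using y by (simp add: \<eta>_def)
  have n\<eta>: "hnorm X (\<eta> n) = (1/3) ^ n" for n
    using N0[of n] by (simp add: \<eta>_def hnorm_scaleC y N_def norm_power norm_divide)
  have ip\<eta>: "norm (ip X (y n) (\<eta> n)) = (1/3) ^ n * N n" for n
    using N0[of n]
    by (simp add: \<eta>_def ip_scaleC y norm_scaleC N_def norm_power norm_divide power2_eq_square
        flip: hnorm_square)
  \<comment> \<open>The inner products of \<open>y n\<close> with the two candidates differ by twice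
    the hump, so the better sign keeps at least one hump.\<close>
  define z where "z = rec_nat 0 (\<lambda>n w. if norm (ip X (y n) (w - \<eta> n)) \<le> norm (ip X (y n) (w + \<eta> n))
    then w + \<eta> n else w - \<eta> n)"
  have z0: "z 0 = 0" and zS: "z (Suc n) = (if norm (ip X (y n) (z n - \<eta> n)) \<le> norm (ip X (y n) (z n + \<eta> n))
    then z n + \<eta> n else z n - \<eta> n)" for n
    by (simp_all add: z_def)
  have z: "z n \<in> carr X" for n
    by (induction n) (simp_all add: z0 zS \<eta>)
  have hump: "(1/3) ^ n * N n \<le> norm (ip X (y n) (z (Suc n)))" for n
  proof -
    have "2 *\<^sub>R ip X (y n) (\<eta> n) = ip X (y n) (z n + \<eta> n) - ip X (y n) (z n - \<eta> n)"
      by (simp add: ip_add ip_diff y z \<eta> scaleR_2)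
    then have "2 * ((1/3) ^ n * N n) = norm (ip X (y n) (z n + \<eta> n) - ip X (y n) (z n - \<eta> n))"
      by (metis ip\<eta> norm_scaleR abs_numeral)
    also have "\<dots> \<le> norm (ip X (y n) (z n + \<eta> n)) + norm (ip X (y n) (z n - \<eta> n))"
      by (rule norm_triangle_ineq4)
    finally show ?thesis by (auto simp: zS)
  qed
  have step: "hnorm X (z (Suc n) - z n) = (1/3) ^ n" for n
    using n\<eta> hnorm_minus[OF \<eta>] by (simp add: zS)
  have tail: "hnorm X (z (n + m) - z n) \<le> 3/2 * ((1/3) ^ n - (1/3) ^ (n + m))" for n m
  proof (induction m)
    case (Suc m)
    have "hnorm X (z (n + Suc m) - z n) \<le> (1/3) ^ (n + m) + hnorm X (z (n + m) - z n)"
      using hnorm_triangle_diff[of "z (n + Suc m)" "z (n + m)" "z n"] z step[of "n + m"] by simp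
    also have "\<dots> \<le> (1/3) ^ (n + m) + 3/2 * ((1/3) ^ n - (1/3) ^ (n + m))"
      using Suc by (rule add_left_mono)
    also have "\<dots> = 3/2 * ((1/3) ^ n - (1/3) ^ (n + Suc m))" by (simp add: right_diff_distrib)
    finally show ?case .
  qed (simp add: z)
  have tail': "hnorm X (z m - z n) \<le> 3/2 * (1/3) ^ n" if "n \<le> m" for n m
  proof -
    have "hnorm X (z m - z n) \<le> 3/2 * ((1/3) ^ n - (1/3) ^ m)" using tail[of n "m - n"] that by simp
    also have "\<dots> \<le> 3/2 * (1/3) ^ n" by simp
    finally show ?thesis .
  qed
  have "\<exists>\<xi>\<in>carr X. (\<lambda>k. hnorm X (z k - \<xi>)) \<longlonglongrightarrow> 0"
  proof (rule complete[OF z])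
    fix \<epsilon> :: real assume "\<epsilon> > 0"
    then obtain M where M: "(1/3) ^ M < \<epsilon> / 3"
      using real_arch_pow_inv[of "\<epsilon> / 3" "1/3"] by auto
    have "hnorm X (z j - z k) < \<epsilon>" if "j \<ge> M" "k \<ge> M" for j k
    proof -
      have "hnorm X (z j - z k) \<le> hnorm X (z j - z M) + hnorm X (z k - z M)"
        using hnorm_triangle_diff[of "z j" "z M" "z k"] hnorm_commute[of "z M" "z k"] z by simp
      also have "\<dots> < \<epsilon>" using tail'[OF that(1)] tail'[OF that(2)] M by simp
      finally show ?thesis .
    qed
    then show "\<exists>N. \<forall>j\<ge>N. \<forall>k\<ge>N. hnorm X (z j - z k) < \<epsilon>" by blast
  qed
  then obtain \<zeta> where \<zeta>: "\<zeta> \<in> carr X" "(\<lambda>k. hnorm X (z k - \<zeta>)) \<longlonglongrightarrow> 0" by blast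
  \<comment> \<open>The steps after n sum to at most \<open>(1/3)^n / 2\<close>, so half of hump n
    survives in the limit.\<close>
  have close: "hnorm X (\<zeta> - z (Suc n)) \<le> (1/3) ^ n / 2" for n
  proof (rule LIMSEQ_le_const)
    show "(\<lambda>k. hnorm X (z k - \<zeta>) + (1/3) ^ n / 2) \<longlonglongrightarrow> (1/3) ^ n / 2"
      using tendsto_add[OF \<zeta>(2) tendsto_const[of "(1/3) ^ n / 2"]] by simp
    have "hnorm X (\<zeta> - z (Suc n)) \<le> hnorm X (z k - \<zeta>) + (1/3) ^ n / 2" if "k \<ge> Suc n" for k
      using hnorm_triangle_diff[of \<zeta> "z k" "z (Suc n)"] tail'[OF that] hnorm_commute[of \<zeta> "z k"] \<zeta>(1) z
      by simp
    then show "\<exists>K. \<forall>k\<ge>K. hnorm X (\<zeta> - z (Suc n)) \<le> hnorm X (z k - \<zeta>) + (1/3) ^ n / 2" by blast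
  qed
  have bound: "(4/3) ^ n / 2 \<le> hnorm X (S \<zeta>)" for n
  proof -
    have "norm (ip X (y n) (z (Suc n))) \<le> norm (ip X (y n) \<zeta>) + norm (ip X (y n) (\<zeta> - z (Suc n)))"
      using norm_triangle_ineq4[of "ip X (y n) \<zeta>" "ip X (y n) (\<zeta> - z (Suc n))"]
      by (simp add: ip_diff y \<zeta> z)
    also have "norm (ip X (y n) (\<zeta> - z (Suc n))) \<le> N n * ((1/3) ^ n / 2)"
      unfolding N_def
      by (intro order_trans[OF Cauchy_Schwarz] mult_left_mono close) (simp_all add: y \<zeta> z)
    finally have "(1/3) ^ n * N n / 2 \<le> norm (ip X (y n) \<zeta>)" using hump[of n] by (simp add: algebra_simps)
    \<comment> \<open>Passing to the adjoint bounds all humps by the single number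
      \<open>hnorm X (S \<zeta>)\<close>.\<close>
    also have "ip X (y n) \<zeta> = ip X (x n) (S \<zeta>)" by (simp add: y_def S x \<zeta>)
    also have "norm \<dots> \<le> 1 * hnorm X (S \<zeta>)"
      by (intro order_trans[OF Cauchy_Schwarz] mult_right_mono) (simp_all add: x S \<zeta>)
    finally have "(1/3) ^ n * N n / 2 \<le> hnorm X (S \<zeta>)" by simp
    moreover have "(1/3) ^ n * 4 ^ n \<le> (1/3) ^ n * N n" using N[of n] by (intro mult_left_mono) auto
    moreover have "(1/3) ^ n * 4 ^ n = (4/3 :: real) ^ n" by (simp flip: power_mult_distrib)
    ultimately show ?thesis by simp
  qed
  obtain n where "2 * hnorm X (S \<zeta>) < (4/3) ^ n" using real_arch_pow[of "4/3"] by auto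
  then show False using bound[of n] by simp
qed

text \<open>\<open>op_norm\<close> is a real supremum, so estimates with it first require the set to
  be bounded above.\<close>

lemma op_norm_bdd:
  assumes "T \<in> adjointables X"
  shows "bdd_above ((\<lambda>\<xi>. hnorm X (T \<xi>)) ` {\<xi> \<in> carr X. hnorm X \<xi> \<le> 1})"
  using adjointable_bounded[OF assms] by (metis (mono_tags, lifting) bdd_aboveI2 mem_Collect_eq)

lemma op_norm_bound:
  assumes T: "T \<in> adjointables X" and \<xi>: "\<xi> \<in> carr X"
  shows "hnorm X (T \<xi>) \<le> op_norm X T * hnorm X \<xi>"
proof (cases "hnorm X \<xi> = 0")
  case True
  then have "\<xi> = 0" using \<xi> ip_definite by (simp add: hnorm_def)
  then show ?thesis using adjointable_scaleC[OF T \<xi>, of 0] by simp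
next
  case False
  then have pos: "hnorm X \<xi> > 0" using hnorm_nonneg[of \<xi>] by linarith
  let ?c = "complex_of_real (1 / hnorm X \<xi>)"
  have "hnorm X (T (?c *\<^sub>C \<xi>)) \<le> op_norm X T"
    unfolding op_norm_def using pos
    by (intro cSUP_upper op_norm_bdd T) (simp add: \<xi> hnorm_scaleC norm_divide)
  then show ?thesis
    using pos by (simp add: adjointable_scaleC[OF T \<xi>] hnorm_scaleC T \<xi> norm_divide field_simps)
qed

lemma op_norm_nonneg: "T \<in> adjointables X \<Longrightarrow> 0 \<le> op_norm X T"
  unfolding op_norm_def
  by (rule cSUP_upper2[where x=0]) (auto intro: op_norm_bdd)

lemma op_norm_le:
  assumes "\<And>\<xi>. \<xi> \<in> carr X \<Longrightarrow> hnorm X (T \<xi>) \<le> c * hnorm X \<xi>" "0 \<le> c"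
  shows "op_norm X T \<le> c"
  unfolding op_norm_def
proof (rule cSUP_least)
  show "{\<xi> \<in> carr X. hnorm X \<xi> \<le> 1} \<noteq> {}" using carr_zero by (auto intro: exI[of _ 0])
  show "hnorm X (T \<xi>) \<le> c" if "\<xi> \<in> {\<xi> \<in> carr X. hnorm X \<xi> \<le> 1}" for \<xi>
    using assms(1)[of \<xi>] mult_left_mono[of "hnorm X \<xi>" 1 c] that assms(2) by simp
qed

end

section \<open>Correspondences\<close>

lemma cspan_induct [consumes 1, case_names zero step]:
  assumes "x \<in> cspan S" "P 0" "\<And>c x y. x \<in> S \<Longrightarrow> y \<in> cspan S \<Longrightarrow> P y \<Longrightarrow> P (c *\<^sub>C x + y)"
  shows "P x"
proof -
  have "x \<in> cspan S \<and> P x"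
    using assms(1)
  proof (induction rule: module.span_induct_alt[OF module_scaleC, consumes 1])
    case 1
    then show ?case using assms(2) module.span_zero[OF module_scaleC] by blast
  next
    case (2 c x y)
    then show ?case
      using assms(3) module.span_add[OF module_scaleC] module.span_scale[OF module_scaleC]
        module.span_base[OF module_scaleC] by blast
  qed
  then show ?thesis ..
qed

lemmas cspan_intros = module.span_zero[OF module_scaleC] module.span_add[OF module_scaleC]
  module.span_scale[OF module_scaleC] module.span_base[OF module_scaleC]
  module.span_diff[OF module_scaleC]

lemma cspan_subset: "S \<subseteq> M \<Longrightarrow> csubspace M \<Longrightarrow> cspan S \<subseteq> M"
  by (rule module.span_minimal[OF module_scaleC])

abbreviation rank_ones :: "('a, 'x) corr \<Rightarrow> 'x set \<Rightarrow> ('x \<Rightarrow> 'x) set"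
  where "rank_ones X S \<equiv> {rank_one X \<xi> \<eta> | \<xi> \<eta>. \<xi> \<in> S \<and> \<eta> \<in> S}"

context hilbert_module
begin

lemma module_ideal_carr: "module_ideal X I \<subseteq> carr X"
  by (auto simp: module_ideal_def)

lemma rank_ones_adjointable: "S \<subseteq> carr X \<Longrightarrow> cspan (rank_ones X S) \<subseteq> adjointables X"
  by (rule cspan_subset[OF _ csubspace_adjointables]) (auto intro: rank_one_adjointable)

text \<open>Pointwise form of lying in the norm closure of the finite-rank operators. It mentions
  neither adjoints nor suprema, so it applies directly to composed functions.\<close>

definition approximable :: "'x set \<Rightarrow> ('x \<Rightarrow> 'x) \<Rightarrow> bool"
  where "approximable S T \<longleftrightarrow> (\<forall>\<epsilon>>0. \<exists>R\<in>cspan (rank_ones X S). \<forall>\<xi>\<in>carr X. hnorm X (T \<xi> - R \<xi>) \<le> \<epsilon> * hnorm X \<xi>)"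

lemma approximableD:
  "approximable S T \<Longrightarrow> \<epsilon> > 0 \<Longrightarrow>
    \<exists>R\<in>cspan (rank_ones X S). \<forall>\<xi>\<in>carr X. hnorm X (T \<xi> - R \<xi>) \<le> \<epsilon> * hnorm X \<xi>"
  by (simp add: approximable_def)

lemma compacts_on_iff:
  assumes "S \<subseteq> carr X"
  shows "T \<in> compacts_on X S \<longleftrightarrow> T \<in> adjointables X \<and> approximable S T"
proof (cases "T \<in> adjointables X")
  case True
  have diff: "T - R \<in> adjointables X" if "R \<in> cspan (rank_ones X S)" for R
    using csubspaceD(5)[OF csubspace_adjointables True] rank_ones_adjointable[OF assms] that by blast
  have 1: "hnorm X (T \<xi> - R \<xi>) \<le> \<epsilon> * hnorm X \<xi>"
    if "R \<in> cspan (rank_ones X S)" "op_norm X (T - R) < \<epsilon>" "\<xi> \<in> carr X" for R \<epsilon> \<xi>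
    using op_norm_bound[OF diff[OF that(1)] that(3)] mult_right_mono[OF less_imp_le[OF that(2)] hnorm_nonneg[of \<xi>]]
    by simp
  have 2: "op_norm X (T - R) \<le> \<epsilon>" if "\<forall>\<xi>\<in>carr X. hnorm X (T \<xi> - R \<xi>) \<le> \<epsilon> * hnorm X \<xi>" "\<epsilon> > 0" for R \<epsilon>
    by (rule op_norm_le) (use that in auto)
  show ?thesis
    unfolding compacts_on_def approximable_def
  proof (intro iffI conjI allI impI True CollectI; elim CollectE conjE)
    fix \<epsilon> :: real assume "\<epsilon> > 0" "\<forall>\<epsilon>>0. \<exists>R\<in>cspan (rank_ones X S). op_norm X (T - R) < \<epsilon>"
    then show "\<exists>R\<in>cspan (rank_ones X S). \<forall>\<xi>\<in>carr X. hnorm X (T \<xi> - R \<xi>) \<le> \<epsilon> * hnorm X \<xi>"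
      using 1 by meson
  next
    fix \<epsilon> :: real
    assume e: "\<epsilon> > 0" and "\<forall>\<epsilon>>0. \<exists>R\<in>cspan (rank_ones X S). \<forall>\<xi>\<in>carr X. hnorm X (T \<xi> - R \<xi>) \<le> \<epsilon> * hnorm X \<xi>"
    then obtain R where R: "R \<in> cspan (rank_ones X S)" "\<forall>\<xi>\<in>carr X. hnorm X (T \<xi> - R \<xi>) \<le> \<epsilon> / 2 * hnorm X \<xi>"
      by (meson half_gt_zero)
    have "op_norm X (T - R) \<le> \<epsilon> / 2" by (rule 2) (use R e in auto)
    then show "\<exists>R\<in>cspan (rank_ones X S). op_norm X (T - R) < \<epsilon>" using R(1) e by force
  qed
qed (simp add: compacts_on_def)

lemma approximable_zero: "approximable S 0"
  unfolding approximable_def by (auto intro!: bexI[of _ 0] cspan_intros(1))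

lemma approximable_rank_one: "\<xi> \<in> S \<Longrightarrow> \<eta> \<in> S \<Longrightarrow> S \<subseteq> carr X \<Longrightarrow> approximable S (rank_one X \<xi> \<eta>)"
  unfolding approximable_def by (auto intro!: bexI[of _ "rank_one X \<xi> \<eta>"] cspan_intros(4))

text \<open>The shape \<open>c T + T'\<close> is that of one step of span induction. Agreement on
  \<open>carr X\<close> suffices, since values outside it are irrelevant.\<close>

lemma approximable_lincomb:
  assumes S: "S \<subseteq> carr X" and T: "approximable S T" "approximable S T'"
    and carr: "\<And>\<xi>. \<xi> \<in> carr X \<Longrightarrow> T \<xi> \<in> carr X" "\<And>\<xi>. \<xi> \<in> carr X \<Longrightarrow> T' \<xi> \<in> carr X"
    and Q: "\<And>\<xi>. \<xi> \<in> carr X \<Longrightarrow> Q \<xi> = c *\<^sub>C T \<xi> + T' \<xi>"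
  shows "approximable S Q"
  unfolding approximable_def
proof (intro allI impI)
  fix \<epsilon> :: real assume e: "\<epsilon> > 0"
  define \<delta> where "\<delta> = \<epsilon> / (cmod c + 1)"
  have c: "cmod c + 1 > 0" by (simp add: add_nonneg_pos)
  have d: "\<delta> > 0" using e c by (simp add: \<delta>_def)
  obtain R where R: "R \<in> cspan (rank_ones X S)" "\<forall>\<xi>\<in>carr X. hnorm X (T \<xi> - R \<xi>) \<le> \<delta> * hnorm X \<xi>"
    using approximableD[OF T(1) d] by blast
  obtain R' where R': "R' \<in> cspan (rank_ones X S)" "\<forall>\<xi>\<in>carr X. hnorm X (T' \<xi> - R' \<xi>) \<le> \<delta> * hnorm X \<xi>"
    using approximableD[OF T(2) d] by blast
  have RC: "R \<xi> \<in> carr X" "R' \<xi> \<in> carr X" if "\<xi> \<in> carr X" for \<xi>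
    using rank_ones_adjointable[OF S] R R' that adjointable_carr by blast+
  show "\<exists>R\<in>cspan (rank_ones X S). \<forall>\<xi>\<in>carr X. hnorm X (Q \<xi> - R \<xi>) \<le> \<epsilon> * hnorm X \<xi>"
  proof (intro bexI ballI)
    show "c *\<^sub>C R + R' \<in> cspan (rank_ones X S)" by (intro cspan_intros R R')
    fix \<xi> assume \<xi>: "\<xi> \<in> carr X"
    have "Q \<xi> - (c *\<^sub>C R + R') \<xi> = c *\<^sub>C (T \<xi> - R \<xi>) + (T' \<xi> - R' \<xi>)"
      by (simp add: Q \<xi> scaleC_fun_def scaleC_diff_right)
    also have "hnorm X \<dots> \<le> cmod c * (\<delta> * hnorm X \<xi>) + \<delta> * hnorm X \<xi>"
      using \<xi> RC carr R(2) R'(2)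
      by (intro order_trans[OF hnorm_triangle] add_mono) (auto simp: hnorm_scaleC mult_left_mono)
    also have "\<dots> = (\<delta> * (cmod c + 1)) * hnorm X \<xi>" by (simp add: algebra_simps)
    also have "\<delta> * (cmod c + 1) = \<epsilon>" using c by (simp add: \<delta>_def)
    finally show "hnorm X (Q \<xi> - (c *\<^sub>C R + R') \<xi>) \<le> \<epsilon> * hnorm X \<xi>" .
  qed
qed

lemma approximable_closed:
  assumes S: "S \<subseteq> carr X" and T: "\<And>\<xi>. \<xi> \<in> carr X \<Longrightarrow> T \<xi> \<in> carr X"
    and ex: "\<And>\<epsilon>. \<epsilon> > 0 \<Longrightarrow> \<exists>Q. approximable S Q \<and> (\<forall>\<xi>\<in>carr X. Q \<xi> \<in> carr X) \<and>
      (\<forall>\<xi>\<in>carr X. hnorm X (T \<xi> - Q \<xi>) \<le> \<epsilon> * hnorm X \<xi>)"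
  shows "approximable S T"
  unfolding approximable_def
proof (intro allI impI)
  fix \<epsilon> :: real assume "\<epsilon> > 0"
  then have e: "\<epsilon> / 2 > 0" by simp
  obtain Q where Q: "approximable S Q" "\<forall>\<xi>\<in>carr X. Q \<xi> \<in> carr X"
    "\<forall>\<xi>\<in>carr X. hnorm X (T \<xi> - Q \<xi>) \<le> \<epsilon> / 2 * hnorm X \<xi>" using ex[OF e] by blast
  obtain R where R: "R \<in> cspan (rank_ones X S)" "\<forall>\<xi>\<in>carr X. hnorm X (Q \<xi> - R \<xi>) \<le> \<epsilon> / 2 * hnorm X \<xi>"
    using approximableD[OF Q(1) e] by blast
  have "hnorm X (T \<xi> - R \<xi>) \<le> \<epsilon> * hnorm X \<xi>" if \<xi>: "\<xi> \<in> carr X" for \<xi>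
  proof -
    have "R \<xi> \<in> carr X" using rank_ones_adjointable[OF S] R \<xi> adjointable_carr by blast
    then have "hnorm X (T \<xi> - R \<xi>) \<le> hnorm X (T \<xi> - Q \<xi>) + hnorm X (Q \<xi> - R \<xi>)"
      using T Q \<xi> by (intro hnorm_triangle_diff) auto
    also have "\<dots> \<le> \<epsilon> / 2 * hnorm X \<xi> + \<epsilon> / 2 * hnorm X \<xi>"
      using Q(3) R(2) \<xi> by (intro add_mono) auto
    finally show ?thesis by simp
  qed
  then show "\<exists>R\<in>cspan (rank_ones X S). \<forall>\<xi>\<in>carr X. hnorm X (T \<xi> - R \<xi>) \<le> \<epsilon> * hnorm X \<xi>"
    using R(1) by blast
qed

lemma hnorm_rank_one:
  assumes "\<xi> \<in> carr X" "\<eta> \<in> carr X" "\<zeta> \<in> carr X"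
  shows "hnorm X (rank_one X \<xi> \<eta> \<zeta>) \<le> hnorm X \<xi> * hnorm X \<eta> * hnorm X \<zeta>"
  unfolding rank_one_def
  using order_trans[OF hnorm_ract mult_left_mono[OF Cauchy_Schwarz]] assms by (simp add: mult.assoc)

text \<open>Approximate \<open>c\<close> by \<open>c * e'\<close> with \<open>e'\<close>
  self-adjoint in the ideal; \<open>e'\<close> then moves across the inner product onto
  \<open>\<eta>\<close>, so that both vectors lie in XI.\<close>

lemma approximable_rank_one_ideal:
  assumes I: "cstar_ideal I" and c: "c \<in> I" and \<xi>: "\<xi> \<in> carr X" and \<eta>: "\<eta> \<in> carr X"
  shows "approximable (module_ideal X I) (rank_one X (ract X \<xi> c) \<eta>)"
proof (rule approximable_closed[OF module_ideal_carr])
  show "rank_one X (ract X \<xi> c) \<eta> \<zeta> \<in> carr X" if "\<zeta> \<in> carr X" for \<zeta>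
    using \<xi> by (simp add: rank_one_def)
  fix \<epsilon> :: real assume e: "\<epsilon> > 0"
  \<comment> \<open>The added 1 keeps the denominator positive when one of the vectors is
    zero.\<close>
  define \<delta> where "\<delta> = \<epsilon> / (hnorm X \<xi> * hnorm X \<eta> + 1)"
  have c1: "hnorm X \<xi> * hnorm X \<eta> + 1 > 0" by (simp add: add_nonneg_pos)
  have d: "\<delta> > 0" using e c1 by (simp add: \<delta>_def)
  obtain e' where e': "e' \<in> I" "star e' = e'" "norm (c - c * e') < \<delta>"
    using ideal_approx_unit[OF I cstar_idealD(6)[OF I c] d] by metis
  let ?Q = "rank_one X (ract X \<xi> c) (ract X \<eta> e')"
  have "hnorm X (rank_one X (ract X \<xi> c) \<eta> \<zeta> - ?Q \<zeta>) \<le> \<epsilon> * hnorm X \<zeta>" if \<zeta>: "\<zeta> \<in> carr X" for \<zeta>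
  proof -
    have "ract X \<xi> (c - c * e') = ract X \<xi> c - ract X \<xi> (c * e')"
      using ract_add_right[OF \<xi>, of "c - c * e'" "c * e'"] by (simp add: eq_diff_eq)
    moreover have "?Q \<zeta> = rank_one X (ract X \<xi> (c * e')) \<eta> \<zeta>"
      using \<xi> \<eta> \<zeta> by (simp add: rank_one_def ip_ract_left e' ract_mult[symmetric] mult.assoc)
    moreover have "ract X (\<alpha> - \<beta>) a = ract X \<alpha> a - ract X \<beta> a" if "\<alpha> \<in> carr X" "\<beta> \<in> carr X" for \<alpha> \<beta> a
      using ract_add_left[of "\<alpha> - \<beta>" \<beta> a] that by (simp add: eq_diff_eq)
    ultimately have "rank_one X (ract X \<xi> c) \<eta> \<zeta> - ?Q \<zeta> = rank_one X (ract X \<xi> (c - c * e')) \<eta> \<zeta>"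
      using \<xi> by (simp add: rank_one_def)
    also have "hnorm X \<dots> \<le> hnorm X (ract X \<xi> (c - c * e')) * hnorm X \<eta> * hnorm X \<zeta>"
      by (rule hnorm_rank_one) (simp_all add: \<xi> \<eta> \<zeta>)
    also have "\<dots> \<le> (hnorm X \<xi> * \<delta>) * hnorm X \<eta> * hnorm X \<zeta>"
      using e'(3) by (intro mult_right_mono order_trans[OF hnorm_ract[OF \<xi>]] mult_left_mono) simp_all
    also have "\<dots> \<le> (\<delta> * (hnorm X \<xi> * hnorm X \<eta> + 1)) * hnorm X \<zeta>"
      using d by (intro mult_right_mono) (simp_all add: algebra_simps)
    also have "\<delta> * (hnorm X \<xi> * hnorm X \<eta> + 1) = \<epsilon>" using c1 by (simp add: \<delta>_def)
    finally show ?thesis .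
  qed
  moreover have "approximable (module_ideal X I) ?Q"
    by (rule approximable_rank_one[OF _ _ module_ideal_carr]) (use \<xi> \<eta> c e' in \<open>auto simp: module_ideal_def\<close>)
  ultimately show "\<exists>Q. approximable (module_ideal X I) Q \<and> (\<forall>\<xi>\<in>carr X. Q \<xi> \<in> carr X) \<and>
      (\<forall>\<zeta>\<in>carr X. hnorm X (rank_one X (ract X \<xi> c) \<eta> \<zeta> - Q \<zeta>) \<le> \<epsilon> * hnorm X \<zeta>)"
    using \<xi> by (intro exI[of _ ?Q] conjI ballI) (simp_all add: rank_one_def)
qed

text \<open>A rank-one operator with first vector \<open>ract X \<alpha> a\<close> contributes
  \<open>ip X \<xi> \<alpha> * a * ip X \<beta> \<eta>\<close>, which lies in \<open>I\<close> with
  \<open>a\<close>; sums and limits stay there.\<close>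

lemma ip_compacts_on_ideal:
  assumes I: "cstar_ideal I" and T: "T \<in> compacts_on X (module_ideal X I)"
    and \<xi>: "\<xi> \<in> carr X" and \<eta>: "\<eta> \<in> carr X"
  shows "ip X \<xi> (T \<eta>) \<in> I"
proof (rule closed_approachable)
  have T: "T \<in> adjointables X" "approximable (module_ideal X I) T"
    using T compacts_on_iff[OF module_ideal_carr] by blast+
  show "closed I" by (rule cstar_idealD[OF I])
  fix \<epsilon> :: real assume e: "\<epsilon> > 0"
  define \<delta> where "\<delta> = \<epsilon> / (hnorm X \<xi> * hnorm X \<eta> + 1)"
  have c1: "hnorm X \<xi> * hnorm X \<eta> + 1 > 0" by (simp add: add_nonneg_pos)
  have d: "\<delta> > 0" using e c1 by (simp add: \<delta>_def)
  obtain R where R: "R \<in> cspan (rank_ones X (module_ideal X I))"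
      "\<forall>\<xi>\<in>carr X. hnorm X (T \<xi> - R \<xi>) \<le> \<delta> * hnorm X \<xi>"
    using approximableD[OF T(2) d] by blast
  have Rc: "R \<eta> \<in> carr X"
    using rank_ones_adjointable[OF module_ideal_carr] R \<eta> adjointable_carr by blast
  have "R \<eta> \<in> carr X \<and> ip X \<xi> (R \<eta>) \<in> I"
    using R(1)
  proof (induction rule: cspan_induct)
    case (step c R R')
    obtain \<alpha> \<beta> a where R: "R = rank_one X (ract X \<alpha> a) \<beta>" "\<alpha> \<in> carr X" "\<beta> \<in> carr X" "a \<in> I"
      using step(1) by (auto simp: module_ideal_def)
    have "ip X \<xi> (R \<eta>) = ip X \<xi> \<alpha> * a * ip X \<beta> \<eta>"
      using R \<xi> \<eta> by (simp add: rank_one_def ip_ract)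
    then have "ip X \<xi> (R \<eta>) \<in> I" using R(4) by (simp add: cstar_idealD[OF I])
    moreover have "R \<eta> \<in> carr X" using R by (simp add: rank_one_def)
    ultimately show ?case
      using step(3) \<xi> by (simp add: scaleC_fun_def ip_add ip_scaleC cstar_idealD[OF I])
  qed (simp add: \<xi> cstar_idealD[OF I])
  then have "ip X \<xi> (R \<eta>) \<in> I" ..
  moreover have "norm (ip X \<xi> (T \<eta>) - ip X \<xi> (R \<eta>)) < \<epsilon>"
  proof -
    have "norm (ip X \<xi> (T \<eta>) - ip X \<xi> (R \<eta>)) = norm (ip X \<xi> (T \<eta> - R \<eta>))"
      using \<xi> \<eta> T Rc by (simp add: ip_diff)
    also have "\<dots> \<le> hnorm X \<xi> * (\<delta> * hnorm X \<eta>)"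
      using \<xi> \<eta> T Rc R(2) by (intro order_trans[OF Cauchy_Schwarz] mult_left_mono) simp_all
    also have "\<dots> < \<delta> * (hnorm X \<xi> * hnorm X \<eta> + 1)" using d by (simp add: algebra_simps)
    also have "\<dots> = \<epsilon>" using c1 by (simp add: \<delta>_def)
    finally show ?thesis .
  qed
  ultimately show "\<exists>y\<in>I. norm (ip X \<xi> (T \<eta>) - y) < \<epsilon>" by blast
qed

end

context cstar_correspondence
begin

lemma lact_carr [simp]: "\<xi> \<in> carr X \<Longrightarrow> lact X a \<xi> \<in> carr X"
  by (rule adjointable_carr[OF lact_adjointable])

lemmas lact_add_right = adjointable_add[OF lact_adjointable]
  and lact_scaleC_right = adjointable_scaleC[OF lact_adjointable]
  and lact_diff_right = adjointable_diff[OF lact_adjointable]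
  and lact_ract = adjointable_ract[OF lact_adjointable]

lemma lact_star': "\<xi> \<in> carr X \<Longrightarrow> \<eta> \<in> carr X \<Longrightarrow> ip X \<xi> (lact X a \<eta>) = ip X (lact X (star a) \<xi>) \<eta>"
  by (simp add: lact_star star_star)

lemma lact_diff: "\<xi> \<in> carr X \<Longrightarrow> lact X (a - b) \<xi> = lact X a \<xi> - lact X b \<xi>"
  using lact_add[of \<xi> "a - b" b] by (simp add: eq_diff_eq)

lemma lact_zero [simp]: "\<xi> \<in> carr X \<Longrightarrow> lact X 0 \<xi> = 0"
  using lact_diff[of \<xi> 0 0] by simp

text \<open>Lets the unitisation act on the module, so that square roots taken there become
  operators.\<close>

definition unit_lact :: "'a unitisation \<Rightarrow> 'x \<Rightarrow> 'x"
  where "unit_lact z \<xi> = lact X (alg_part z) \<xi> + scalar_part z *\<^sub>C \<xi>"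

lemma unit_lact_carr [simp]: "\<xi> \<in> carr X \<Longrightarrow> unit_lact z \<xi> \<in> carr X"
  by (simp add: unit_lact_def)

lemma unit_lact_mult: "\<xi> \<in> carr X \<Longrightarrow> unit_lact (z * w) \<xi> = unit_lact z (unit_lact w \<xi>)"
  by (simp add: unit_lact_def times_unitisation_def lact_add lact_mult lact_scaleC lact_add_right
      lact_scaleC_right scaleC_add_right scaleC_scaleC algebra_simps)

lemma unit_lact_star:
  "\<xi> \<in> carr X \<Longrightarrow> \<eta> \<in> carr X \<Longrightarrow> ip X (unit_lact z \<xi>) \<eta> = ip X \<xi> (unit_lact (star z) \<eta>)"
  by (simp add: unit_lact_def star_unitisation_def ip_add ip_add_left ip_scaleC ip_scaleC_left lact_star)

text \<open>\<open>\<parallel>a\<parallel>\<^sup>2 - star a * a\<close> is a square in the unitisation, which acts on \<open>X\<close>.\<close>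

lemma hnorm_lact:
  assumes \<xi>: "\<xi> \<in> carr X"
  shows "hnorm X (lact X a \<xi>) \<le> norm a * hnorm X \<xi>"
proof -
  let ?s = "(norm a)\<^sup>2"
  have "sa_square (of_real ?s - of_alg (star a * a))"
    using sa_square_diff_norm[OF sa_square_star[OF sa_square_of_alg[of a]], of ?s] by (simp add: cstar_identity)
  then obtain l where l: "star l = l" "of_real ?s - of_alg (star a * a) = l * l"
    by (auto simp: sa_square_def)
  have "ip X (unit_lact l \<xi>) (unit_lact l \<xi>) = ip X \<xi> (unit_lact (l * l) \<xi>)"
    using \<xi> by (simp add: unit_lact_star l unit_lact_mult)
  also have "unit_lact (l * l) \<xi> = complex_of_real ?s *\<^sub>C \<xi> - lact X (star a * a) \<xi>"
  proof -
    have "l * l = Unitisation (- (star a * a)) (complex_of_real ?s)"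
      unfolding l(2)[symmetric] by (simp add: of_real_def unitisation_defs of_alg_def)
    then show ?thesis using \<xi> lact_diff[of \<xi> 0 "star a * a"] by (simp add: unit_lact_def)
  qed
  also have "ip X \<xi> \<dots> = ?s *\<^sub>R ip X \<xi> \<xi> - ip X (lact X a \<xi>) (lact X a \<xi>)"
    using \<xi> by (simp add: ip_diff ip_scaleC lact_mult lact_star star_star scaleR_scaleC)
  finally have "sa_square (?s *\<^sub>R of_alg (ip X \<xi> \<xi>) - of_alg (ip X (lact X a \<xi>) (lact X a \<xi>)))"
    using sa_square_ip[of "unit_lact l \<xi>"] \<xi> by (simp add: of_alg_diff of_alg_simps)
  then have "norm (of_alg (ip X (lact X a \<xi>) (lact X a \<xi>))) \<le> norm (?s *\<^sub>R of_alg (ip X \<xi> \<xi>))"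
    by (rule norm_mono_sa_square[rotated]) (simp add: sa_square_ip \<xi>)
  then have "(hnorm X (lact X a \<xi>))\<^sup>2 \<le> (norm a * hnorm X \<xi>)\<^sup>2"
    by (simp add: power_mult_distrib hnorm_square)
  then show ?thesis by (rule power2_le_imp_le) simp
qed

section \<open>Preimage ideals and compactness of the left action\<close>

lemma inv_ideal_iff:
  "a \<in> inv_ideal X I \<longleftrightarrow> (\<forall>\<xi>\<in>carr X. \<forall>\<eta>\<in>carr X. ip X \<xi> (lact X a \<eta>) \<in> I)"
  by (auto simp: inv_ideal_def sandwich_def)

lemma cstar_ideal_inv_ideal:
  assumes I: "cstar_ideal I"
  shows "cstar_ideal (inv_ideal X I)"
  unfolding cstar_ideal_def
proof (intro conjI ballI allI)
  show "csubspace (inv_ideal X I)"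
    unfolding csubspace_iff
    by (auto simp: inv_ideal_iff lact_add lact_scaleC ip_add ip_scaleC cstar_idealD[OF I])
  show "closed (inv_ideal X I)"
    unfolding closed_sequential_limits
  proof (intro allI impI; elim conjE)
    fix s a assume s: "\<forall>n. s n \<in> inv_ideal X I" and lim: "s \<longlonglongrightarrow> a"
    show "a \<in> inv_ideal X I"
      unfolding inv_ideal_iff
    proof (intro ballI)
      fix \<xi> \<eta> assume \<xi>: "\<xi> \<in> carr X" and \<eta>: "\<eta> \<in> carr X"
      have "(\<lambda>n. ip X \<xi> (lact X (s n) \<eta>) - ip X \<xi> (lact X a \<eta>)) \<longlonglongrightarrow> 0"
      proof (rule Lim_null_comparison)
        have "norm (ip X \<xi> (lact X (s n) \<eta>) - ip X \<xi> (lact X a \<eta>)) \<le> hnorm X \<xi> * (norm (s n - a) * hnorm X \<eta>)" for n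
        proof -
          have "ip X \<xi> (lact X (s n) \<eta>) - ip X \<xi> (lact X a \<eta>) = ip X \<xi> (lact X (s n - a) \<eta>)"
            using \<xi> \<eta> by (simp add: ip_diff lact_diff)
          also have "norm \<dots> \<le> hnorm X \<xi> * (norm (s n - a) * hnorm X \<eta>)"
            using \<xi> \<eta> by (intro order_trans[OF Cauchy_Schwarz] mult_left_mono hnorm_lact) simp_all
          finally show ?thesis .
        qed
        then show "\<forall>\<^sub>F n in sequentially. norm (ip X \<xi> (lact X (s n) \<eta>) - ip X \<xi> (lact X a \<eta>))
            \<le> hnorm X \<xi> * (norm (s n - a) * hnorm X \<eta>)" by simp
        show "(\<lambda>n. hnorm X \<xi> * (norm (s n - a) * hnorm X \<eta>)) \<longlonglongrightarrow> 0"
          by (intro tendsto_mult_right_zero tendsto_mult_left_zero tendsto_norm_zero LIM_zero lim)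
      qed
      then have "(\<lambda>n. ip X \<xi> (lact X (s n) \<eta>)) \<longlonglongrightarrow> ip X \<xi> (lact X a \<eta>)" by (rule LIM_zero_cancel)
      moreover have "ip X \<xi> (lact X (s n) \<eta>) \<in> I" for n using s \<xi> \<eta> by (auto simp: inv_ideal_iff)
      ultimately show "ip X \<xi> (lact X a \<eta>) \<in> I"
        using cstar_idealD(8)[OF I] by (metis closed_sequentially)
    qed
  qed
  show "a * x \<in> inv_ideal X I" "x * a \<in> inv_ideal X I" if "x \<in> inv_ideal X I" for a x
    using that by (simp_all add: inv_ideal_iff lact_mult lact_star'[of _ _ a])
qed

text \<open>Left multiplication by \<open>a\<close> replaces \<open>\<alpha>\<close> by
  \<open>a \<alpha>\<close> in a rank-one operator, right multiplication replaces
  \<open>\<beta>\<close> by \<open>star a \<beta>\<close>; both stay in XI. Being a closed ideal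
  makes \<open>ideal_star_mult_self\<close> applicable to this set.\<close>

lemma cstar_ideal_lact_approximable:
  assumes I: "cstar_ideal I"
  shows "cstar_ideal {b. approximable (module_ideal X I) (lact X b)}" (is "cstar_ideal ?N")
  unfolding cstar_ideal_def
proof (intro conjI ballI allI)
  note S = module_ideal_carr[of I]
  have lin: "c *\<^sub>C x + y \<in> ?N" if "x \<in> ?N" "y \<in> ?N" for c x y
    using that by (auto intro!: approximable_lincomb[OF S, of "lact X x" "lact X y"] simp: lact_add lact_scaleC)
  have zero: "0 \<in> ?N"
    using approximable_lincomb[OF S approximable_zero approximable_zero, of "lact X 0" 0] by simp
  show "csubspace ?N"
    unfolding csubspace_iff
    using lin[of _ _ 1] lin[OF _ zero] zero by (auto simp: scaleC_one)
  show "closed ?N"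
    unfolding closed_sequential_limits
  proof (intro allI impI; elim conjE)
    fix s b assume s: "\<forall>n. s n \<in> ?N" and lim: "s \<longlonglongrightarrow> b"
    have "approximable (module_ideal X I) (lact X b)"
    proof (rule approximable_closed[OF S])
      fix \<epsilon> :: real assume "\<epsilon> > 0"
      then obtain n where n: "norm (b - s n) < \<epsilon>"
        using lim by (metis LIMSEQ_iff norm_minus_commute order_refl)
      have "hnorm X (lact X b \<xi> - lact X (s n) \<xi>) \<le> \<epsilon> * hnorm X \<xi>" if "\<xi> \<in> carr X" for \<xi>
      proof -
        have "hnorm X (lact X b \<xi> - lact X (s n) \<xi>) \<le> norm (b - s n) * hnorm X \<xi>"
          using hnorm_lact[OF that, of "b - s n"] that by (simp add: lact_diff)
        also have "\<dots> \<le> \<epsilon> * hnorm X \<xi>" using n by (intro mult_right_mono) simp_all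
        finally show ?thesis .
      qed
      then show "\<exists>Q. approximable (module_ideal X I) Q \<and> (\<forall>\<xi>\<in>carr X. Q \<xi> \<in> carr X) \<and>
          (\<forall>\<xi>\<in>carr X. hnorm X (lact X b \<xi> - Q \<xi>) \<le> \<epsilon> * hnorm X \<xi>)"
        using s by (intro exI[of _ "lact X (s n)"]) auto
    qed simp
    then show "b \<in> ?N" by simp
  qed
next
  note S = module_ideal_carr[of I]
  fix a x :: 'a assume "x \<in> {b. approximable (module_ideal X I) (lact X b)}"
  then have x: "approximable (module_ideal X I) (lact X x)" by simp
  have left: "lact X a \<xi> \<in> module_ideal X I" if "\<xi> \<in> module_ideal X I" for a \<xi>
    using that unfolding module_ideal_def by (auto simp: lact_ract) (metis lact_carr)
  have N: "0 < norm a + 1" by (simp add: add_nonneg_pos)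
  have "approximable (module_ideal X I) (lact X (a * x))"
    unfolding approximable_def
  proof (intro allI impI)
    fix \<epsilon> :: real assume e: "\<epsilon> > 0"
    then have d: "\<epsilon> / (norm a + 1) > 0" using N by simp
    obtain R where R: "R \<in> cspan (rank_ones X (module_ideal X I))"
      "\<forall>\<xi>\<in>carr X. hnorm X (lact X x \<xi> - R \<xi>) \<le> \<epsilon> / (norm a + 1) * hnorm X \<xi>"
      using approximableD[OF x d] by blast
    have "(\<forall>\<xi>\<in>carr X. R \<xi> \<in> carr X) \<and>
        (\<exists>R'\<in>cspan (rank_ones X (module_ideal X I)). \<forall>\<xi>\<in>carr X. R' \<xi> = lact X a (R \<xi>))"
      using R(1)
    proof (induction rule: cspan_induct)
      case zero
      then show ?case
        using lact_scaleC_right[of 0 a 0] by (auto intro!: bexI[of _ 0] cspan_intros(1))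
    next
      case (step c Q R)
      obtain \<alpha> \<beta> where Q: "Q = rank_one X \<alpha> \<beta>" "\<alpha> \<in> module_ideal X I" "\<beta> \<in> module_ideal X I"
        using step(1) by blast
      then have c: "\<alpha> \<in> carr X" "\<beta> \<in> carr X" using S by blast+
      obtain R' where R': "R' \<in> cspan (rank_ones X (module_ideal X I))" "\<forall>\<xi>\<in>carr X. R' \<xi> = lact X a (R \<xi>)"
        using step(3) by blast
      have "c *\<^sub>C rank_one X (lact X a \<alpha>) \<beta> + R' \<in> cspan (rank_ones X (module_ideal X I))"
        using Q left[OF Q(2)] by (intro cspan_intros R') blast
      moreover have "\<forall>\<xi>\<in>carr X. (c *\<^sub>C rank_one X (lact X a \<alpha>) \<beta> + R') \<xi> = lact X a ((c *\<^sub>C Q + R) \<xi>)"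
        using R'(2) step(3) c
        by (simp add: scaleC_fun_def Q(1) rank_one_def lact_add_right lact_scaleC_right lact_ract)
      moreover have "\<forall>\<xi>\<in>carr X. (c *\<^sub>C Q + R) \<xi> \<in> carr X"
        using step(3) c by (simp add: scaleC_fun_def Q(1) rank_one_def)
      ultimately show ?case by blast
    qed
    then obtain R' where Rc: "\<forall>\<xi>\<in>carr X. R \<xi> \<in> carr X" and R': "R' \<in> cspan (rank_ones X (module_ideal X I))"
      "\<forall>\<xi>\<in>carr X. R' \<xi> = lact X a (R \<xi>)" by blast
    have "hnorm X (lact X (a * x) \<xi> - R' \<xi>) \<le> \<epsilon> * hnorm X \<xi>" if \<xi>: "\<xi> \<in> carr X" for \<xi>
    proof -
      have "lact X (a * x) \<xi> - R' \<xi> = lact X a (lact X x \<xi> - R \<xi>)"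
        using \<xi> R' Rc by (simp add: lact_mult lact_diff_right)
      also have "hnorm X \<dots> \<le> norm a * hnorm X (lact X x \<xi> - R \<xi>)"
        using \<xi> Rc by (intro hnorm_lact) simp
      also have "\<dots> \<le> (norm a + 1) * (\<epsilon> / (norm a + 1) * hnorm X \<xi>)"
        using \<xi> R(2) by (intro mult_mono) auto
      finally show ?thesis using N by simp
    qed
    then show "\<exists>R\<in>cspan (rank_ones X (module_ideal X I)). \<forall>\<xi>\<in>carr X. hnorm X (lact X (a * x) \<xi> - R \<xi>) \<le> \<epsilon> * hnorm X \<xi>"
      using R'(1) by blast
  qed
  then show "a * x \<in> {b. approximable (module_ideal X I) (lact X b)}" by simp
  have "approximable (module_ideal X I) (lact X (x * a))"
    unfolding approximable_def
  proof (intro allI impI)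
    fix \<epsilon> :: real assume e: "\<epsilon> > 0"
    then have d: "\<epsilon> / (norm a + 1) > 0" using N by simp
    obtain R where R: "R \<in> cspan (rank_ones X (module_ideal X I))"
      "\<forall>\<xi>\<in>carr X. hnorm X (lact X x \<xi> - R \<xi>) \<le> \<epsilon> / (norm a + 1) * hnorm X \<xi>"
      using approximableD[OF x d] by blast
    have "\<exists>R'\<in>cspan (rank_ones X (module_ideal X I)). \<forall>\<xi>\<in>carr X. R' \<xi> = R (lact X a \<xi>)"
      using R(1)
    proof (induction rule: cspan_induct)
      case zero
      then show ?case by (auto intro!: bexI[of _ 0] cspan_intros(1))
    next
      case (step c Q R)
      obtain \<alpha> \<beta> where Q: "Q = rank_one X \<alpha> \<beta>" "\<alpha> \<in> module_ideal X I" "\<beta> \<in> module_ideal X I"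
        using step(1) by blast
      then have c: "\<alpha> \<in> carr X" "\<beta> \<in> carr X" using S by blast+
      obtain R' where R': "R' \<in> cspan (rank_ones X (module_ideal X I))" "\<forall>\<xi>\<in>carr X. R' \<xi> = R (lact X a \<xi>)"
        using step(3) by blast
      have "c *\<^sub>C rank_one X \<alpha> (lact X (star a) \<beta>) + R' \<in> cspan (rank_ones X (module_ideal X I))"
        using Q left[OF Q(3)] by (intro cspan_intros R') blast
      moreover have "\<forall>\<xi>\<in>carr X. (c *\<^sub>C rank_one X \<alpha> (lact X (star a) \<beta>) + R') \<xi> = (c *\<^sub>C Q + R) (lact X a \<xi>)"
        using R'(2) c by (simp add: scaleC_fun_def Q(1) rank_one_def lact_star star_star)
      ultimately show ?case by blast
    qed
    then obtain R' where R': "R' \<in> cspan (rank_ones X (module_ideal X I))"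
      "\<forall>\<xi>\<in>carr X. R' \<xi> = R (lact X a \<xi>)" by blast
    have "hnorm X (lact X (x * a) \<xi> - R' \<xi>) \<le> \<epsilon> * hnorm X \<xi>" if \<xi>: "\<xi> \<in> carr X" for \<xi>
    proof -
      have "lact X (x * a) \<xi> - R' \<xi> = lact X x (lact X a \<xi>) - R (lact X a \<xi>)"
        using \<xi> R' by (simp add: lact_mult)
      also have "hnorm X \<dots> \<le> \<epsilon> / (norm a + 1) * hnorm X (lact X a \<xi>)"
        using \<xi> R(2) by simp
      also have "\<dots> \<le> \<epsilon> / (norm a + 1) * ((norm a + 1) * hnorm X \<xi>)"
        using d hnorm_lact[OF \<xi>, of a]
        by (intro mult_left_mono order_trans[OF hnorm_lact[OF \<xi>]] mult_right_mono) auto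
      finally show ?thesis using N by simp
    qed
    then show "\<exists>R\<in>cspan (rank_ones X (module_ideal X I)). \<forall>\<xi>\<in>carr X. hnorm X (lact X (x * a) \<xi> - R \<xi>) \<le> \<epsilon> * hnorm X \<xi>"
      using R'(1) by blast
  qed
  then show "x * a \<in> {b. approximable (module_ideal X I) (lact X b)}" by simp
qed

text \<open>The composite of \<open>rank_one X \<gamma> \<delta>\<close>, \<open>star a\<close> and
  \<open>rank_one X \<alpha> \<beta>\<close> is rank one with vectors
  \<open>ract X \<gamma> d\<close> and \<open>\<beta>\<close>, where the middle inner product
  \<open>d\<close> lies in \<open>I\<close>. Span induction in each factor does the rest.\<close>

lemma approximable_rank_lact_rank:
  assumes I: "cstar_ideal I" and a: "a \<in> inv_ideal X I"
    and R: "R \<in> cspan (rank_ones X (carr X))" and R': "R' \<in> cspan (rank_ones X (carr X))"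
  shows "approximable (module_ideal X I) (\<lambda>\<xi>. R (lact X (star a) (R' \<xi>)))"
proof -
  note S = module_ideal_carr[of I]
  have adj: "Q \<in> adjointables X" if "Q \<in> cspan (rank_ones X (carr X))" for Q
    using rank_ones_adjointable[of "carr X"] that by blast
  have base: "approximable (module_ideal X I) (\<lambda>\<xi>. R (lact X (star a) (rank_one X \<alpha> \<beta> \<xi>)))"
    if \<alpha>: "\<alpha> \<in> carr X" and \<beta>: "\<beta> \<in> carr X" for \<alpha> \<beta>
    using R
  proof (induction rule: cspan_induct)
    case zero
    then show ?case using approximable_zero by (simp add: zero_fun_def)
  next
    case (step c Q R)
    obtain \<gamma> \<delta> where Q: "Q = rank_one X \<gamma> \<delta>" "\<gamma> \<in> carr X" "\<delta> \<in> carr X" using step(1) by blast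
    have R: "R \<in> adjointables X" using adj step(2) by blast
    define d where "d = ip X \<delta> (lact X (star a) \<alpha>)"
    have "d = star (ip X \<alpha> (lact X a \<delta>))"
      using \<alpha> Q by (simp add: d_def lact_star' star_star ip_star)
    then have d: "d \<in> I"
      using ideal_star[OF I] a \<alpha> Q by (simp add: inv_ideal_iff)
    show ?case
    proof (rule approximable_lincomb[OF S approximable_rank_one_ideal[OF I d Q(2) \<beta>] step(3)])
      show "rank_one X (ract X \<gamma> d) \<beta> \<xi> \<in> carr X" "R (lact X (star a) (rank_one X \<alpha> \<beta> \<xi>)) \<in> carr X"
        if "\<xi> \<in> carr X" for \<xi>
        using that Q R \<alpha> by (simp_all add: rank_one_def)
      show "(c *\<^sub>C Q + R) (lact X (star a) (rank_one X \<alpha> \<beta> \<xi>)) =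
          c *\<^sub>C rank_one X (ract X \<gamma> d) \<beta> \<xi> + R (lact X (star a) (rank_one X \<alpha> \<beta> \<xi>))"
        if "\<xi> \<in> carr X" for \<xi>
        using that Q \<alpha> \<beta> by (simp add: scaleC_fun_def rank_one_def lact_ract ip_ract ract_mult d_def)
    qed
  qed
  show ?thesis
    using R'
  proof (induction rule: cspan_induct)
    case zero
    have "R (lact X (star a) 0) = 0"
      using lact_scaleC_right[of 0 "star a" 0] adjointable_scaleC[OF adj[OF R], of 0 0] by simp
    then show ?case using approximable_zero by (simp add: zero_fun_def)
  next
    case (step c Q R')
    obtain \<gamma> \<delta> where Q: "Q = rank_one X \<gamma> \<delta>" "\<gamma> \<in> carr X" "\<delta> \<in> carr X" using step(1) by blast
    have aR: "R \<in> adjointables X" and aR': "R' \<in> adjointables X" using adj step(2) R by blast+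
    show ?case
    proof (rule approximable_lincomb[OF S base[OF Q(2,3)] step(3)])
      show "R (lact X (star a) (rank_one X \<gamma> \<delta> \<xi>)) \<in> carr X" "R (lact X (star a) (R' \<xi>)) \<in> carr X"
        if "\<xi> \<in> carr X" for \<xi>
        using that Q aR aR' by (simp_all add: rank_one_def)
      show "R (lact X (star a) ((c *\<^sub>C Q + R') \<xi>)) =
          c *\<^sub>C R (lact X (star a) (rank_one X \<gamma> \<delta> \<xi>)) + R (lact X (star a) (R' \<xi>))"
        if "\<xi> \<in> carr X" for \<xi>
        using that Q aR aR'
        by (simp add: scaleC_fun_def rank_one_def lact_add_right lact_scaleC_right
            adjointable_add[OF aR] adjointable_scaleC[OF aR])
    qed
  qed
qed

text \<open>The set of \<open>b\<close> acting by elements of \<open>\<K>(XI)\<close> is a closed ideal, so it suffices to see that it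
  contains \<open>a * star a * a\<close>. Writing \<open>a\<close> as a limit of finite-rank \<open>R\<close>, this is the limit of the
  operators \<open>R \<circ> star a \<circ> R\<close>.\<close>

lemma lact_compacts_on_ideal:
  assumes I: "cstar_ideal I" and a: "a \<in> inv_ideal X I" and K: "lact X a \<in> compacts X"
  shows "lact X a \<in> compacts_on X (module_ideal X I)"
proof -
  note S = module_ideal_carr[of I]
  let ?N = "{b. approximable (module_ideal X I) (lact X b)}"
  have N: "cstar_ideal ?N" by (rule cstar_ideal_lact_approximable[OF I])
  have apx: "approximable (carr X) (lact X a)"
    using K compacts_on_iff[of "carr X"] by (simp add: compacts_def)
  have "approximable (module_ideal X I) (lact X (a * star a * a))"
  proof (rule approximable_closed[OF S])
    fix \<epsilon> :: real assume e: "\<epsilon> > 0"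
    \<comment> \<open>Collects the errors from replacing the two outer factors \<open>a\<close> by
      \<open>R\<close>, which is within \<open>\<delta>\<close> of \<open>a\<close> and has norm at
      most \<open>norm a + 1\<close>.\<close>
    define C where "C = (norm a)\<^sup>2 + (norm a + 1) * norm a + 1"
    have C: "C > 0" by (simp add: C_def add_nonneg_pos)
    define \<delta> where "\<delta> = min 1 (\<epsilon> / C)"
    have d: "\<delta> > 0" "\<delta> \<le> 1" "\<delta> * C \<le> \<epsilon>"
      using e C by (simp_all add: \<delta>_def min_def field_simps)
    obtain R where R: "R \<in> cspan (rank_ones X (carr X))"
        "\<forall>\<xi>\<in>carr X. hnorm X (lact X a \<xi> - R \<xi>) \<le> \<delta> * hnorm X \<xi>"
      using approximableD[OF apx d(1)] by blast
    have adj: "R \<in> adjointables X" using rank_ones_adjointable[of "carr X"] R by blast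
    have nR: "hnorm X (R \<xi>) \<le> (norm a + 1) * hnorm X \<xi>" if \<xi>: "\<xi> \<in> carr X" for \<xi>
    proof -
      have "hnorm X (R \<xi>) \<le> hnorm X (lact X a \<xi>) + hnorm X (R \<xi> - lact X a \<xi>)"
        using hnorm_triangle[of "lact X a \<xi>" "R \<xi> - lact X a \<xi>"] \<xi> adj by simp
      also have "hnorm X (R \<xi> - lact X a \<xi>) \<le> \<delta> * hnorm X \<xi>"
        using hnorm_commute[of "R \<xi>" "lact X a \<xi>"] \<xi> adj R(2) by simp
      also have "\<dots> \<le> 1 * hnorm X \<xi>" using d(2) by (intro mult_right_mono) simp_all
      finally show ?thesis using hnorm_lact[OF \<xi>, of a] by (simp add: algebra_simps)
    qed
    let ?Q = "\<lambda>\<xi>. R (lact X (star a) (R \<xi>))"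
    have "hnorm X (lact X (a * star a * a) \<xi> - ?Q \<xi>) \<le> \<epsilon> * hnorm X \<xi>" if \<xi>: "\<xi> \<in> carr X" for \<xi>
    proof -
      let ?u = "lact X (star a) (lact X a \<xi>)" and ?v = "lact X a \<xi> - R \<xi>"
      have v: "?v \<in> carr X" using \<xi> adj by simp
      have "lact X (a * star a * a) \<xi> - ?Q \<xi> = (lact X a ?u - R ?u) + R (lact X (star a) ?v)"
        using \<xi> adj by (simp add: lact_mult lact_diff_right adjointable_diff[OF adj])
      also have "hnorm X \<dots> \<le> \<delta> * hnorm X ?u + (norm a + 1) * hnorm X (lact X (star a) ?v)"
        using \<xi> adj R(2) by (intro order_trans[OF hnorm_triangle] add_mono nR) simp_all
      also have "\<dots> \<le> \<delta> * (norm a * (norm a * hnorm X \<xi>)) + (norm a + 1) * (norm a * (\<delta> * hnorm X \<xi>))"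
      proof (intro add_mono mult_left_mono)
        show "hnorm X ?u \<le> norm a * (norm a * hnorm X \<xi>)"
          using hnorm_lact[of "lact X a \<xi>" "star a"] hnorm_lact[OF \<xi>, of a] \<xi>
          by (simp add: mult_left_mono order_trans)
        have "hnorm X (lact X (star a) ?v) \<le> norm a * hnorm X ?v"
          using hnorm_lact[OF v, of "star a"] by simp
        also have "\<dots> \<le> norm a * (\<delta> * hnorm X \<xi>)" using R(2) \<xi> by (intro mult_left_mono) simp_all
        finally show "hnorm X (lact X (star a) ?v) \<le> norm a * (\<delta> * hnorm X \<xi>)" .
      qed (use d in simp_all)
      also have "\<dots> \<le> (\<delta> * C) * hnorm X \<xi>"
        using d by (simp add: C_def algebra_simps power2_eq_square)
      also have "\<dots> \<le> \<epsilon> * hnorm X \<xi>" using d by (intro mult_right_mono) simp_all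
      finally show ?thesis .
    qed
    then show "\<exists>Q. approximable (module_ideal X I) Q \<and> (\<forall>\<xi>\<in>carr X. Q \<xi> \<in> carr X) \<and>
        (\<forall>\<xi>\<in>carr X. hnorm X (lact X (a * star a * a) \<xi> - Q \<xi>) \<le> \<epsilon> * hnorm X \<xi>)"
      using approximable_rank_lact_rank[OF I a R(1) R(1)] adj by (intro exI[of _ ?Q]) simp
  qed simp
  then have "a * star a * a \<in> ?N" by simp
  \<comment> \<open>The extra factor produces the square of \<open>star a * a\<close>, from which
    \<open>ideal_star_mult_self\<close> descends twice.\<close>
  then have "star a * (a * star a * a) \<in> ?N" by (rule cstar_idealD(6)[OF N])
  then have "star (star a * a) * (star a * a) \<in> ?N" by (simp only: star_mult star_star mult.assoc)
  then have "a \<in> ?N" using ideal_star_mult_self[OF N] by blast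
  then show ?thesis using compacts_on_iff[OF S] lact_adjointable by blast
qed

text \<open>On the range of \<open>g\<close> the operator \<open>h\<close> is bounded below by \<open>\<epsilon>'\<close>, but modulo \<open>I\<close> its norm is at
  most \<open>\<epsilon> < \<epsilon>'\<close>; compare the growth of the powers of \<open>h\<close>.\<close>

lemma cutoff_square_in_inv_ideal:
  assumes I: "cstar_ideal I" and R: "\<And>\<xi>. \<xi> \<in> carr X \<Longrightarrow> R \<xi> \<in> carr X"
      "\<And>\<xi> \<eta>. \<xi> \<in> carr X \<Longrightarrow> \<eta> \<in> carr X \<Longrightarrow> ip X \<xi> (R \<eta>) \<in> I"
      "\<And>\<xi>. \<xi> \<in> carr X \<Longrightarrow> hnorm X (lact X h \<xi> - R \<xi>) \<le> \<epsilon> * hnorm X \<xi>"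
    and \<epsilon>: "0 \<le> \<epsilon>" "\<epsilon> < \<epsilon>'" and g: "star g = g"
      "\<And>N. \<exists>b. star (((\<lambda>x. h * x) ^^ N) g) * (((\<lambda>x. h * x) ^^ N) g) = (\<epsilon>' ^ N)\<^sup>2 *\<^sub>R (g * g) + star b * b"
  shows "g * g \<in> inv_ideal X I"
proof -
  have diag: "ip X \<xi> (lact X (g * g) \<xi>) \<in> I" if \<xi>: "\<xi> \<in> carr X" for \<xi>
  proof -
    define \<zeta> where "\<zeta> = lact X g \<xi>"
    have \<zeta>: "\<zeta> \<in> carr X" using \<xi> by (simp add: \<zeta>_def)
    obtain k where k: "ip X \<zeta> \<zeta> = star k * k" using ip_positive[OF \<zeta>] by (auto simp: cstar_positive_def)
    \<comment> \<open>Modulo \<open>I\<close> the operators \<open>T\<close> and \<open>h\<close>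
      agree, and \<open>T\<close> has norm at most \<open>\<epsilon>\<close>. So \<open>t N\<close>
      decays like \<open>\<epsilon>^N\<close> and represents the same vector modulo \<open>I\<close>
      as \<open>y N\<close>, the image of \<open>\<xi>\<close> under \<open>h^N g\<close>.\<close>
    define T where "T \<xi> = lact X h \<xi> - R \<xi>" for \<xi>
    have T: "T \<xi> \<in> carr X" if "\<xi> \<in> carr X" for \<xi> using that R by (simp add: T_def)
    define t where "t N = (T ^^ N) \<zeta>" for N
    have t0: "t 0 = \<zeta>" and tS: "t (Suc N) = T (t N)" for N by (simp_all add: t_def)
    have t: "t N \<in> carr X" for N by (induction N) (simp_all add: t0 tS \<zeta> T)
    have nt: "hnorm X (t N) \<le> \<epsilon> ^ N * hnorm X \<zeta>" for N
    proof (induction N)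
      case (Suc N)
      have "hnorm X (t (Suc N)) \<le> \<epsilon> * hnorm X (t N)" using R(3)[OF t] by (simp add: tS T_def)
      also have "\<dots> \<le> \<epsilon> * (\<epsilon> ^ N * hnorm X \<zeta>)" using Suc \<epsilon>(1) by (rule mult_left_mono)
      finally show ?case by simp
    qed (simp add: t0)
    define y where "y N = lact X (((\<lambda>x. h * x) ^^ N) g) \<xi>" for N
    have y: "y N \<in> carr X" for N using \<xi> by (simp add: y_def)
    have diff: "ip X \<eta> (y N - t N) \<in> I" if "\<eta> \<in> carr X" for N \<eta>
      using that
    proof (induction N arbitrary: \<eta>)
      case 0
      then show ?case by (simp add: y_def t0 \<zeta>_def cstar_idealD[OF I])
    next
      case (Suc N)
      have "y (Suc N) - t (Suc N) = lact X h (y N - t N) + R (t N)"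
        using \<xi> y t by (simp add: y_def tS T_def lact_mult lact_diff_right)
      then have "ip X \<eta> (y (Suc N) - t (Suc N)) = ip X (lact X (star h) \<eta>) (y N - t N) + ip X \<eta> (R (t N))"
        using Suc.prems y t R by (simp add: ip_add lact_star')
      then show ?case using Suc.IH[of "lact X (star h) \<eta>"] Suc.prems R(2) t
        by (simp add: cstar_idealD[OF I])
    qed
    \<comment> \<open>Divide the growth identity by \<open>\<epsilon>'^(2N)\<close>:
      \<open>ip X \<zeta> \<zeta>\<close> plus a positive term is an element of \<open>I\<close> up
      to an error of norm at most \<open>\<rho> ^ N * (hnorm X \<zeta>)\<^sup>2\<close>.\<close>
    have "k \<in> I"
    proof (rule ideal_dominated[OF I])
      fix \<delta> :: real assume d: "\<delta> > 0"
      define \<rho> where "\<rho> = (\<epsilon> / \<epsilon>')\<^sup>2"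
      have "0 \<le> \<epsilon> / \<epsilon>'" "\<epsilon> / \<epsilon>' < 1" using \<epsilon> by simp_all
      then have \<rho>: "0 \<le> \<rho>" "\<rho> < 1" by (simp_all add: \<rho>_def power_less_one_iff abs_square_less_1)
      have "(\<lambda>N. \<rho> ^ N * (hnorm X \<zeta>)\<^sup>2) \<longlonglongrightarrow> 0"
        by (rule tendsto_mult_left_zero) (rule LIMSEQ_realpow_zero[OF \<rho>])
      then obtain N where N: "\<rho> ^ N * (hnorm X \<zeta>)\<^sup>2 < \<delta>"
        using d by (metis LIMSEQ_D abs_of_nonneg diff_zero order_refl real_norm_def
          zero_le_mult_iff zero_le_power zero_le_power2 \<rho>(1))
      obtain b where b: "star (((\<lambda>x. h * x) ^^ N) g) * (((\<lambda>x. h * x) ^^ N) g) = (\<epsilon>' ^ N)\<^sup>2 *\<^sub>R (g * g) + star b * b"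
        using g(2) by blast
      define r where "r = (1 / (\<epsilon>' ^ N)\<^sup>2)"
      have e': "\<epsilon>' > 0" "(\<epsilon>' ^ N)\<^sup>2 > 0" using \<epsilon> by simp_all
      have r: "r > 0" using e' by (simp add: r_def)
      have "ip X (y N) (y N) = ip X \<xi> (lact X (star (((\<lambda>x. h * x) ^^ N) g) * (((\<lambda>x. h * x) ^^ N) g)) \<xi>)"
        using \<xi> by (simp add: y_def lact_mult lact_star)
      also have "\<dots> = (\<epsilon>' ^ N)\<^sup>2 *\<^sub>R ip X \<zeta> \<zeta> + ip X (lact X b \<xi>) (lact X b \<xi>)"
        unfolding b using \<xi> g(1)
        by (simp add: lact_add lact_scaleC ip_add ip_scaleC \<zeta>_def lact_star lact_mult scaleR_scaleC)
      finally have yy: "r *\<^sub>R ip X (y N) (y N) = ip X \<zeta> \<zeta> + r *\<^sub>R ip X (lact X b \<xi>) (lact X b \<xi>)"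
        using e' by (simp add: r_def scaleR_add_right)
      obtain c where c: "ip X (lact X b \<xi>) (lact X b \<xi>) = star c * c"
        using ip_positive[of "lact X b \<xi>"] \<xi> by (auto simp: cstar_positive_def)
      define c' where "c' = sqrt r *\<^sub>R c"
      have c': "star c' * c' = r *\<^sub>R (star c * c)" using r by (simp add: c'_def star_scaleR)
      define i where "i = r *\<^sub>R (ip X (y N) (y N) - ip X (t N) (t N))"
      have "ip X (y N) (y N) - ip X (t N) (t N) = ip X (y N) (y N - t N) + star (ip X (t N) (y N - t N))"
        using y t by (simp add: ip_star ip_diff star_diff)
      then have iI: "i \<in> I" unfolding i_def
        using diff[OF y] diff[OF t] by (simp add: cstar_idealD[OF I] ideal_star[OF I])
      have "star k * k + star c' * c' - i = r *\<^sub>R ip X (t N) (t N)"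
        using yy by (simp add: c' c k[symmetric] i_def scaleR_diff_right)
      then have "norm (star k * k + star c' * c' - i) = r * (hnorm X (t N))\<^sup>2"
        using r by (simp add: hnorm_square)
      also have "\<dots> \<le> r * (\<epsilon> ^ N * hnorm X \<zeta>)\<^sup>2"
        using r nt by (intro mult_left_mono power_mono) simp_all
      also have "\<dots> = \<rho> ^ N * (hnorm X \<zeta>)\<^sup>2"
        by (simp add: r_def \<rho>_def power_mult_distrib power_divide flip: power_mult) (simp add: mult.commute)
      finally have "norm (star k * k + star c' * c' - i) < \<delta>" using N by simp
      then show "\<exists>b. \<exists>i\<in>I. norm (star k * k + star b * b - i) < \<delta>" using iI by blast
    qed
    then have "ip X \<zeta> \<zeta> \<in> I" by (simp add: k cstar_idealD[OF I])
    then show ?thesis using \<xi> g(1) by (simp add: \<zeta>_def lact_star lact_mult)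
  qed
  show ?thesis
    unfolding inv_ideal_iff
  proof (intro ballI)
    fix \<xi> \<eta> assume \<xi>: "\<xi> \<in> carr X" and \<eta>: "\<eta> \<in> carr X"
    \<comment> \<open>Polarisation: the diagonal values at \<open>\<xi> + \<eta>\<close> and
      \<open>\<xi> + i \<eta>\<close> yield the sum and the difference of the two mixed
      values.\<close>
    define B where "B \<xi> \<eta> = ip X \<xi> (lact X (g * g) \<eta>)" for \<xi> \<eta>
    have "B (\<xi> + \<eta>) (\<xi> + \<eta>) - B \<xi> \<xi> - B \<eta> \<eta> \<in> I"
      unfolding B_def using \<xi> \<eta> by (intro cstar_idealD(5)[OF I] diag) simp_all
    moreover have "B (\<xi> + \<eta>) (\<xi> + \<eta>) - B \<xi> \<xi> - B \<eta> \<eta> = B \<xi> \<eta> + B \<eta> \<xi>"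
      unfolding B_def using \<xi> \<eta> by (simp add: lact_add_right ip_add ip_add_left)
    ultimately have 1: "B \<xi> \<eta> + B \<eta> \<xi> \<in> I" by simp
    have "(- \<i>) *\<^sub>C (B (\<xi> + \<i> *\<^sub>C \<eta>) (\<xi> + \<i> *\<^sub>C \<eta>) - B \<xi> \<xi> - B \<eta> \<eta>) \<in> I"
      unfolding B_def using \<xi> \<eta> by (intro cstar_idealD(3,5)[OF I] diag) simp_all
    moreover have "(- \<i>) *\<^sub>C (B (\<xi> + \<i> *\<^sub>C \<eta>) (\<xi> + \<i> *\<^sub>C \<eta>) - B \<xi> \<xi> - B \<eta> \<eta>) = B \<xi> \<eta> - B \<eta> \<xi>"
      unfolding B_def using \<xi> \<eta>
      by (simp add: lact_add_right lact_scaleC_right ip_add ip_add_left ip_scaleC ip_scaleC_left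
          scaleC_scaleC scaleC_add_right scaleC_diff_right scaleC_one scaleC_minus1)
    ultimately have 2: "B \<xi> \<eta> - B \<eta> \<xi> \<in> I" by simp
    have "(B \<xi> \<eta> + B \<eta> \<xi>) + (B \<xi> \<eta> - B \<eta> \<xi>) \<in> I" by (rule cstar_idealD(2)[OF I 1 2])
    then have "(1/2) *\<^sub>R ((B \<xi> \<eta> + B \<eta> \<xi>) + (B \<xi> \<eta> - B \<eta> \<xi>)) \<in> I" by (rule cstar_idealD(9)[OF I])
    then show "ip X \<xi> (lact X (g * g) \<eta>) \<in> I" by (simp add: B_def flip: scaleR_2)
  qed
qed

lemma quotient_norm_eq_zero:
  assumes "T \<in> compacts_on X S" "S \<subseteq> carr X"
  shows "quotient_norm X (compacts_on X S) T = 0"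
proof -
  have adj: "T - R \<in> adjointables X" if "R \<in> compacts_on X S" for R
    using that assms csubspaceD(5)[OF csubspace_adjointables] by (simp add: compacts_on_iff)
  have ge: "0 \<le> op_norm X (T - R)" if "R \<in> compacts_on X S" for R
    by (rule op_norm_nonneg[OF adj[OF that]])
  have "op_norm X (T - T) \<le> 0" by (rule op_norm_le) simp_all
  then show ?thesis
    unfolding quotient_norm_def
    using assms(1) ge by (intro antisym cINF_lower2[OF _ assms(1)] cINF_greatest)
      (auto intro!: bdd_belowI2[where m=0])
qed

lemma quotient_norm_lessD:
  assumes "quotient_norm X (compacts_on X S) T < \<epsilon>" "S \<subseteq> carr X" "T \<in> adjointables X"
  obtains R where "R \<in> compacts_on X S" "\<And>\<xi>. \<xi> \<in> carr X \<Longrightarrow> hnorm X (T \<xi> - R \<xi>) \<le> \<epsilon> * hnorm X \<xi>"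
proof -
  have adj: "T - R \<in> adjointables X" if "R \<in> compacts_on X S" for R
    using that assms csubspaceD(5)[OF csubspace_adjointables] by (simp add: compacts_on_iff)
  have "0 \<in> compacts_on X S"
    using approximable_zero csubspaceD(1)[OF csubspace_adjointables] assms(2) by (simp add: compacts_on_iff)
  then obtain R where R: "R \<in> compacts_on X S" "op_norm X (T - R) < \<epsilon>"
    using assms(1) adj unfolding quotient_norm_def
    by (subst (asm) cINF_less_iff) (auto intro!: bdd_belowI2[where m=0] op_norm_nonneg)
  have "hnorm X (T \<xi> - R \<xi>) \<le> \<epsilon> * hnorm X \<xi>" if "\<xi> \<in> carr X" for \<xi>
    using op_norm_bound[OF adj[OF R(1)] that] mult_right_mono[OF less_imp_le[OF R(2)] hnorm_nonneg[of \<xi>]]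
    by simp
  with R(1) that show thesis by blast
qed

end

section \<open>Product systems\<close>

lemma cstar_ideal_INT:
  assumes "\<And>n. n \<in> N \<Longrightarrow> cstar_ideal (I n)"
  shows "cstar_ideal (\<Inter>n\<in>N. I n)"
  unfolding cstar_ideal_def csubspace_iff
  using assms by (auto simp: cstar_idealD intro!: closed_INT)

text \<open>Extends membership in a closed ideal from generating vectors to a whole fibre, by
  continuity of the inner product.\<close>

lemma (in hilbert_module) ip_hclosed_span:
  assumes I: "cstar_ideal I" and \<xi>: "\<xi> \<in> carr X" and S: "S \<subseteq> carr X"
    and ip: "\<And>\<eta>. \<eta> \<in> S \<Longrightarrow> ip X \<xi> \<eta> \<in> I" and \<eta>: "\<eta> \<in> hclosed_span X S"
  shows "ip X \<xi> \<eta> \<in> I"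
proof (rule closed_approachable)
  show "closed I" by (rule cstar_idealD[OF I])
  fix \<epsilon> :: real assume e: "\<epsilon> > 0"
  have \<eta>c: "\<eta> \<in> carr X" using \<eta> by (simp add: hclosed_span_def)
  have c1: "hnorm X \<xi> + 1 > 0" by (simp add: add_nonneg_pos)
  then have "\<epsilon> / (hnorm X \<xi> + 1) > 0" using e by simp
  then obtain \<zeta> where \<zeta>: "\<zeta> \<in> cspan S" "hnorm X (\<eta> - \<zeta>) < \<epsilon> / (hnorm X \<xi> + 1)"
    using \<eta> unfolding hclosed_span_def by blast
  have \<zeta>c: "\<zeta> \<in> carr X" using \<zeta>(1) cspan_subset[OF S carr_subspace] by blast
  have "\<zeta> \<in> carr X \<and> ip X \<xi> \<zeta> \<in> I"
    using \<zeta>(1)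
  proof (induction rule: cspan_induct)
    case (step c x y)
    then have "x \<in> carr X" "ip X \<xi> x \<in> I" using S ip by blast+
    then show ?case using step \<xi> by (simp add: ip_add ip_scaleC cstar_idealD[OF I])
  qed (simp add: \<xi> cstar_idealD[OF I])
  moreover have "norm (ip X \<xi> \<eta> - ip X \<xi> \<zeta>) < \<epsilon>"
  proof -
    have "norm (ip X \<xi> \<eta> - ip X \<xi> \<zeta>) \<le> hnorm X \<xi> * hnorm X (\<eta> - \<zeta>)"
      using Cauchy_Schwarz[of "\<eta> - \<zeta>" \<xi>] \<xi> \<eta>c \<zeta>c by (simp add: ip_diff)
    also have "\<dots> \<le> (hnorm X \<xi> + 1) * hnorm X (\<eta> - \<zeta>)"
      by (intro mult_right_mono) simp_all
    also have "\<dots> < (hnorm X \<xi> + 1) * (\<epsilon> / (hnorm X \<xi> + 1))"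
      using \<zeta>(2) c1 by (rule mult_strict_left_mono)
    finally show ?thesis using c1 by simp
  qed
  ultimately show "\<exists>y\<in>I. norm (ip X \<xi> \<eta> - y) < \<epsilon>" by blast
qed

subsection \<open>Multi-indices\<close>

lemma perp_zero [simp]: "0 \<perp> F"
  by (simp add: perp_def)

lemma perp_iff: "n \<perp> F \<longleftrightarrow> (\<forall>i\<in>F. n $ i = 0)"
  by (auto simp: perp_def)

lemma perp_axis: "axis i 1 \<perp> F \<longleftrightarrow> i \<notin> F"
  by (auto simp: perp_iff axis_def)

lemma axis_one_neq_zero: "axis i (1::nat) \<noteq> 0"
  by (simp add: axis_eq_0_iff)

lemma split_axis:
  fixes n :: "nat ^ 'd::finite"
  assumes "n $ i \<noteq> 0"
  obtains m where "n = m + axis i 1" "m \<le> n" "\<And>j. j \<noteq> i \<Longrightarrow> m $ j = n $ j" "m $ i = n $ i - 1"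
proof
  let ?m = "\<chi> j. if j = i then n $ i - 1 else n $ j"
  show "n = ?m + axis i 1" using assms by (auto simp: vec_eq_iff axis_def)
qed (auto simp: less_eq_vec_def)

text \<open>Induction on the coordinate sum, removing one generator outside \<open>F\<close> at a
  time; this matches the T-identity, which concerns single generators.\<close>

lemma perp_induct [consumes 1, case_names zero step]:
  fixes n :: "nat ^ 'd::finite"
  assumes "n \<perp> F" "P 0" "\<And>m i. m \<perp> F \<Longrightarrow> i \<notin> F \<Longrightarrow> P m \<Longrightarrow> P (m + axis i 1)"
  shows "P n"
  using assms(1)
proof (induction "\<Sum>i\<in>UNIV. n $ i" arbitrary: n rule: less_induct)
  case less
  show ?case
  proof (cases "n = 0")
    case False
    then obtain i where i: "n $ i \<noteq> 0" by (auto simp: vec_eq_iff)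
    then obtain m where m: "n = m + axis i 1" "m \<le> n" "\<And>j. j \<noteq> i \<Longrightarrow> m $ j = n $ j" "m $ i = n $ i - 1"
      using split_axis[OF i] by blast
    have "m \<perp> F" using less.prems m(2) unfolding perp_iff less_eq_vec_def by (metis le_zero_eq)
    moreover have "(\<Sum>i\<in>UNIV. m $ i) < (\<Sum>i\<in>UNIV. n $ i)"
    proof (rule sum_strict_mono_ex1)
      show "\<forall>j\<in>UNIV. m $ j \<le> n $ j" using m(2) by (simp add: less_eq_vec_def)
      show "\<exists>j\<in>UNIV. m $ j < n $ j" using i m(4) by (intro bexI[of _ i]) simp_all
    qed simp
    ultimately have "P m" using less.hyps by blast
    moreover have "i \<notin> F" using less.prems i by (auto simp: perp_iff)
    ultimately show ?thesis using assms(3) \<open>m \<perp> F\<close> m(1) by blast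
  qed (simp add: assms(2))
qed

lemma ones_nth: "ones F $ j = (if j \<in> F then 1 else 0)"
proof -
  have "ones F $ j = (\<Sum>i\<in>F. if j = i then 1 else 0)"
    unfolding ones_def sum_component by (rule sum.cong) (auto simp: axis_def)
  then show ?thesis by simp
qed

lemma le_ones_iff: "n \<le> ones F \<longleftrightarrow> (\<forall>i. n $ i \<le> (if i \<in> F then 1 else 0))"
  by (simp add: less_eq_vec_def ones_nth)

lemma axis_le_ones: "i \<in> F \<Longrightarrow> axis i 1 \<le> ones F"
  by (simp add: le_ones_iff axis_def)

text \<open>Identifies \<open>inv_ideal_F\<close> of a singleton with the preimage under one
  generator, as needed for \<open>F = {}\<close>.\<close>

lemma le_ones_singleton: "n \<noteq> 0 \<Longrightarrow> n \<le> ones {i} \<Longrightarrow> n = axis i 1"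
proof -
  assume n: "n \<noteq> 0" "n \<le> ones {i}"
  have le: "n $ j \<le> (if j = i then 1 else 0)" for j using n(2) by (simp add: le_ones_iff)
  obtain j where "n $ j \<noteq> 0" using n(1) by (auto simp: vec_eq_iff)
  then have "n $ i \<noteq> 0" using le[of j] by (cases "j = i") simp_all
  then have "n $ j = axis i 1 $ j" for j
    using le[of j] by (cases "j = i") (simp_all add: axis_def)
  then show "n = axis i 1" by (simp add: vec_eq_iff)
qed

lemma inv_ideal_F_iff: "a \<in> inv_ideal_F X F I \<longleftrightarrow> (\<forall>n. n \<noteq> 0 \<longrightarrow> n \<le> ones F \<longrightarrow> a \<in> inv_ideal (X n) I)"
  by (auto simp: inv_ideal_F_def)

lemma inv_ideal_mono: "I \<subseteq> I' \<Longrightarrow> inv_ideal X I \<subseteq> inv_ideal X I'"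
  by (auto simp: inv_ideal_def)

text \<open>Coordinatewise maxima keep the index set directed, so its tails form a filter
  base.\<close>

lemma eventually_perp_limit:
  "eventually P (perp_limit F) \<longleftrightarrow> (\<exists>n. n \<perp> F \<and> (\<forall>m. m \<perp> F \<longrightarrow> n \<le> m \<longrightarrow> P m))"
proof -
  have "eventually P (perp_limit F) \<longleftrightarrow>
      (\<exists>n\<in>{n. n \<perp> F}. eventually P (principal {m. m \<perp> F \<and> n \<le> m}))"
    unfolding perp_limit_def
  proof (rule eventually_INF_base)
    show "{n. n \<perp> F} \<noteq> {}" using perp_zero by blast
    fix a b :: "nat ^ 'a" assume ab: "a \<in> {n. n \<perp> F}" "b \<in> {n. n \<perp> F}"
    show "\<exists>x\<in>{n. n \<perp> F}. principal {m. m \<perp> F \<and> x \<le> m} \<le>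
        inf (principal {m. m \<perp> F \<and> a \<le> m}) (principal {m. m \<perp> F \<and> b \<le> m})"
    proof (rule bexI[of _ "\<chi> i. max (a $ i) (b $ i)"])
      show "(\<chi> i. max (a $ i) (b $ i)) \<in> {n. n \<perp> F}" using ab by (simp add: perp_iff)
    qed (auto simp: less_eq_vec_def)
  qed
  then show ?thesis by (auto simp: eventually_principal)
qed

context product_system
begin

sublocale fibre: cstar_correspondence "X n" for n
  by (rule fibre)

section \<open>Products of fibres and preimage ideals\<close>

lemma zero_fibre:
  "carr (X 0) = range \<iota>" "ip (X 0) (\<iota> b) (lact (X 0) a (\<iota> c)) = star b * (a * c)"
proof -
  have *: "corr_unitary self_corr (X 0) (carr (X 0)) \<iota>" by (rule fibre_zero)
  show "carr (X 0) = range \<iota>" using * by (simp add: corr_unitary_def self_corr_def)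
  have "\<forall>\<xi>\<in>carr self_corr. \<forall>a. \<iota> (lact self_corr a \<xi>) = lact (X 0) a (\<iota> \<xi>)"
    and ip: "\<forall>\<xi>\<in>carr self_corr. \<forall>\<eta>\<in>carr self_corr. ip (X 0) (\<iota> \<xi>) (\<iota> \<eta>) = ip self_corr \<xi> \<eta>"
    using * unfolding corr_unitary_def by blast+
  then have "lact (X 0) a (\<iota> c) = \<iota> (a * c)" by (simp add: self_corr_def)
  moreover have "ip (X 0) (\<iota> b) (\<iota> (a * c)) = star b * (a * c)" using ip by (simp add: self_corr_def)
  ultimately show "ip (X 0) (\<iota> b) (lact (X 0) a (\<iota> c)) = star b * (a * c)" by simp
qed

text \<open>Without a unit, the test vectors \<open>a\<close> and \<open>star a * a\<close> put the
  square of \<open>star a * a\<close> into \<open>I\<close>; two uses of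
  \<open>ideal_star_mult_self\<close> recover \<open>a\<close>.\<close>

lemma inv_ideal_zero:
  assumes I: "cstar_ideal I"
  shows "inv_ideal (X 0) I = I"
proof
  show "I \<subseteq> inv_ideal (X 0) I"
    by (auto simp: fibre.inv_ideal_iff zero_fibre cstar_idealD[OF I])
  show "inv_ideal (X 0) I \<subseteq> I"
  proof
    fix a assume "a \<in> inv_ideal (X 0) I"
    then have "star b * (a * c) \<in> I" for b c by (auto simp: fibre.inv_ideal_iff zero_fibre)
    from this[of a "star a * a"] have "star (star a * a) * (star a * a) \<in> I"
      by (simp add: star_mult star_star mult.assoc)
    then show "a \<in> I" using ideal_star_mult_self[OF I] by blast
  qed
qed

definition pmult :: "nat ^ 'd \<Rightarrow> nat ^ 'd \<Rightarrow> 'x \<Rightarrow> 'x \<Rightarrow> 'x"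
  where "pmult n m \<xi> \<eta> = u n m (\<tau> n m \<xi> \<eta>)"

lemma elementary_tensor:
  assumes "\<xi> \<in> carr (X n)" "\<eta> \<in> carr (X m)" "\<xi>' \<in> carr (X n)" "\<eta>' \<in> carr (X m)"
  shows "\<tau> n m \<xi> \<eta> \<in> carr (T n m)"
    "lact (T n m) a (\<tau> n m \<xi> \<eta>) = \<tau> n m (lact (X n) a \<xi>) \<eta>"
    "ip (T n m) (\<tau> n m \<xi> \<eta>) (\<tau> n m \<xi>' \<eta>') = ip (X m) \<eta> (lact (X m) (ip (X n) \<xi> \<xi>') \<eta>')"
proof -
  note t = tensor[of n m, unfolded interior_tensor_def, THEN conjunct2]
  show "\<tau> n m \<xi> \<eta> \<in> carr (T n m)"
    using t[THEN conjunct1] assms by simp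
  note t = t[THEN conjunct2, THEN conjunct2, THEN conjunct2, THEN conjunct2, THEN conjunct2, THEN conjunct2]
  show "lact (T n m) a (\<tau> n m \<xi> \<eta>) = \<tau> n m (lact (X n) a \<xi>) \<eta>"
    using t[THEN conjunct1] assms by simp
  show "ip (T n m) (\<tau> n m \<xi> \<eta>) (\<tau> n m \<xi>' \<eta>') = ip (X m) \<eta> (lact (X m) (ip (X n) \<xi> \<xi>') \<eta>')"
    using t[THEN conjunct2, THEN conjunct1] assms by simp
qed

text \<open>Sandwiches between products are iterated sandwiches; this is the source of the rule
  composing X_n^-1 with X_m^-1.\<close>

lemma pmult_carr_ip:
  assumes nm: "n \<noteq> 0" "m \<noteq> 0"
    and x: "\<xi> \<in> carr (X n)" "\<eta> \<in> carr (X m)" "\<xi>' \<in> carr (X n)" "\<eta>' \<in> carr (X m)"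
  shows "pmult n m \<xi> \<eta> \<in> carr (X (n + m))"
    "ip (X (n + m)) (pmult n m \<xi> \<eta>) (lact (X (n + m)) a (pmult n m \<xi>' \<eta>')) =
      ip (X m) \<eta> (lact (X m) (ip (X n) \<xi> (lact (X n) a \<xi>')) \<eta>')"
proof -
  have *: "u n m ` carr (T n m) = carr (X (n + m))"
    "\<forall>s\<in>carr (T n m). \<forall>t\<in>carr (T n m). ip (X (n + m)) (u n m s) (u n m t) = ip (T n m) s t"
    "\<forall>s\<in>carr (T n m). \<forall>a. u n m (lact (T n m) a s) = lact (X (n + m)) a (u n m s)"
    using mult_unitary[OF nm] unfolding corr_unitary_def by blast+
  show "pmult n m \<xi> \<eta> \<in> carr (X (n + m))"
    using * elementary_tensor(1)[OF x] by (auto simp: pmult_def)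
  have "lact (X (n + m)) a (pmult n m \<xi>' \<eta>') = u n m (\<tau> n m (lact (X n) a \<xi>') \<eta>')"
    using *(3)[rule_format, OF elementary_tensor(1)[OF x(3,4) x(3,4)], of a] elementary_tensor(2)[OF x(3,4) x(3,4), of a]
    by (simp add: pmult_def)
  then show "ip (X (n + m)) (pmult n m \<xi> \<eta>) (lact (X (n + m)) a (pmult n m \<xi>' \<eta>')) =
      ip (X m) \<eta> (lact (X m) (ip (X n) \<xi> (lact (X n) a \<xi>')) \<eta>')"
    using *(2) elementary_tensor(1,3)[OF x(1,2) fibre.lact_carr[OF x(3)] x(4)]
      elementary_tensor(1)[OF fibre.lact_carr[OF x(3)] x(4) x(3,4)] by (simp add: pmult_def)
qed

lemma pmult_dense:
  assumes nm: "n \<noteq> 0" "m \<noteq> 0"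
  shows "carr (X (n + m)) \<subseteq> hclosed_span (X (n + m)) {pmult n m \<xi> \<eta> | \<xi> \<eta>. \<xi> \<in> carr (X n) \<and> \<eta> \<in> carr (X m)}"
    (is "_ \<subseteq> hclosed_span _ ?S")
proof
  fix x assume x: "x \<in> carr (X (n + m))"
  have *: "u n m ` carr (T n m) = carr (X (n + m))"
    "\<forall>s\<in>carr (T n m). \<forall>t\<in>carr (T n m). u n m (s + t) = u n m s + u n m t"
    "\<forall>s\<in>carr (T n m). \<forall>c. u n m (c *\<^sub>C s) = c *\<^sub>C u n m s"
    "\<forall>s\<in>carr (T n m). \<forall>t\<in>carr (T n m). ip (X (n + m)) (u n m s) (u n m t) = ip (T n m) s t"
    using mult_unitary[OF nm] unfolding corr_unitary_def by blast+
  let ?E = "{\<tau> n m \<xi> \<eta> | \<xi> \<eta>. \<xi> \<in> carr (X n) \<and> \<eta> \<in> carr (X m)}"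
  have "cstar_correspondence (T n m)" and span: "hclosed_span (T n m) ?E = carr (T n m)"
    using tensor[of n m] unfolding interior_tensor_def by blast+
  then interpret T: cstar_correspondence "T n m" by simp
  obtain t where t: "t \<in> carr (T n m)" "x = u n m t" using x *(1) by blast
  have E: "?E \<subseteq> carr (T n m)" using elementary_tensor(1) by blast
  show "x \<in> hclosed_span (X (n + m)) ?S"
    unfolding hclosed_span_def
  proof (intro CollectI conjI x allI impI)
    fix \<epsilon> :: real assume "\<epsilon> > 0"
    moreover have "t \<in> hclosed_span (T n m) ?E" using t(1) by (simp only: span)
    ultimately obtain s where s: "s \<in> cspan ?E" "hnorm (T n m) (t - s) < \<epsilon>"
      unfolding hclosed_span_def by blast
    have sc: "s \<in> carr (T n m)" using s(1) cspan_subset[OF E T.carr_subspace] by blast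
    have u0: "u n m 0 = 0" using *(3)[rule_format, OF T.carr_zero, of 0] by simp
    have "s \<in> carr (T n m) \<and> u n m s \<in> cspan ?S"
      using s(1)
    proof (induction rule: cspan_induct)
      case zero
      then show ?case using u0 cspan_intros(1) by simp
    next
      case (step c y z)
      then have y: "y \<in> carr (T n m)" "u n m y \<in> ?S" using E by (auto simp: pmult_def)
      have "u n m (c *\<^sub>C y + z) = c *\<^sub>C u n m y + u n m z" using * y step by simp
      moreover have "c *\<^sub>C u n m y + u n m z \<in> cspan ?S"
        using step(3) by (intro cspan_intros(2)[OF cspan_intros(3)[OF cspan_intros(4)[OF y(2)]]]) blast
      ultimately show ?case using y step by simp
    qed
    moreover have "hnorm (X (n + m)) (x - u n m s) = hnorm (T n m) (t - s)"
    proof -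
      have "u n m (t - s) = x - u n m s"
        using *(2)[rule_format, of "t - s" s] t sc by simp
      then have "ip (X (n + m)) (x - u n m s) (x - u n m s) = ip (T n m) (t - s) (t - s)"
        using *(4)[rule_format, of "t - s" "t - s"] t(1) sc by simp
      then show ?thesis by (simp add: hnorm_def)
    qed
    ultimately show "\<exists>\<eta>\<in>cspan ?S. hnorm (X (n + m)) (x - \<eta>) < \<epsilon>" using s(2) by (intro bexI[of _ "u n m s"]) auto
  qed
qed

text \<open>A sandwich over X_m of a sandwich over X_n is one over X_(n+m), between products.
  \<open>mult_unitary\<close> does not cover index zero: there the ideal property (n = 0) or
  \<open>inv_ideal_zero\<close> (m = 0) is used.\<close>

lemma inv_ideal_addD:
  assumes I: "cstar_ideal I" and a: "a \<in> inv_ideal (X (n + m)) I"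
    and \<xi>: "\<xi> \<in> carr (X n)" and \<xi>': "\<xi>' \<in> carr (X n)"
  shows "ip (X n) \<xi> (lact (X n) a \<xi>') \<in> inv_ideal (X m) I"
proof -
  consider "n = 0" | "m = 0" | "n \<noteq> 0" "m \<noteq> 0" by blast
  then show ?thesis
  proof cases
    case 1
    then obtain b c where "\<xi> = \<iota> b" "\<xi>' = \<iota> c" using \<xi> \<xi>' zero_fibre(1) by auto
    then show ?thesis
      using a 1 cstar_idealD(6,7)[OF fibre.cstar_ideal_inv_ideal[OF I]] by (simp add: zero_fibre)
  next
    case 2
    then show ?thesis using a \<xi> \<xi>' by (simp add: inv_ideal_zero[OF I] fibre.inv_ideal_iff)
  next
    case 3
    show ?thesis
      unfolding fibre.inv_ideal_iff
      using a pmult_carr_ip[OF 3] \<xi> \<xi>' unfolding fibre.inv_ideal_iff by metis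
  qed
qed

text \<open>Between products of vectors the claim is the hypothesis; density of these products
  extends it to the fibre, one variable at a time.\<close>

lemma inv_ideal_addI:
  assumes I: "cstar_ideal I" and nm: "n \<noteq> 0" "m \<noteq> 0"
    and a: "\<And>\<xi> \<xi>'. \<xi> \<in> carr (X n) \<Longrightarrow> \<xi>' \<in> carr (X n) \<Longrightarrow> ip (X n) \<xi> (lact (X n) a \<xi>') \<in> inv_ideal (X m) I"
  shows "a \<in> inv_ideal (X (n + m)) I"
  unfolding fibre.inv_ideal_iff
proof (intro ballI)
  let ?S = "{pmult n m \<xi> \<eta> | \<xi> \<eta>. \<xi> \<in> carr (X n) \<and> \<eta> \<in> carr (X m)}"
  have S: "?S \<subseteq> carr (X (n + m))" using pmult_carr_ip(1)[OF nm] by blast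
  have el: "ip (X (n + m)) s (lact (X (n + m)) a t) \<in> I" if "s \<in> ?S" "t \<in> ?S" for s t
    using that a pmult_carr_ip(2)[OF nm] unfolding fibre.inv_ideal_iff by fastforce
  fix x y assume x: "x \<in> carr (X (n + m))" and y: "y \<in> carr (X (n + m))"
  have 1: "ip (X (n + m)) s (lact (X (n + m)) a y) \<in> I" if s: "s \<in> ?S" for s
  proof -
    have s': "s \<in> carr (X (n + m))" using S s by blast
    have "ip (X (n + m)) (lact (X (n + m)) (star a) s) y \<in> I"
    proof (rule fibre.ip_hclosed_span[OF I _ S])
      show "y \<in> hclosed_span (X (n + m)) ?S" using y pmult_dense[OF nm] by blast
      show "ip (X (n + m)) (lact (X (n + m)) (star a) s) t \<in> I" if "t \<in> ?S" for t
        using el[OF s that] s' that S by (simp add: fibre.lact_star' subsetD)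
    qed (simp add: s')
    then show ?thesis using s' y by (simp add: fibre.lact_star')
  qed
  have "ip (X (n + m)) (lact (X (n + m)) a y) x \<in> I"
  proof (rule fibre.ip_hclosed_span[OF I _ S])
    show "x \<in> hclosed_span (X (n + m)) ?S" using x pmult_dense[OF nm] by blast
    show "ip (X (n + m)) (lact (X (n + m)) a y) s \<in> I" if "s \<in> ?S" for s
      using ideal_star[OF I 1[OF that]] that S y by (simp add: fibre.ip_star subsetD)
  qed (simp add: y)
  from ideal_star[OF I this] show "ip (X (n + m)) x (lact (X (n + m)) a y) \<in> I"
    using x y by (simp add: fibre.ip_star)
qed

lemma cstar_ideal_inv_ideal_F: "cstar_ideal I \<Longrightarrow> cstar_ideal (inv_ideal_F X F I)"
  unfolding inv_ideal_F_def by (intro cstar_ideal_INT fibre.cstar_ideal_inv_ideal)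

text \<open>With \<open>z\<close> also \<open>star z\<close> lies in the preimage ideal, so the
  defining property of J_F puts \<open>z * star z\<close> into \<open>I\<close>.\<close>

lemma J_ideal_Int_inv_ideal_F:
  assumes I: "cstar_ideal I" and z: "z \<in> J_ideal X F I" "z \<in> inv_ideal_F X F I"
  shows "z \<in> I"
proof -
  have "star z \<in> inv_ideal_F X F I" by (rule ideal_star[OF cstar_ideal_inv_ideal_F[OF I] z(2)])
  then have "star (star z) * star z \<in> I" using z(1) by (simp add: J_ideal_def star_star)
  then have "star z \<in> I" by (rule ideal_star_mult_self[OF I])
  then show ?thesis using ideal_star[OF I] star_star by metis
qed

text \<open>A closed subspace absorbs closed spans, so invariance becomes containment in a preimage
  ideal, the form used in both directions.\<close>

lemma invariant_inv_ideal:
  assumes "cstar_ideal (L F)"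
  shows "cclosed_span (sandwich (X n) (L F)) \<subseteq> L F \<longleftrightarrow> L F \<subseteq> inv_ideal (X n) (L F)"
proof -
  have "cclosed_span S \<subseteq> L F \<longleftrightarrow> S \<subseteq> L F" for S
  proof
    show "cclosed_span S \<subseteq> L F" if "S \<subseteq> L F"
      unfolding cclosed_span_def using assms that
      by (intro closure_minimal cspan_subset) (simp_all add: cstar_ideal_def)
    show "S \<subseteq> L F" if "cclosed_span S \<subseteq> L F"
      using that cspan_intros(4) closure_subset unfolding cclosed_span_def by blast
  qed
  moreover have "sandwich (X n) (L F) \<subseteq> L F \<longleftrightarrow>
      (\<forall>a\<in>L F. \<forall>\<xi>\<in>carr (X n). \<forall>\<eta>\<in>carr (X n). ip (X n) \<xi> (lact (X n) a \<eta>) \<in> L F)"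
    unfolding sandwich_def by blast
  ultimately show ?thesis by (simp add: subset_eq[of "L F" "inv_ideal _ _"] fibre.inv_ideal_iff)
qed

lemma quotient_norm_lact_eq_zero:
  assumes "proper X" "cstar_ideal I" "a \<in> inv_ideal (X n) I"
  shows "quotient_norm (X n) (compacts_on (X n) (module_ideal (X n) I)) (lact (X n) a) = 0"
  using assms fibre.lact_compacts_on_ideal fibre.module_ideal_carr
  by (intro fibre.quotient_norm_eq_zero) (simp_all add: proper_def)

subsection \<open>NT-tuples are T-families\<close>

lemma NT_tuple_imp_T_family:
  assumes proper: "proper X" and NT: "NT_tuple X L"
  shows "T_family X L"
proof -
  have tup: "is_tuple L" and ideals: "\<And>F. cstar_ideal (L F)" and
    J: "\<And>F. F \<noteq> {} \<Longrightarrow> L F \<subseteq> J_ideal X F (L {})" and po: "\<And>F F'. F \<subseteq> F' \<Longrightarrow> L F \<subseteq> L F'" and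
    max: "\<And>F. F \<noteq> {} \<Longrightarrow> F \<noteq> UNIV \<Longrightarrow>
      (\<Inter>n\<in>{n. n \<perp> F}. inv_ideal (X n) (J_ideal X F (L {}))) \<inter> L_inv X L F \<inter> L_lim X L F \<subseteq> L F"
    using NT unfolding NT_tuple_def consists_of_ideals_def partially_ordered_def by auto
  have inv: "L F \<subseteq> inv_ideal (X n) (L F)" if "n \<perp> F" for n F
    using NT that invariant_inv_ideal[of L F n, OF ideals] unfolding NT_tuple_def X_invariant_def by simp
  note idl = cstar_idealD[OF ideals]
  let ?I = "L {}"

  \<comment> \<open>For \<open>c\<close> in X_F^-1(I), the product \<open>b * c\<close> is shown to
    lie in X_D^-1(I) and J_D(I) with \<open>D = insert i F\<close>, hence in I.\<close>
  have J_step: "b \<in> J_ideal X F ?I"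
    if F: "F \<noteq> {}" "i \<notin> F" and b: "b \<in> inv_ideal (X (axis i 1)) (L F)" "b \<in> L (insert i F)" for F i b
    unfolding J_ideal_def
  proof (intro CollectI ballI)
    fix c assume c: "c \<in> inv_ideal_F X F ?I"
    define z where "z = b * c"
    have zF: "z \<in> inv_ideal (X n) ?I" if "n \<noteq> 0" "n \<le> ones F" for n
      using c that cstar_idealD(6)[OF fibre.cstar_ideal_inv_ideal[OF ideals]]
      by (simp add: z_def inv_ideal_F_iff)
    have zi: "z \<in> inv_ideal (X (axis i 1)) (L F)"
      unfolding z_def by (rule cstar_idealD(7)[OF fibre.cstar_ideal_inv_ideal[OF ideals] b(1)])
    have zFi: "z \<in> inv_ideal (X (m + axis i 1)) ?I" if m: "m \<noteq> 0" "m \<le> ones F" for m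
    proof (rule inv_ideal_addI[OF ideals m(1) axis_one_neq_zero])
      fix \<xi> \<xi>' assume "\<xi> \<in> carr (X m)" "\<xi>' \<in> carr (X m)"
      then have "ip (X m) \<xi> (lact (X m) z \<xi>') \<in> ?I"
        using zF[OF m] by (simp add: fibre.inv_ideal_iff)
      then show "ip (X m) \<xi> (lact (X m) z \<xi>') \<in> inv_ideal (X (axis i 1)) ?I"
        using inv[OF perp_axis[of i "{}", THEN iffD2]] by blast
    qed
    have "z \<in> inv_ideal (X (axis i 1)) ?I"
      unfolding fibre.inv_ideal_iff
    proof (intro ballI)
      fix \<xi> \<xi>' assume \<xi>: "\<xi> \<in> carr (X (axis i 1))" "\<xi>' \<in> carr (X (axis i 1))"
      \<comment> \<open>\<open>?e\<close> lies in J_F(I) through L_F, and in X_F^-1(I) because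
        \<open>z\<close> is in the preimages for the indices m + i.\<close>
      let ?e = "ip (X (axis i 1)) \<xi> (lact (X (axis i 1)) z \<xi>')"
      have "?e \<in> L F" using zi \<xi> by (simp add: fibre.inv_ideal_iff)
      then have "?e \<in> J_ideal X F ?I" using J[OF F(1)] by blast
      moreover have "?e \<in> inv_ideal_F X F ?I"
        unfolding inv_ideal_F_iff
        using inv_ideal_addD[OF ideals _ \<xi>] zFi by (simp add: add.commute)
      ultimately show "?e \<in> ?I" by (rule J_ideal_Int_inv_ideal_F[OF ideals])
    qed
    then have "z \<in> inv_ideal_F X (insert i F) ?I"
      unfolding inv_ideal_F_iff
    proof (intro allI impI)
      fix n :: "nat ^ 'd" assume n: "n \<noteq> 0" "n \<le> ones (insert i F)"
      assume zi': "z \<in> inv_ideal (X (axis i 1)) ?I"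
      show "z \<in> inv_ideal (X n) ?I"
      proof (cases "n $ i = 0")
        case True
        then have "n $ j \<le> (if j \<in> F then 1 else 0)" for j
          using n(2)[unfolded le_ones_iff, rule_format, of j] by (cases "j = i") auto
        then have "n \<le> ones F" by (simp add: le_ones_iff)
        then show ?thesis using zF n(1) by blast
      next
        case False
        \<comment> \<open>Entry i of n is exactly 1, so removing the generator once leaves an index
          below \<open>ones F\<close>.\<close>
        then obtain m where m: "n = m + axis i 1" "\<And>j. j \<noteq> i \<Longrightarrow> m $ j = n $ j" "m $ i = n $ i - 1"
          using split_axis by metis
        have "m $ j \<le> (if j \<in> F then 1 else 0)" for j
          using n(2)[unfolded le_ones_iff, rule_format, of j] m(2)[of j] m(3) F(2)
          by (cases "j = i") auto
        then have "m \<le> ones F" by (simp add: le_ones_iff)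
        then show ?thesis using zFi zi' m(1) by (cases "m = 0") simp_all
      qed
    qed
    moreover have "z \<in> J_ideal X (insert i F) ?I"
      using J[of "insert i F"] idl(7)[OF b(2)] by (auto simp: z_def)
    ultimately show "b * c \<in> ?I" using J_ideal_Int_inv_ideal_F[OF ideals] by (simp add: z_def)
  qed

  have "a \<in> L F" if "i \<notin> F" "a \<in> inv_ideal (X (axis i 1)) (L F)" "a \<in> L (insert i F)" for F i a
    using that
  proof (induction "card (- F)" arbitrary: F i a rule: less_induct)
    case less
    note i = less.prems(1) and ai = less.prems(2) and aFi = less.prems(3)
    show ?case
    proof (cases "F = {}")
      case True
      \<comment> \<open>The maximality axiom speaks of nonempty sets; here \<open>L {i}\<close>
        being inside its J-ideal takes its place.\<close>
      have "a \<in> inv_ideal_F X {i} ?I"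
        using ai True le_ones_singleton by (auto simp: inv_ideal_F_iff)
      moreover have "a \<in> J_ideal X {i} ?I" using J[of "{i}"] aFi True by auto
      ultimately show ?thesis using J_ideal_Int_inv_ideal_F[OF ideals] True by blast
    next
      case False
      have neU: "F \<noteq> UNIV" using i by blast
      \<comment> \<open>Split off i as the first factor: sandwiches over X_i fall into L_F, which is
        invariant under the remaining index.\<close>
      have aF: "a \<in> inv_ideal (X n) (L F)" if n: "n \<perp> F" "n $ i \<noteq> 0" for n
      proof -
        obtain m where m: "n = m + axis i 1" "m \<le> n" using n(2) split_axis by metis
        have mF: "m \<perp> F" using n(1) m(2) unfolding perp_iff less_eq_vec_def by (metis le_zero_eq)
        show ?thesis
        proof (cases "m = 0")
          case True
          then show ?thesis using ai m by simp
        next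
          case False
          have "a \<in> inv_ideal (X (axis i 1 + m)) (L F)"
          proof (rule inv_ideal_addI[OF ideals axis_one_neq_zero False])
            fix \<xi> \<xi>' assume "\<xi> \<in> carr (X (axis i 1))" "\<xi>' \<in> carr (X (axis i 1))"
            then have "ip (X (axis i 1)) \<xi> (lact (X (axis i 1)) a \<xi>') \<in> L F"
              using ai by (simp add: fibre.inv_ideal_iff)
            then show "ip (X (axis i 1)) \<xi> (lact (X (axis i 1)) a \<xi>') \<in> inv_ideal (X m) (L F)"
              using inv[OF mF] by blast
          qed
          then show ?thesis by (simp add: m(1) add.commute)
        qed
      qed
      \<comment> \<open>A sandwich of \<open>a\<close> is either already in L_F or inherits both
        hypotheses on \<open>a\<close>; this serves the J-condition and \<open>L_inv\<close>
        alike.\<close>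
      have b_cases: "ip (X n) \<xi> (lact (X n) a \<eta>) \<in> L F \<or>
          ip (X n) \<xi> (lact (X n) a \<eta>) \<in> inv_ideal (X (axis i 1)) (L F) \<inter> L (insert i F)"
        if n: "n \<perp> F" and \<xi>: "\<xi> \<in> carr (X n)" "\<eta> \<in> carr (X n)" for n \<xi> \<eta>
      proof (cases "n $ i = 0")
        case False
        then show ?thesis using aF[OF n] \<xi> by (simp add: fibre.inv_ideal_iff)
      next
        case True
        then have "n \<perp> insert i F" using n by (simp add: perp_iff)
        then have "ip (X n) \<xi> (lact (X n) a \<eta>) \<in> L (insert i F)"
          using inv aFi \<xi> by (auto simp: fibre.inv_ideal_iff subset_iff)
        moreover have "n + axis i 1 \<perp> F" "(n + axis i 1) $ i \<noteq> 0"
          using n i by (auto simp: perp_iff axis_def)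
        then have "ip (X n) \<xi> (lact (X n) a \<eta>) \<in> inv_ideal (X (axis i 1)) (L F)"
          using inv_ideal_addD[OF ideals aF \<xi>] by blast
        ultimately show ?thesis by blast
      qed
      have "a \<in> (\<Inter>n\<in>{n. n \<perp> F}. inv_ideal (X n) (J_ideal X F ?I))"
      proof (intro INT_I)
        fix n assume "n \<in> {n. n \<perp> F}"
        then have n: "n \<perp> F" by simp
        show "a \<in> inv_ideal (X n) (J_ideal X F ?I)"
          unfolding fibre.inv_ideal_iff[of a n]
          using b_cases[OF n] J_step[OF False i] J[OF False] by blast
      qed
      moreover have "a \<in> L_inv X L F"
        unfolding L_inv_def
      proof (intro INT_I)
        fix n assume "n \<in> {n. n \<perp> F}"
        then have n: "n \<perp> F" by simp
        show "a \<in> inv_ideal (X n) (\<Inter>D\<in>{D. F \<subset> D}. L D)"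
          unfolding fibre.inv_ideal_iff
        proof (intro ballI INT_I)
          fix \<xi> \<eta> D assume \<xi>: "\<xi> \<in> carr (X n)" "\<eta> \<in> carr (X n)" and "D \<in> {D. F \<subset> D}"
          then have D: "F \<subset> D" by simp
          let ?b = "ip (X n) \<xi> (lact (X n) a \<eta>)"
          show "?b \<in> L D"
          proof (cases "?b \<in> L F")
            case True
            then show ?thesis using po[of F D] D by blast
          next
            case False
            then have b: "?b \<in> inv_ideal (X (axis i 1)) (L F)" "?b \<in> L (insert i F)"
              using b_cases[OF n \<xi>] by blast+
            show ?thesis
            proof (cases "i \<in> D")
              case True
              then show ?thesis using po[of "insert i F" D] b(2) D by blast
            next
              \<comment> \<open>\<open>D\<close> is strictly larger than \<open>F\<close> and still
                misses i, so the induction hypothesis applies to the sandwich.\<close>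
              case iD: False
              have "card (- D) < card (- F)" using D by (intro psubset_card_mono) auto
              moreover have "?b \<in> inv_ideal (X (axis i 1)) (L D)"
                using b(1) inv_ideal_mono[OF po[of F D]] D by blast
              moreover have "?b \<in> L (insert i D)" using po[of "insert i F" "insert i D"] b(2) D by blast
              ultimately show ?thesis using less.hyps iD by blast
            qed
          qed
        qed
      qed
      moreover have "a \<in> L_lim X L F"
        unfolding L_lim_def
      proof (intro CollectI tendsto_eventually)
        show "\<forall>\<^sub>F n in perp_limit F. quotient_norm (X n) (compacts_on (X n) (module_ideal (X n) (L F))) (lact (X n) a) = 0"
          unfolding eventually_perp_limit
        proof (intro exI[of _ "axis i 1"] conjI allI impI)
          show "axis i 1 \<perp> F" using i perp_axis by blast
          fix m :: "nat ^ 'd" assume m: "m \<perp> F" "axis i 1 \<le> m"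
          have "m $ i \<noteq> 0" using m(2)[unfolded less_eq_vec_def, rule_format, of i] by (simp add: axis_def)
          then show "quotient_norm (X m) (compacts_on (X m) (module_ideal (X m) (L F))) (lact (X m) a) = 0"
            using aF m(1) by (intro quotient_norm_lact_eq_zero[OF proper ideals])
        qed
      qed
      ultimately show ?thesis using max[OF False neU] by blast
    qed
  qed
  moreover have "L F \<subseteq> inv_ideal (X (axis i 1)) (L F) \<inter> L (insert i F)" if "i \<notin> F" for F i
    using inv[OF perp_axis[THEN iffD2, OF that]] po[of F "insert i F"] by blast
  ultimately show ?thesis
    unfolding T_family_def consists_of_ideals_def using tup ideals by blast
qed

subsection \<open>T-families are NT-tuples\<close>

lemma T_family_imp_NT_tuple:
  assumes proper: "proper X" and T: "T_family X L"
  shows "NT_tuple X L"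
proof -
  have tup: "is_tuple L" and ideals: "\<And>F. cstar_ideal (L F)" and
    eq: "\<And>F i. i \<notin> F \<Longrightarrow> L F = inv_ideal (X (axis i 1)) (L F) \<inter> L (insert i F)"
    using T unfolding T_family_def consists_of_ideals_def by blast+
  have po: "L F \<subseteq> L F'" if "F \<subseteq> F'" for F F'
  proof -
    have "L F \<subseteq> L (F \<union> G)" if "finite G" for G
      using that
    proof (induction G)
      case (insert i G)
      have "L (F \<union> G) \<subseteq> L (insert i (F \<union> G))"
        using eq[of i "F \<union> G"] by (cases "i \<in> F \<union> G") (auto simp: insert_absorb)
      then show ?case using insert by auto
    qed simp
    from this[of "F'"] show ?thesis using that by (simp add: Un_absorb1)
  qed
  have inv: "L F \<subseteq> inv_ideal (X n) (L F)" if "n \<perp> F" for n F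
    using that
  proof (induction rule: perp_induct)
    case zero
    then show ?case by (simp add: inv_ideal_zero[OF ideals])
  next
    case (step m i)
    have 1: "L F \<subseteq> inv_ideal (X (axis i 1)) (L F)" using eq[OF step(2)] by blast
    show ?case
    proof (cases "m = 0")
      case False
      show ?thesis
      proof
        fix a assume "a \<in> L F"
        then show "a \<in> inv_ideal (X (m + axis i 1)) (L F)"
          using step(3) 1
          by (intro inv_ideal_addI[OF ideals False axis_one_neq_zero]) (auto simp: fibre.inv_ideal_iff subset_iff)
      qed
    qed (use 1 in simp)
  qed
  have J: "L F \<subseteq> J_ideal X F (L {})" for F
  proof
    fix a assume a: "a \<in> L F"
    show "a \<in> J_ideal X F (L {})"
      unfolding J_ideal_def
    proof (intro CollectI ballI)
      fix b assume b: "b \<in> inv_ideal_F X F (L {})"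
      have z: "a * b \<in> inv_ideal (X (axis i 1)) (L D)" if "i \<in> F" for i D
      proof -
        have "a * b \<in> inv_ideal_F X F (L {})"
          by (rule cstar_idealD(6)[OF cstar_ideal_inv_ideal_F[OF ideals] b])
        then have "a * b \<in> inv_ideal (X (axis i 1)) (L {})"
          using axis_one_neq_zero axis_le_ones[OF that] by (simp add: inv_ideal_F_iff)
        then show ?thesis using inv_ideal_mono[OF po[of "{}" D]] by blast
      qed
      \<comment> \<open>Descent from \<open>D = F\<close>, where the ideal property suffices, to
        \<open>D = {}\<close>; each removal of i uses the T-identity with \<open>z\<close> as its
        preimage half.\<close>
      have "a * b \<in> L D" if "D \<subseteq> F" for D
        using that
      proof (induction "card (F - D)" arbitrary: D rule: less_induct)
        case less
        show ?case
        proof (cases "D = F")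
          case True
          then show ?thesis using cstar_idealD(7)[OF ideals a] by simp
        next
          case False
          then obtain i where i: "i \<in> F" "i \<notin> D" using less.prems by blast
          have "card (F - insert i D) < card (F - D)" using i by (intro psubset_card_mono) auto
          then have "a * b \<in> L (insert i D)" using less.hyps less.prems i by blast
          then show ?thesis using eq[OF i(2)] z[OF i(1)] by blast
        qed
      qed
      then show "a * b \<in> L {}" by blast
    qed
  qed
  have max: "a \<in> L F" if F: "F \<noteq> UNIV" and ainv: "a \<in> L_inv X L F" and alim: "a \<in> L_lim X L F" for F a
  proof -
    let ?M = "L_inv X L F"
    have M: "cstar_ideal ?M"
      unfolding L_inv_def by (intro cstar_ideal_INT fibre.cstar_ideal_inv_ideal ideals)
    \<comment> \<open>Peel off the last generator: sandwiches over X_m lie in X_i^-1(L_F), and in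
      \<open>L (insert i F)\<close> because \<open>b\<close> is in \<open>?M\<close>; the T-identity
      puts them into L_F.\<close>
    have kernel: "b \<in> L F" if "n \<perp> F" "b \<in> ?M" "b \<in> inv_ideal (X n) (L F)" for n b
      using that
    proof (induction rule: perp_induct)
      case zero
      then show ?case by (simp add: inv_ideal_zero[OF ideals])
    next
      case (step m i)
      have "b \<in> inv_ideal (X m) (L F)"
        unfolding fibre.inv_ideal_iff
      proof (intro ballI)
        fix \<xi> \<eta> assume \<xi>: "\<xi> \<in> carr (X m)" "\<eta> \<in> carr (X m)"
        have "ip (X m) \<xi> (lact (X m) b \<eta>) \<in> inv_ideal (X (axis i 1)) (L F)"
          using inv_ideal_addD[OF ideals step.prems(2) \<xi>] .
        moreover have "b \<in> inv_ideal (X m) (\<Inter>D\<in>{D. F \<subset> D}. L D)"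
          using step.prems(1) step(1) unfolding L_inv_def by blast
        then have "ip (X m) \<xi> (lact (X m) b \<eta>) \<in> L (insert i F)"
        proof -
          have "F \<subset> insert i F" using step(2) by blast
          with \<open>b \<in> inv_ideal (X m) _\<close> \<xi> show ?thesis by (simp add: fibre.inv_ideal_iff)
        qed
        ultimately show "ip (X m) \<xi> (lact (X m) b \<eta>) \<in> L F" using eq[OF step(2)] by blast
      qed
      then show ?case using step by blast
    qed
    define h where "h = star a * a"
    have hM: "h \<in> ?M" unfolding h_def by (rule cstar_idealD(6)[OF M ainv])
    have "h * h \<in> L F"
    proof (rule closed_approachable)
      show "closed (L F)" by (rule cstar_idealD[OF ideals])
      fix \<delta> :: real assume \<delta>: "\<delta> > 0"
      \<comment> \<open>Makes the cutoff error \<open>2 * \<epsilon>' * norm h\<close> smaller than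
        \<open>\<delta>\<close>.\<close>
      define \<epsilon>' where "\<epsilon>' = \<delta> / (2 * norm h + 1)"
      have \<epsilon>': "\<epsilon>' > 0" using \<delta> by (simp add: \<epsilon>'_def add_nonneg_pos)
      obtain g where g: "star g = g" "\<And>I. cstar_ideal I \<Longrightarrow> h \<in> I \<Longrightarrow> g \<in> I"
        "norm (h * h - g) \<le> 2 * \<epsilon>' * norm h"
        "\<And>N. \<exists>b. star (((\<lambda>x. h * x) ^^ N) g) * (((\<lambda>x. h * x) ^^ N) g) = (\<epsilon>' ^ N)\<^sup>2 *\<^sub>R (g * g) + star b * b"
        using spectral_cutoff[OF \<epsilon>' h_def] by metis
      \<comment> \<open>An error \<open>\<epsilon>\<close> for \<open>a\<close>, multiplied by
        \<open>star a\<close>, becomes at most \<open>\<epsilon>' / 2\<close> for \<open>h\<close>,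
        strictly below the cutoff.\<close>
      define \<epsilon> where "\<epsilon> = \<epsilon>' / (2 * (norm a + 1))"
      have a1: "norm a + 1 > 0" by (simp add: add_nonneg_pos)
      have \<epsilon>: "\<epsilon> > 0" using \<epsilon>' a1 by (simp add: \<epsilon>_def)
      let ?q = "\<lambda>n. quotient_norm (X n) (compacts_on (X n) (module_ideal (X n) (L F))) (lact (X n) a)"
      have "(?q \<longlongrightarrow> 0) (perp_limit F)" using alim by (simp add: L_lim_def)
      then have "\<forall>\<^sub>F n in perp_limit F. ?q n < \<epsilon>" using \<epsilon> by (rule order_tendstoD)
      then obtain n where n: "n \<perp> F" "?q n < \<epsilon>" unfolding eventually_perp_limit by blast
      obtain R where R: "R \<in> compacts_on (X n) (module_ideal (X n) (L F))"
          "\<And>\<xi>. \<xi> \<in> carr (X n) \<Longrightarrow> hnorm (X n) (lact (X n) a \<xi> - R \<xi>) \<le> \<epsilon> * hnorm (X n) \<xi>"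
        using fibre.quotient_norm_lessD[OF n(2) fibre.module_ideal_carr fibre.lact_adjointable] by blast
      have Radj: "R \<in> adjointables (X n)" using R(1) by (simp add: compacts_on_def)
      have Rc: "R \<xi> \<in> carr (X n)" if "\<xi> \<in> carr (X n)" for \<xi>
        using fibre.adjointable_carr[OF Radj that] .
      have "g * g \<in> inv_ideal (X n) (L F)"
      proof (rule fibre.cutoff_square_in_inv_ideal[OF ideals, where R="\<lambda>\<xi>. lact (X n) (star a) (R \<xi>)"
            and \<epsilon>="\<epsilon>' / 2"])
        fix \<xi> assume \<xi>: "\<xi> \<in> carr (X n)"
        show "lact (X n) (star a) (R \<xi>) \<in> carr (X n)" using Rc \<xi> by simp
        have "lact (X n) h \<xi> - lact (X n) (star a) (R \<xi>) = lact (X n) (star a) (lact (X n) a \<xi> - R \<xi>)"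
          using \<xi> Rc by (simp add: h_def fibre.lact_mult fibre.lact_diff_right)
        also have "hnorm (X n) \<dots> \<le> norm a * hnorm (X n) (lact (X n) a \<xi> - R \<xi>)"
          using fibre.hnorm_lact[of "lact (X n) a \<xi> - R \<xi>" n "star a"] \<xi> Rc by simp
        also have "\<dots> \<le> (norm a + 1) * (\<epsilon> * hnorm (X n) \<xi>)"
          using R(2)[OF \<xi>] by (intro mult_mono) simp_all
        also have "\<dots> = ((norm a + 1) * \<epsilon>) * hnorm (X n) \<xi>" by simp
        also have "(norm a + 1) * \<epsilon> = \<epsilon>' / 2" using a1 by (simp add: \<epsilon>_def field_simps)
        finally show "hnorm (X n) (lact (X n) h \<xi> - lact (X n) (star a) (R \<xi>)) \<le> \<epsilon>' / 2 * hnorm (X n) \<xi>" .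
      next
        fix \<xi> \<eta> assume \<xi>: "\<xi> \<in> carr (X n)" "\<eta> \<in> carr (X n)"
        show "ip (X n) \<xi> (lact (X n) (star a) (R \<eta>)) \<in> L F"
          using fibre.ip_compacts_on_ideal[OF ideals R(1), of "lact (X n) a \<xi>" \<eta>] \<xi> Rc
          by (simp add: fibre.lact_star)
      qed (use \<epsilon>' g in auto)
      moreover have "g * g \<in> ?M" by (rule cstar_idealD(6)[OF M g(2)[OF M hM]])
      ultimately have "g * g \<in> L F" using kernel n(1) by blast
      then have "g \<in> L F" using ideal_star_mult_self[OF ideals] g(1) by metis
      moreover have "norm (h * h - g) < \<delta>"
      proof -
        have "2 * \<epsilon>' * norm h < \<epsilon>' * (2 * norm h + 1)" using \<epsilon>' by (simp add: algebra_simps)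
        also have "\<dots> = \<delta>" by (simp add: \<epsilon>'_def add_nonneg_pos less_imp_neq[symmetric])
        finally show ?thesis using g(3) by simp
      qed
      ultimately show "\<exists>y\<in>L F. norm (h * h - y) < \<delta>" by blast
    qed
    \<comment> \<open>Both descents, from \<open>h * h\<close> to \<open>h\<close> and from
      \<open>h\<close> to \<open>a\<close>, use \<open>ideal_star_mult_self\<close>.\<close>
    then have "star h * h \<in> L F" by (simp add: h_def star_mult star_star)
    then have "h \<in> L F" by (rule ideal_star_mult_self[OF ideals])
    then show ?thesis unfolding h_def by (rule ideal_star_mult_self[OF ideals])
  qed
  show ?thesis
    unfolding NT_tuple_def consists_of_ideals_def X_invariant_def partially_ordered_def
  proof (intro conjI allI impI)
    show "cclosed_span (sandwich (X n) (L F)) \<subseteq> L F" if "n \<perp> F" for F n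
      using inv[OF that] invariant_inv_ideal[of L F, OF ideals] by blast
    show "(\<Inter>n\<in>{n. n \<perp> F}. inv_ideal (X n) (J_ideal X F (L {}))) \<inter> L_inv X L F \<inter> L_lim X L F \<subseteq> L F"
      if "F \<noteq> {} \<and> F \<noteq> UNIV" for F
      using max that by blast
  qed (use tup ideals J po in auto)
qed

end

theorem theoremA:
  fixes X :: "nat ^ 'd::finite \<Rightarrow> ('a::cstar_algebra, 'x::complex_vector) corr"
    and \<iota> :: "'a \<Rightarrow> 'x"
    and T :: "nat ^ 'd \<Rightarrow> nat ^ 'd \<Rightarrow> ('a, 't::complex_vector) corr"
    and \<tau> :: "nat ^ 'd \<Rightarrow> nat ^ 'd \<Rightarrow> 'x \<Rightarrow> 'x \<Rightarrow> 't"
    and u :: "nat ^ 'd \<Rightarrow> nat ^ 'd \<Rightarrow> 't \<Rightarrow> 'x"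
  assumes "product_system X \<iota> T \<tau> u"
    and "proper X"
  shows "(\<forall>L. is_tuple L \<longrightarrow> (NT_tuple X L \<longleftrightarrow> T_family X L)) \<and>
    (\<forall>L. is_tuple L \<longrightarrow> (NO_tuple X L \<longleftrightarrow> O_family X L))"
  using product_system.NT_tuple_imp_T_family[OF assms] product_system.T_family_imp_NT_tuple[OF assms]
  unfolding NO_tuple_def O_family_def by blast

end
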